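(* A state $\rho=(\rho_n)_n$ is weak Solovay random if and only if for every $\epsilon>0$ and every $c>0$ there is $n_0$ such that for all $n\ge n_0$, $QK^{\epsilon}(\rho_n)\ge n+c$.
   Context: Let $\mathbb{U}$ be a fixed universal prefix-free Turing machine and $K$ the associated prefix-free Kolmogorov complexity. Finite sets of vectors with complex algebraic entries are coded by natural numbers via a fixed canonical effective indexing; $\mathbb{U}(\sigma)\downarrow=F$ means that $\mathbb{U}$ on input $\sigma$ halts and outputs the code of $F$. $\mathbb{C}^{2^n}_{alg}$ denotes the set of vectors in $\mathbb{C}^{2^n}$ all of whose entries are complex algebraic numbers. All logarithms are base 2. For a density matrix $\tau$ on $\mathbb{C}^{2^{n}}$ write $|\tau|=n$. For $\epsilon>0$ define $QK^{\epsilon}(\tau)=\inf\{|\sigma|+\log|F| : \mathbb{U}(\sigma)\downarrow=F,\ F \text{ an orthonormal subset of } \mathbb{C}^{2^{|\tau|}}_{alg},\ \sum_{v\in F}\langle v|\tau|v\rangle>\epsilon\}$, with $\inf\emptyset=\infty$. A state is a sequence $\rho=(\rho_n)_{n\in\mathbb{N}}$ where each $\rho_n$ is a density matrix on $\mathbb{C}^{2^n}$ and, for all $n\ge1$, the partial trace of $\rho_n$ over the last qubit equals $\rho_{n-1}$. A special projection is a Hermitian projection matrix with complex algebraic entries (these can be effectively coded by natural numbers, so computable sequences of them make sense). For a special projection $S$ on $\mathbb{C}^{2^n}$ put $\tau(S)=2^{-n}\operatorname{Tr}(S)$ and, for a state $\rho$, $\rho(S)=\operatorname{Tr}(\rho_nS)$.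 A strong Solovay test is a computable sequence $(S^m)_m$ of special projections with $\sum_m\tau(S^m)<\infty$. A state $\rho$ fails $(S^m)_m$ at level $\epsilon>0$ if $\rho(S^m)>\epsilon$ for infinitely many $m$; it passes the test if it fails it at no $\epsilon>0$. A state is weak Solovay random if it passes every strong Solovay test. *)

theory Defs
  imports "HOL-Analysis.Analysis" "HOL-Computational_Algebra.Polynomial"
          "HOL-Library.Nat_Bijection"
begin

datatype recf = Zr | Sc | Id nat | Cn recf "recf list" | Pr recf recf | Mn recf

inductive eval_rf :: "recf \<Rightarrow> nat list \<Rightarrow> nat \<Rightarrow> bool" where
  zero: "eval_rf Zr xs 0"
| succ: "eval_rf Sc (x # xs) (Suc x)"
| proj: "n < length xs \<Longrightarrow> eval_rf (Id n) xs (xs ! n)"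
| comp: "list_all2 (\<lambda>g y. eval_rf g xs y) gs ys \<Longrightarrow> eval_rf f ys z \<Longrightarrow> eval_rf (Cn f gs) xs z"
| prim0: "eval_rf f xs y \<Longrightarrow> eval_rf (Pr f g) (0 # xs) y"
| primS: "eval_rf (Pr f g) (n # xs) y \<Longrightarrow> eval_rf g (n # y # xs) z \<Longrightarrow>
          eval_rf (Pr f g) (Suc n # xs) z"
| mini: "eval_rf f (n # xs) 0 \<Longrightarrow> (\<forall>m<n. \<exists>y. y > 0 \<and> eval_rf f (m # xs) y) \<Longrightarrow>
          eval_rf (Mn f) xs n"

text \<open>Effective bijective coding of bit strings by natural numbers (bijective base 2).\<close>
fun bs_code :: "bool list \<Rightarrow> nat" where
  "bs_code [] = 0"
| "bs_code (b # s) = (if b then 2 else 1) + 2 * bs_code s"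

definition partial_computable :: "(nat \<Rightarrow> nat option) \<Rightarrow> bool" where
  "partial_computable f \<longleftrightarrow> (\<exists>r. \<forall>x y. eval_rf r [x] y \<longleftrightarrow> f x = Some y)"

definition total_computable :: "(nat \<Rightarrow> nat) \<Rightarrow> bool" where
  "total_computable g \<longleftrightarrow> partial_computable (\<lambda>x. Some (g x))"

definition machine_computable :: "(bool list \<Rightarrow> nat option) \<Rightarrow> bool" where
  "machine_computable M \<longleftrightarrow> (\<exists>r. \<forall>\<sigma> y. eval_rf r [bs_code \<sigma>] y \<longleftrightarrow> M \<sigma> = Some y)"

definition prefix_free_machine :: "(bool list \<Rightarrow> nat option) \<Rightarrow> bool" where
  "prefix_free_machine M \<longleftrightarrow> machine_computable M \<and>
     (\<forall>\<sigma> \<tau>. M \<sigma> \<noteq> None \<longrightarrow> M (\<sigma> @ \<tau>) \<noteq> None \<longrightarrow> \<tau> = [])"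

definition universal_pf_machine :: "(bool list \<Rightarrow> nat option) \<Rightarrow> bool" where
  "universal_pf_machine U \<longleftrightarrow> prefix_free_machine U \<and>
     (\<forall>M. prefix_free_machine M \<longrightarrow> (\<exists>\<rho>. \<forall>\<sigma>. U (\<rho> @ \<sigma>) = M \<sigma>))"

definition rat_decode :: "nat \<Rightarrow> real" where
  "rat_decode k = (case prod_decode k of (a, b) \<Rightarrow> of_int (int_decode a) / of_nat (Suc b))"

text \<open>A code of an algebraic number: integer polynomial (coefficient list, lowest first)
  together with an open rational rectangle containing exactly one root of it.
  Invalid codes decode to 0.\<close>
definition alg_decode :: "nat \<Rightarrow> complex" where
  "alg_decode k =
    (case prod_decode k of (pc, rc) \<Rightarrow>
     (let p = Poly (map (\<lambda>c. of_int (int_decode c)) (list_decode pc)) :: complex poly;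
          bs = map rat_decode (list_decode rc);
          R = {z. poly p z = 0 \<and> length bs = 4 \<and>
                  bs!0 < Re z \<and> Re z < bs!1 \<and> bs!2 < Im z \<and> Im z < bs!3}
      in if p \<noteq> 0 \<and> card R = 1 then the_elem R else 0))"

definition vec_decode :: "nat \<Rightarrow> complex list" where
  "vec_decode k = map alg_decode (list_decode k)"

definition fset_decode :: "nat \<Rightarrow> complex list set" where
  "fset_decode k = set (map vec_decode (list_decode k))"

definition mat_rows :: "nat \<Rightarrow> complex list list" where
  "mat_rows k = map vec_decode (list_decode k)"

definition mat_dim :: "nat \<Rightarrow> nat" where
  "mat_dim k = length (mat_rows k)"

definition mat_decode :: "nat \<Rightarrow> nat \<Rightarrow> nat \<Rightarrow> complex" where
  "mat_decode k i j = mat_rows k ! i ! j"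

type_synonym cmat = "nat \<Rightarrow> nat \<Rightarrow> complex"

definition hermitian :: "nat \<Rightarrow> cmat \<Rightarrow> bool" where
  "hermitian d A \<longleftrightarrow> (\<forall>i<d. \<forall>j<d. A j i = cnj (A i j))"

definition mmult :: "nat \<Rightarrow> cmat \<Rightarrow> cmat \<Rightarrow> cmat" where
  "mmult d A B = (\<lambda>i j. \<Sum>k<d. A i k * B k j)"

definition mtrace :: "nat \<Rightarrow> cmat \<Rightarrow> complex" where
  "mtrace d A = (\<Sum>i<d. A i i)"

definition qform :: "nat \<Rightarrow> cmat \<Rightarrow> (nat \<Rightarrow> complex) \<Rightarrow> complex" where
  "qform d A v = (\<Sum>i<d. \<Sum>j<d. cnj (v i) * A i j * v j)"

definition density_matrix :: "nat \<Rightarrow> cmat \<Rightarrow> bool" where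
  "density_matrix n A \<longleftrightarrow> hermitian (2^n) A \<and>
     (\<forall>v. Re (qform (2^n) A v) \<ge> 0) \<and> mtrace (2^n) A = 1"

text \<open>Partial trace over the last qubit: C^(2^(n+1)) = C^(2^n) (x) C^2, the last qubit
  being the least significant bit of the basis index.\<close>
definition ptrace_last :: "cmat \<Rightarrow> cmat" where
  "ptrace_last A = (\<lambda>i j. A (2*i) (2*j) + A (2*i+1) (2*j+1))"

definition is_state :: "(nat \<Rightarrow> cmat) \<Rightarrow> bool" where
  "is_state \<rho> \<longleftrightarrow> (\<forall>n. density_matrix n (\<rho> n)) \<and>
     (\<forall>n. \<forall>i<2^n. \<forall>j<2^n. ptrace_last (\<rho> (Suc n)) i j = \<rho> n i j)"

definition cinner :: "complex list \<Rightarrow> complex list \<Rightarrow> complex" where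
  "cinner v w = (\<Sum>i<length v. cnj (v ! i) * w ! i)"

definition orthonormal_alg :: "nat \<Rightarrow> complex list set \<Rightarrow> bool" where
  "orthonormal_alg d F \<longleftrightarrow> (\<forall>v\<in>F. length v = d \<and> (\<forall>x\<in>set v. algebraic x)) \<and>
     (\<forall>v\<in>F. \<forall>w\<in>F. cinner v w = (if v = w then 1 else 0))"

definition QK :: "(bool list \<Rightarrow> nat option) \<Rightarrow> real \<Rightarrow> nat \<Rightarrow> cmat \<Rightarrow> ereal" where
  "QK U eps n \<tau> = Inf {ereal (real (length \<sigma>) + log 2 (real (card F))) | \<sigma> F.
      (\<exists>k. U \<sigma> = Some k \<and> fset_decode k = F) \<and> orthonormal_alg (2^n) F \<and>
      (\<Sum>v\<in>F. Re (qform (2^n) \<tau> (\<lambda>i. v ! i))) > eps}"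

definition special_proj_code :: "nat \<Rightarrow> bool" where
  "special_proj_code k \<longleftrightarrow> (\<exists>n. mat_dim k = 2^n) \<and>
     (\<forall>r\<in>set (mat_rows k). length r = mat_dim k) \<and>
     hermitian (mat_dim k) (mat_decode k) \<and>
     (\<forall>i<mat_dim k. \<forall>j<mat_dim k. mmult (mat_dim k) (mat_decode k) (mat_decode k) i j = mat_decode k i j)"

definition tau_proj :: "nat \<Rightarrow> real" where
  "tau_proj k = Re (mtrace (mat_dim k) (mat_decode k)) / real (mat_dim k)"

definition state_val :: "(nat \<Rightarrow> cmat) \<Rightarrow> nat \<Rightarrow> real" where
  "state_val \<rho> k = Re (mtrace (mat_dim k) (mmult (mat_dim k) (\<rho> (THE n. mat_dim k = 2^n)) (mat_decode k)))"

definition strong_solovay_test :: "(nat \<Rightarrow> nat) \<Rightarrow> bool" where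
  "strong_solovay_test g \<longleftrightarrow> total_computable g \<and> (\<forall>m. special_proj_code (g m)) \<and>
     summable (\<lambda>m. tau_proj (g m))"

definition fails_test :: "(nat \<Rightarrow> cmat) \<Rightarrow> (nat \<Rightarrow> nat) \<Rightarrow> real \<Rightarrow> bool" where
  "fails_test \<rho> g eps \<longleftrightarrow> (\<exists>\<^sub>\<infinity>m. state_val \<rho> (g m) > eps)"

definition weak_solovay_random :: "(nat \<Rightarrow> cmat) \<Rightarrow> bool" where
  "weak_solovay_random \<rho> \<longleftrightarrow> (\<forall>g. strong_solovay_test g \<longrightarrow> (\<forall>eps>0. \<not> fails_test \<rho> g eps))"

end

theory Submission
  imports Defs "HOL-Computational_Algebra.Fundamental_Theorem_Algebra"
    "HOL-Computational_Algebra.Polynomial_Factorial" "HOL-Computational_Algebra.Field_as_Ring"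
begin

text \<open>
  If \<open>QK\<close> is small infinitely often, then the orthonormal sets \<open>F\<close> output by \<open>U\<close> on short programs
  give projections of small trace, and Kraft's inequality bounds the sum of the traces. Conversely,
  orthonormal bases of the ranges of the projections of a test are output by a prefix-free machine
  obtained from the Kraft-Chaitin construction.

  Both directions avoid exact arithmetic with algebraic numbers: the projections and bases are
  replaced by approximations of the same rank that are spanned by orthogonal Gaussian integer
  vectors, which exist by Gram-Schmidt over the Gaussian rationals. Hence all that is needed of the
  coding of algebraic numbers is that the coded numbers are uniformly computable to any precision.
  As invalid codes denote \<open>0\<close>, this requires deciding whether a root lies on the boundary of a
  rectangle, which is done by searching for a certificate.
\<close>


section \<open>Total recursive functions\<close>

text \<open>Rounding costs part of the threshold, so each direction passes from \<open>eps\<close>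
  to \<open>eps / 2\<close>; this is harmless since both sides quantify over all levels. The rank
  must not grow, because it enters the trace and \<open>log |F|\<close>; hence projections are
  replaced by lists of orthogonal vectors whose length is the rank, not by arbitrary nearby
  matrices. Whether an output of \<open>U\<close> is exactly orthonormal is never decided. The test
  accepts any orthogonal list that is close to the output and short enough, so its trace is bounded
  by its own length whatever \<open>U\<close> printed; orthonormality is used only to estimate the
  value of the state. In the other direction the additive constant absorbs the simulation prefix,
  the scaling of the total trace to at most 1 and the rounding of word lengths. Both contradictions
  need unboundedly many qubits: for the test because the bound fails at arbitrarily large
  \<open>n\<close>, for the machine because a nonzero projection on \<open>n\<close> qubits has
  normalised trace at least \<open>1 / 2 ^ n\<close> while the traces tend to 0.\<close>

lemma eval_Zr: "eval_rf Zr xs y \<longleftrightarrow> y = 0"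
  by (subst eval_rf.simps) auto

lemma eval_Sc: "eval_rf Sc (x # xs) y \<longleftrightarrow> y = Suc x"
  by (subst eval_rf.simps) auto

lemma eval_Sc_Nil: "\<not> eval_rf Sc [] y"
  by (subst eval_rf.simps) auto

lemma eval_Id: "eval_rf (Id n) xs y \<longleftrightarrow> n < length xs \<and> y = xs ! n"
  by (subst eval_rf.simps) auto

lemma eval_Cn: "eval_rf (Cn f gs) xs z \<longleftrightarrow>
    (\<exists>ys. list_all2 (\<lambda>g y. eval_rf g xs y) gs ys \<and> eval_rf f ys z)"
  by (subst eval_rf.simps) auto

lemma eval_Pr_Nil: "\<not> eval_rf (Pr f g) [] y"
  by (subst eval_rf.simps) auto

lemma eval_Pr_0: "eval_rf (Pr f g) (0 # xs) y \<longleftrightarrow> eval_rf f xs y"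
  by (subst eval_rf.simps) auto

lemma eval_Pr_Suc: "eval_rf (Pr f g) (Suc n # xs) z \<longleftrightarrow>
    (\<exists>y. eval_rf (Pr f g) (n # xs) y \<and> eval_rf g (n # y # xs) z)"
  by (subst eval_rf.simps) auto

lemma eval_Mn: "eval_rf (Mn f) xs n \<longleftrightarrow>
    eval_rf f (n # xs) 0 \<and> (\<forall>m<n. \<exists>y. y > 0 \<and> eval_rf f (m # xs) y)"
  by (subst eval_rf.simps) auto

text \<open>The equivalence expresses totality and single-valuedness of \<open>r\<close> on lists of
  length \<open>k\<close> at once, so determinism of \<open>eval_rf\<close> needs no separate
  proof.\<close>

definition realizes :: "nat \<Rightarrow> recf \<Rightarrow> (nat list \<Rightarrow> nat) \<Rightarrow> bool" where
  "realizes k r f \<longleftrightarrow> (\<forall>xs y. length xs = k \<longrightarrow> (eval_rf r xs y \<longleftrightarrow> y = f xs))"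

definition recursive :: "nat \<Rightarrow> (nat list \<Rightarrow> nat) \<Rightarrow> bool" where
  "recursive k f \<longleftrightarrow> (\<exists>r. realizes k r f)"

lemma realizes_list_all2:
  assumes "list_all2 (realizes k) rs gs" "length xs = k"
  shows "list_all2 (\<lambda>r y. eval_rf r xs y) rs ys \<longleftrightarrow> ys = map (\<lambda>g. g xs) gs"
  using assms(1)
proof (induction arbitrary: ys rule: list_all2_induct)
  case Nil
  then show ?case by auto
next
  case (Cons r rs g gs)
  then show ?case using assms(2) by (cases ys) (auto simp: realizes_def)
qed

lemma realizes_Cn:
  assumes "realizes (length gs) r f" "list_all2 (realizes k) rs gs"
  shows "realizes k (Cn r rs) (\<lambda>xs. f (map (\<lambda>g. g xs) gs))"
  using assms(1) realizes_list_all2[OF assms(2)]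
  by (auto simp: realizes_def eval_Cn)

lemma recursive_cong:
  assumes "recursive k f" "\<And>xs. length xs = k \<Longrightarrow> f xs = g xs"
  shows "recursive k g"
  using assms by (auto simp: recursive_def realizes_def)

lemma recursive_comp:
  assumes "recursive (length gs) f" "\<And>g. g \<in> set gs \<Longrightarrow> recursive k g"
  shows "recursive k (\<lambda>xs. f (map (\<lambda>g. g xs) gs))"
proof -
  obtain r where r: "realizes (length gs) r f" using assms(1) by (auto simp: recursive_def)
  have "\<exists>rs. list_all2 (realizes k) rs gs"
    using assms(2)
  proof (induction gs)
    case (Cons g gs)
    then obtain rs where "list_all2 (realizes k) rs gs" by auto
    moreover obtain r where "realizes k r g" using Cons.prems by (auto simp: recursive_def)
    ultimately show ?case by (intro exI[of _ "r # rs"]) auto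
  qed auto
  then obtain rs where "list_all2 (realizes k) rs gs" ..
  from realizes_Cn[OF r this] show ?thesis by (auto simp: recursive_def)
qed

lemma recursive_nth: "i < k \<Longrightarrow> recursive k (\<lambda>xs. xs ! i)"
  by (auto simp: recursive_def realizes_def eval_Id intro!: exI[of _ "Id i"])

lemma recursive_Suc: "recursive k g \<Longrightarrow> recursive k (\<lambda>xs. Suc (g xs))"
proof -
  have "recursive 1 (\<lambda>xs. Suc (hd xs))"
    unfolding recursive_def realizes_def
    by (rule exI[of _ Sc]) (auto simp: length_Suc_conv eval_Sc)
  then show "recursive k g \<Longrightarrow> ?thesis"
    using recursive_comp[of "[g]" "\<lambda>xs. Suc (hd xs)" k] by simp
qed

lemma recursive_const: "recursive k (\<lambda>xs. c)"
proof (induction c)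
  case 0
  then show ?case by (auto simp: recursive_def realizes_def eval_Zr intro!: exI[of _ Zr])
qed (rule recursive_Suc)

lemma recursive_comp1:
  assumes "recursive 1 (\<lambda>xs. f (xs ! 0))" "recursive k g"
  shows "recursive k (\<lambda>xs. f (g xs))"
  using recursive_comp[of "[g]" "\<lambda>xs. f (xs ! 0)" k] assms by simp

lemma recursive_comp2:
  assumes "recursive 2 (\<lambda>xs. f (xs ! 0) (xs ! 1))" "recursive k g" "recursive k h"
  shows "recursive k (\<lambda>xs. f (g xs) (h xs))"
  using recursive_comp[of "[g, h]" "\<lambda>xs. f (xs ! 0) (xs ! 1)" k] assms
  by (auto simp: numeral_2_eq_2)

lemma recursive_rec_nat:
  assumes b: "recursive k b" and s: "recursive (Suc (Suc k)) s" and n: "recursive k n"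
  shows "recursive k (\<lambda>xs. rec_nat (b xs) (\<lambda>i y. s (i # y # xs)) (n xs))"
proof -
  obtain rb rs where rb: "realizes k rb b" and rs: "realizes (Suc (Suc k)) rs s"
    using b s by (auto simp: recursive_def)
  have *: "eval_rf (Pr rb rs) (m # xs) y \<longleftrightarrow> y = rec_nat (b xs) (\<lambda>i y. s (i # y # xs)) m"
    if "length xs = k" for m xs y
    using that
  proof (induction m arbitrary: y)
    case 0
    then show ?case using rb by (auto simp: eval_Pr_0 realizes_def)
  next
    case (Suc m)
    then show ?case using rs by (auto simp: eval_Pr_Suc realizes_def)
  qed
  have "recursive (Suc k) (\<lambda>xs. rec_nat (b (tl xs)) (\<lambda>i y. s (i # y # tl xs)) (hd xs))"
    unfolding recursive_def realizes_def
    by (rule exI[of _ "Pr rb rs"]) (auto simp: length_Suc_conv *)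
  \<comment> \<open>Primitive recursion runs on the head of the argument list; composing with
    \<open>n\<close> and the projections places the bound there and hands on the parameters.\<close>
  then have "recursive (length (n # map (\<lambda>i xs. xs ! i) [0..<k]))
      (\<lambda>xs. rec_nat (b (tl xs)) (\<lambda>i y. s (i # y # tl xs)) (hd xs))"
    by simp
  from recursive_comp[OF this, of k]
  have "recursive k (\<lambda>xs. rec_nat (b (map (\<lambda>i. xs ! i) [0..<k]))
      (\<lambda>i y. s (i # y # (map (\<lambda>i. xs ! i) [0..<k]))) (n xs))"
    using n recursive_nth[of _ k] by (force simp: o_def)
  moreover have "map (\<lambda>i. xs ! i) [0..<k] = xs" if "length xs = k" for xs :: "nat list"
    using map_nth[of xs] that by simp
  ultimately show ?thesis by (elim recursive_cong) simp
qed

text \<open>\<open>Mn\<close> asks for positive values below its result. As \<open>p\<close> is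
  total, these are available below the least zero, so the existence of a zero is all that
  termination needs.\<close>

lemma recursive_Least:
  assumes p: "recursive (Suc k) p" and ex: "\<And>xs. length xs = k \<Longrightarrow> \<exists>n. p (n # xs) = 0"
  shows "recursive k (\<lambda>xs. LEAST n. p (n # xs) = 0)"
proof -
  obtain r where r: "realizes (Suc k) r p" using p by (auto simp: recursive_def)
  have "eval_rf (Mn r) xs y \<longleftrightarrow> y = (LEAST n. p (n # xs) = 0)" if "length xs = k" for xs y
  proof -
    have "eval_rf (Mn r) xs y \<longleftrightarrow> p (y # xs) = 0 \<and> (\<forall>m<y. p (m # xs) > 0)"
      using r that by (auto simp: eval_Mn realizes_def)
    also have "\<dots> \<longleftrightarrow> y = (LEAST n. p (n # xs) = 0)"
      using ex[OF that] by (metis (mono_tags, lifting) LeastI_ex Least_equality not_less_Least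
          gr0I leI less_numeral_extra(3))
    finally show ?thesis .
  qed
  then show ?thesis by (auto simp: recursive_def realizes_def)
qed

lemma recursive_add:
  assumes "recursive k f" "recursive k g"
  shows "recursive k (\<lambda>xs. f xs + g xs)"
proof -
  have "recursive k (\<lambda>xs. rec_nat (g xs) (\<lambda>i y. Suc ((i # y # xs) ! 1)) (f xs))"
    by (intro recursive_rec_nat recursive_Suc recursive_nth assms) auto
  moreover have "rec_nat b (\<lambda>i y. Suc y) a = a + b" for a b by (induction a) auto
  ultimately show ?thesis by simp
qed

lemma recursive_mult:
  assumes "recursive k f" "recursive k g"
  shows "recursive k (\<lambda>xs. f xs * g xs)"
proof -
  have "recursive 2 (\<lambda>xs. rec_nat 0 (\<lambda>i y. (i # y # xs) ! 1 + (i # y # xs) ! 3) (xs ! 0))"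
    by (intro recursive_rec_nat recursive_add recursive_nth recursive_const) auto
  moreover have "rec_nat 0 (\<lambda>i y. y + b) a = a * b" for a b :: nat by (induction a) auto
  ultimately have "recursive 2 (\<lambda>xs. xs ! 0 * xs ! 1)" by (simp add: eval_nat_numeral)
  from recursive_comp2[OF this assms] show ?thesis .
qed

lemma recursive_pred:
  assumes "recursive k f"
  shows "recursive k (\<lambda>xs. f xs - 1)"
proof -
  have "recursive k (\<lambda>xs. rec_nat 0 (\<lambda>i y. (i # y # xs) ! 0) (f xs))"
    by (intro recursive_rec_nat recursive_nth recursive_const assms) auto
  moreover have "rec_nat 0 (\<lambda>i y. i) a = a - 1" for a :: nat by (cases a) auto
  ultimately show ?thesis by simp
qed

lemma recursive_diff:
  assumes "recursive k f" "recursive k g"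
  shows "recursive k (\<lambda>xs. f xs - g xs)"
proof -
  have "recursive k (\<lambda>xs. rec_nat (f xs) (\<lambda>i y. (i # y # xs) ! 1 - 1) (g xs))"
    by (intro recursive_rec_nat recursive_nth recursive_pred assms) auto
  moreover have "rec_nat a (\<lambda>i y. y - 1) b = a - b" for a b :: nat by (induction b) auto
  ultimately show ?thesis by simp
qed

lemma triangle_rec_nat: "triangle n = rec_nat 0 (\<lambda>i y. Suc i + y) n"
  by (induction n) auto

lemma recursive_triangle: "recursive k f \<Longrightarrow> recursive k (\<lambda>xs. triangle (f xs))"
proof -
  assume "recursive k f"
  then have "recursive k (\<lambda>xs. rec_nat 0 (\<lambda>i y. Suc ((i # y # xs) ! 0) + (i # y # xs) ! 1) (f xs))"
    by (intro recursive_rec_nat recursive_add recursive_Suc recursive_nth recursive_const) auto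
  then show ?thesis by (simp add: triangle_rec_nat)
qed

lemma recursive_prod_encode:
  "recursive k f \<Longrightarrow> recursive k g \<Longrightarrow> recursive k (\<lambda>xs. prod_encode (f xs, g xs))"
  by (simp add: prod_encode_def recursive_add recursive_triangle)

lemma triangle_mono: "m \<le> n \<Longrightarrow> triangle m \<le> triangle n"
  by (induction n) (auto simp: le_Suc_eq)

text \<open>The diagonal of the pairing function on which \<open>z\<close> lies is the least
  \<open>s\<close> with \<open>z < triangle (Suc s)\<close>. The inequality is written as a
  vanishing truncated difference because \<open>recursive_Least\<close> searches for a zero.\<close>

lemma triangle_prod_decode:
  assumes "prod_decode z = (m, n)"
  shows "(LEAST s. Suc z - triangle (Suc s) = 0) = m + n"
proof -
  have z: "z = triangle (m + n) + m"
    using prod_decode_inverse[of z] assms by (simp add: prod_encode_def)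
  show ?thesis
  proof (rule Least_equality)
    show "Suc z - triangle (Suc (m + n)) = 0" by (simp add: z)
  next
    fix s assume "Suc z - triangle (Suc s) = 0"
    then have "triangle (m + n) < triangle (Suc s)" by (simp add: z)
    then show "m + n \<le> s" using triangle_mono[of "Suc s" "m + n"] by (meson not_less not_less_eq_eq)
  qed
qed

lemma recursive_prod_decode_sum:
  "recursive k f \<Longrightarrow> recursive k (\<lambda>xs. case prod_decode (f xs) of (m, n) \<Rightarrow> m + n)"
proof -
  have "recursive 1 (\<lambda>xs. LEAST s. Suc ((s # xs) ! 1) - triangle (Suc ((s # xs) ! 0)) = 0)"
  proof (rule recursive_Least)
    show "recursive (Suc 1) (\<lambda>xs. Suc (xs ! 1) - triangle (Suc (xs ! 0)))"
      by (intro recursive_diff recursive_Suc recursive_triangle recursive_nth) auto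
  next
    fix xs :: "nat list"
    have "n \<le> triangle n" for n by (induction n) auto
    then show "\<exists>n. Suc ((n # xs) ! 1) - triangle (Suc ((n # xs) ! 0)) = 0"
      by (intro exI[of _ "xs ! 0"]) simp
  qed
  then have "recursive 1 (\<lambda>xs. case prod_decode (xs ! 0) of (m, n) \<Rightarrow> m + n)"
    by (rule recursive_cong) (use triangle_prod_decode in \<open>auto split: prod.splits\<close>)
  from recursive_comp1[OF this] show "recursive k f \<Longrightarrow> ?thesis" .
qed

lemma recursive_fst_prod_decode:
  "recursive k f \<Longrightarrow> recursive k (\<lambda>xs. fst (prod_decode (f xs)))"
proof -
  assume f: "recursive k f"
  have "recursive k (\<lambda>xs. f xs - triangle (case prod_decode (f xs) of (m, n) \<Rightarrow> m + n))"
    by (intro recursive_diff recursive_triangle recursive_prod_decode_sum f)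
  moreover have "z - triangle (case prod_decode z of (m, n) \<Rightarrow> m + n) = fst (prod_decode z)" for z
    using prod_decode_inverse[of z] by (cases "prod_decode z") (auto simp: prod_encode_def)
  ultimately show ?thesis by simp
qed

lemma recursive_snd_prod_decode:
  "recursive k f \<Longrightarrow> recursive k (\<lambda>xs. snd (prod_decode (f xs)))"
proof -
  assume f: "recursive k f"
  have "recursive k (\<lambda>xs. (case prod_decode (f xs) of (m, n) \<Rightarrow> m + n) - fst (prod_decode (f xs)))"
    by (intro recursive_diff recursive_fst_prod_decode recursive_prod_decode_sum f)
  then show ?thesis by (simp add: case_prod_beta)
qed

lemma total_computable_iff: "total_computable g \<longleftrightarrow> recursive 1 (\<lambda>xs. g (xs ! 0))"
proof -
  have "(\<forall>x y. eval_rf r [x] y \<longleftrightarrow> y = g x) \<longleftrightarrow> realizes 1 r (\<lambda>xs. g (xs ! 0))" for r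
    by (auto simp: realizes_def length_Suc_conv)
  then show ?thesis
    by (auto simp: total_computable_def partial_computable_def recursive_def eq_commute)
qed

lemma total_computable_recursive:
  "total_computable g \<Longrightarrow> recursive k f \<Longrightarrow> recursive k (\<lambda>xs. g (f xs))"
  by (simp add: total_computable_iff recursive_comp1)

section \<open>Computable functions between encodable types\<close>

class encodable =
  fixes enc :: "'a \<Rightarrow> nat" and dec :: "nat \<Rightarrow> 'a"
  assumes dec_enc [simp]: "dec (enc x) = x"

text \<open>Surjectivity of \<open>enc\<close> makes \<open>dec\<close> the identity on codes and
  hence computable. Element types of folded lists and arguments of searches belong to this class
  because there every number has to be readable as a code.\<close>

class bij_encodable = encodable +
  assumes enc_dec [simp]: "enc (dec n) = n"

lemma enc_inject [simp]: "enc x = enc y \<longleftrightarrow> x = y"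
  by (metis dec_enc)

instantiation nat :: bij_encodable
begin
definition "enc (n :: nat) = n"
definition "dec (n :: nat) = n"
instance by standard (auto simp: enc_nat_def dec_nat_def)
end

instantiation int :: bij_encodable
begin
definition "enc = int_encode"
definition "dec = int_decode"
instance by standard (auto simp: enc_int_def dec_int_def)
end

instantiation bool :: encodable
begin
definition "enc b = (if b then 1 else 0 :: nat)"
definition "dec (n :: nat) = (n \<noteq> 0)"
instance by standard (auto simp: enc_bool_def dec_bool_def)
end

instantiation prod :: (encodable, encodable) encodable
begin
definition "enc p = prod_encode (enc (fst p), enc (snd p))"
definition "dec n = map_prod dec dec (prod_decode n)"
instance by standard (auto simp: enc_prod_def dec_prod_def)
end

instance prod :: (bij_encodable, bij_encodable) bij_encodable
  by standard (auto simp: enc_prod_def dec_prod_def)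

text \<open>Built on \<open>list_encode\<close>, so that \<open>enc\<close> of nested lists of
  numbers agrees with the given coding of vectors, matrices and finite sets.\<close>

instantiation list :: (encodable) encodable
begin
definition "enc xs = list_encode (map enc xs)"
definition "dec n = map dec (list_decode n)"
instance by standard (auto simp: enc_list_def dec_list_def o_def)
end

instance list :: (bij_encodable) bij_encodable
  by standard (auto simp: enc_list_def dec_list_def o_def)

text \<open>The realiser \<open>g\<close> is unconstrained off the image of \<open>enc\<close>, so a
  type whose coding has gaps, such as \<open>bool\<close>, creates no extra obligation.\<close>

definition computable :: "('a::encodable \<Rightarrow> 'b::encodable) \<Rightarrow> bool" where
  "computable f \<longleftrightarrow> (\<exists>g. total_computable g \<and> (\<forall>x. g (enc x) = enc (f x)))"

text \<open>Syntax-directed introduction rules: computability of a definition is proved by unfolding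
  it. This is why later definitions are written with \<open>fst\<close>, \<open>snd\<close> and
  \<open>get\<close> instead of pattern matching and \<open>!\<close>.\<close>

named_theorems comp_intros

lemma computableI: "total_computable g \<Longrightarrow> (\<And>x. g (enc x) = enc (f x)) \<Longrightarrow> computable f"
  by (auto simp: computable_def)

lemma computable_nat_iff: "computable f \<longleftrightarrow> total_computable f" for f :: "nat \<Rightarrow> nat"
proof
  assume "computable f"
  then obtain g where "total_computable g" "\<forall>x. g x = f x"
    by (auto simp: computable_def enc_nat_def)
  moreover have "g = f" using \<open>\<forall>x. g x = f x\<close> by auto
  ultimately show "total_computable f" by simp
qed (auto simp: computable_def enc_nat_def)

lemma computable_id [comp_intros]: "computable (\<lambda>x. x)"
  by (rule computableI[of "\<lambda>x. x"]) (auto simp: total_computable_iff recursive_nth)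

lemma computable_const [comp_intros]: "computable (\<lambda>x. c)"
  by (rule computableI[of "\<lambda>x. enc c"]) (auto simp: total_computable_iff recursive_const)

lemma computable_comp:
  assumes "computable f" "computable g"
  shows "computable (\<lambda>x. f (g x))"
proof -
  obtain f' g' where "total_computable f'" "\<forall>x. f' (enc x) = enc (f x)"
     "total_computable g'" "\<forall>x. g' (enc x) = enc (g x)"
    using assms by (auto simp: computable_def)
  then show ?thesis
    by (intro computableI[of "\<lambda>x. f' (g' x)"])
      (auto simp: total_computable_iff intro: recursive_comp1)
qed

lemma computable_dec [comp_intros]:
  "computable f \<Longrightarrow> computable (\<lambda>x. dec (f x) :: 'b :: bij_encodable)"
  by (rule computable_comp[of dec], rule computableI[of "\<lambda>x. x"])
    (auto simp: total_computable_iff recursive_nth enc_nat_def)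

lemma computable_enc [comp_intros]: "computable f \<Longrightarrow> computable (\<lambda>x. enc (f x))"
  by (rule computable_comp[of enc], rule computableI[of "\<lambda>x. x"])
    (auto simp: total_computable_iff recursive_nth enc_nat_def)

lemma computable_Pair [comp_intros]:
  assumes "computable f" "computable g"
  shows "computable (\<lambda>x. (f x, g x))"
proof -
  obtain f' g' where "total_computable f'" "\<forall>x. f' (enc x) = enc (f x)"
     "total_computable g'" "\<forall>x. g' (enc x) = enc (g x)"
    using assms by (auto simp: computable_def)
  then show ?thesis
    by (intro computableI[of "\<lambda>x. prod_encode (f' x, g' x)"])
      (auto simp: total_computable_iff enc_prod_def intro: recursive_prod_encode)
qed

lemma computable_fst [comp_intros]: "computable f \<Longrightarrow> computable (\<lambda>x. fst (f x))"
  by (rule computable_comp[of fst], rule computableI[of "\<lambda>x. fst (prod_decode x)"])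
    (auto simp: total_computable_iff enc_prod_def intro!: recursive_fst_prod_decode recursive_nth)

lemma computable_snd [comp_intros]: "computable f \<Longrightarrow> computable (\<lambda>x. snd (f x))"
  by (rule computable_comp[of snd], rule computableI[of "\<lambda>x. snd (prod_decode x)"])
    (auto simp: total_computable_iff enc_prod_def intro!: recursive_snd_prod_decode recursive_nth)

lemma computable_comp2:
  assumes "computable (\<lambda>p. h (fst p) (snd p))" "computable f" "computable g"
  shows "computable (\<lambda>x. h (f x) (g x))"
  using computable_comp[OF assms(1) computable_Pair[OF assms(2,3)]] by simp

lemma computable_comp3:
  assumes "computable (\<lambda>p. h (fst p) (fst (snd p)) (snd (snd p)))"
    "computable f" "computable g" "computable k"
  shows "computable (\<lambda>x. h (f x) (g x) (k x))"
  using computable_comp[OF assms(1) computable_Pair[OF assms(2) computable_Pair[OF assms(3,4)]]]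
  by simp

lemma computable_Suc [comp_intros]: "computable f \<Longrightarrow> computable (\<lambda>x. Suc (f x))"
  by (rule computable_comp[of Suc], rule computableI[of Suc])
    (auto simp: total_computable_iff enc_nat_def intro!: recursive_Suc recursive_nth)

lemma computable_binop:
  fixes F :: "nat \<Rightarrow> nat \<Rightarrow> nat"
  assumes "\<And>k f g. recursive k f \<Longrightarrow> recursive k g \<Longrightarrow> recursive k (\<lambda>xs. F (f xs) (g xs))"
    and "computable f" "computable g"
  shows "computable (\<lambda>x. F (f x) (g x))"
proof (rule computable_comp2[of F])
  show "computable (\<lambda>p. F (fst p) (snd p))"
    by (rule computableI[of "\<lambda>x. F (fst (prod_decode x)) (snd (prod_decode x))"])
      (auto simp: total_computable_iff enc_prod_def enc_nat_def
        intro!: assms(1) recursive_fst_prod_decode recursive_snd_prod_decode recursive_nth)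
qed (use assms in auto)

lemma computable_add [comp_intros]:
  "computable f \<Longrightarrow> computable g \<Longrightarrow> computable (\<lambda>x. f x + g x :: nat)"
  by (rule computable_binop[of "(+)"]) (auto intro: recursive_add)

lemma computable_mult [comp_intros]:
  "computable f \<Longrightarrow> computable g \<Longrightarrow> computable (\<lambda>x. f x * g x :: nat)"
  by (rule computable_binop[of "(*)"]) (auto intro: recursive_mult)

lemma computable_diff [comp_intros]:
  "computable f \<Longrightarrow> computable g \<Longrightarrow> computable (\<lambda>x. f x - g x :: nat)"
  by (rule computable_binop[of "(-)"]) (auto intro: recursive_diff)

lemma computable_rec_nat [comp_intros]:
  fixes b :: "'a::encodable \<Rightarrow> 'b::encodable"
  assumes "computable b" "computable (\<lambda>p. s (fst p) (fst (snd p)) (snd (snd p)))" "computable n"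
  shows "computable (\<lambda>x. rec_nat (b x) (\<lambda>i y. s x i y) (n x))"
proof -
  obtain b' s' n' where b': "total_computable b'" "\<And>x. b' (enc x) = enc (b x)"
    and s': "total_computable s'" "\<And>p. s' (enc p) = enc (s (fst p) (fst (snd p)) (snd (snd p)))"
    and n': "total_computable n'" "\<And>x. n' (enc x) = enc (n x)"
    using assms unfolding computable_def by metis
  have "recursive 1 (\<lambda>xs. rec_nat (b' (xs ! 0)) (\<lambda>i y. s' (prod_encode ((i # y # xs) ! 2,
      prod_encode ((i # y # xs) ! 0, (i # y # xs) ! 1)))) (n' (xs ! 0)))"
    by (intro recursive_rec_nat total_computable_recursive[OF b'(1)]
        total_computable_recursive[OF s'(1)] total_computable_recursive[OF n'(1)]
        recursive_prod_encode recursive_nth) auto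
  then have "total_computable
      (\<lambda>x. rec_nat (b' x) (\<lambda>i y. s' (prod_encode (x, prod_encode (i, y)))) (n' x))"
    by (simp add: total_computable_iff numeral_2_eq_2)
  moreover have "rec_nat (b' (enc x)) (\<lambda>i y. s' (prod_encode (enc x, prod_encode (i, y)))) m
      = enc (rec_nat (b x) (s x) m)" for x m
  proof (induction m)
    case (Suc m)
    have "s' (prod_encode (enc x, prod_encode (m, enc y))) = enc (s x m y)" for y
      using s'(2)[of "(x, m, y)"] by (simp add: enc_prod_def enc_nat_def)
    then show ?case using Suc by simp
  qed (simp add: b')
  ultimately show ?thesis
    by (intro computableI) (auto simp: n'(2) enc_nat_def)
qed

text \<open>A case distinction is a primitive recursion whose number of iterations is the code 0 or
  1 of the condition.\<close>

lemma computable_if [comp_intros]: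
  fixes f :: "'a::encodable \<Rightarrow> 'b::encodable"
  assumes "computable P" "computable f" "computable g"
  shows "computable (\<lambda>x. if P x then f x else g x)"
proof -
  have "computable (\<lambda>x. rec_nat (g x) (\<lambda>i y. f x) (enc (P x)))"
    by (intro comp_intros assms computable_comp[OF assms(2)])
  moreover have "rec_nat (g x) (\<lambda>i y. f x) (enc (P x)) = (if P x then f x else g x)" for x
    by (auto simp: enc_bool_def)
  ultimately show ?thesis by simp
qed

lemma computable_pos:
  assumes "computable f"
  shows "computable (\<lambda>x. f x > (0::nat))"
proof -
  have "computable (\<lambda>n::nat. n > 0)"
    by (rule computableI[of "\<lambda>n. 1 - (1 - n)"])
      (auto simp: total_computable_iff enc_bool_def enc_nat_def
        intro!: recursive_diff recursive_nth recursive_const)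
  from computable_comp[OF this assms] show ?thesis .
qed

lemma computable_less [comp_intros]:
  assumes "computable f" "computable g"
  shows "computable (\<lambda>x. f x < (g x :: nat))"
  using computable_pos[OF computable_diff[OF assms(2,1)]] by simp

lemma computable_not [comp_intros]:
  assumes "computable P"
  shows "computable (\<lambda>x. \<not> P x)"
  by (rule back_subst[of computable, OF computable_if[OF assms computable_const[of False] computable_const[of True]]]) auto

lemma computable_conj [comp_intros]:
  assumes "computable P" "computable Q"
  shows "computable (\<lambda>x. P x \<and> Q x)"
  by (rule back_subst[of computable, OF computable_if[OF assms(1) assms(2) computable_const[of False]]]) auto

lemma computable_disj [comp_intros]:
  assumes "computable P" "computable Q"
  shows "computable (\<lambda>x. P x \<or> Q x)"
  by (rule back_subst[of computable, OF computable_if[OF assms(1) computable_const[of True] assms(2)]]) auto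

lemma computable_le [comp_intros]:
  assumes "computable f" "computable g"
  shows "computable (\<lambda>x. f x \<le> (g x :: nat))"
  using computable_not[OF computable_less[OF assms(2,1)]] by (simp add: not_less)

lemma computable_eq [comp_intros]:
  assumes "computable f" "computable g"
  shows "computable (\<lambda>x. f x = g x)"
proof -
  have "computable (\<lambda>x. enc (f x) \<le> enc (g x) \<and> enc (g x) \<le> enc (f x))"
    by (intro comp_intros assms)
  then show ?thesis by (simp add: order_eq_iff[symmetric])
qed

lemma computable_power [comp_intros]:
  fixes f :: "'a::encodable \<Rightarrow> nat"
  assumes "computable f" "computable g"
  shows "computable (\<lambda>x. f x ^ g x)"
proof -
  have "computable (\<lambda>x. rec_nat 1 (\<lambda>i y. f x * y) (g x))"
    by (intro comp_intros assms computable_comp[OF assms(1)])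
  moreover have "rec_nat 1 (\<lambda>i y. a * y) n = a ^ n" for a n :: nat
    by (induction n) auto
  ultimately show ?thesis by simp
qed

text \<open>The argument type is \<open>bij_encodable\<close> because the search has to succeed on
  every number; each of them must therefore be the code of some \<open>x\<close>.\<close>

lemma computable_Least [comp_intros]:
  fixes P :: "'a::bij_encodable \<Rightarrow> nat \<Rightarrow> bool"
  assumes "computable (\<lambda>p. P (fst p) (snd p))" "\<And>x. \<exists>n. P x n"
  shows "computable (\<lambda>x. LEAST n. P x n)"
proof -
  obtain p where p: "total_computable p" "\<And>q. p (enc q) = enc (P (fst q) (snd q))"
    using assms(1) unfolding computable_def by metis
  have p': "p (prod_encode (m, n)) = (if P (dec m) n then 1 else 0)" for m n
    using p(2)[of "(dec m, n)"] by (simp add: enc_prod_def enc_nat_def enc_bool_def)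
  have "recursive 1 (\<lambda>xs. LEAST n. 1 - p (prod_encode ((n # xs) ! 1, (n # xs) ! 0)) = 0)"
  proof (rule recursive_Least)
    show "recursive (Suc 1) (\<lambda>xs. 1 - p (prod_encode (xs ! 1, xs ! 0)))"
      by (intro recursive_diff recursive_const total_computable_recursive[OF p(1)]
          recursive_prod_encode recursive_nth) auto
  qed (use assms(2) in \<open>auto simp: p'\<close>)
  moreover have "1 - p (prod_encode (m, n)) = 0 \<longleftrightarrow> P (dec m) n" for m n by (simp add: p')
  ultimately have "total_computable (\<lambda>m. LEAST n. P (dec m) n)"
    by (simp add: total_computable_iff)
  then show ?thesis by (rule computableI) (simp add: enc_nat_def)
qed


lemma computable_half [comp_intros]:
  assumes "computable f"
  shows "computable (\<lambda>x. f x div (2::nat))"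
proof -
  have "computable (\<lambda>n::nat. LEAST h. n < 2 * h + 2)"
  proof (intro comp_intros)
    show "\<exists>h. n < 2 * h + 2" for n :: nat by (rule exI[of _ n]) simp
  qed
  moreover have "(LEAST h. n < 2 * h + 2) = n div 2" for n :: nat
    by (rule Least_equality) auto
  ultimately have "computable (\<lambda>n::nat. n div 2)" by simp
  from computable_comp[OF this assms] show ?thesis .
qed

lemma computable_all_less [comp_intros]:
  assumes "computable (\<lambda>p. P (fst p) (snd p))" "computable n"
  shows "computable (\<lambda>x. \<forall>i<(n x :: nat). P x i)"
proof -
  have "computable (\<lambda>x. rec_nat True (\<lambda>i b. b \<and> P x i) (n x))"
    by (intro comp_intros assms computable_comp2[OF assms(1)])
  moreover have "rec_nat True (\<lambda>i b. b \<and> Q i) m = (\<forall>i<m. Q i)" for Q m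
    by (induction m) (auto simp: less_Suc_eq)
  ultimately show ?thesis by simp
qed

section \<open>Operations on lists\<close>

lemma computable_Cons [comp_intros]:
  assumes "computable f" "computable g"
  shows "computable (\<lambda>x. f x # g x)"
proof -
  have "computable (\<lambda>p::'b \<times> 'b list. fst p # snd p)"
    by (rule computableI[of Suc])
      (auto simp: total_computable_iff enc_list_def enc_prod_def intro!: recursive_Suc recursive_nth)
  from computable_comp2[OF this assms] show ?thesis .
qed

lemma computable_tl [comp_intros]:
  assumes "computable f"
  shows "computable (\<lambda>x. tl (f x))"
proof -
  have "snd (prod_decode 0) = 0" by (simp add: prod_decode_def prod_decode_aux.simps)
  then have "snd (prod_decode (enc xs - 1)) = enc (tl xs)" for xs :: "'b list"
    by (cases xs) (auto simp: enc_list_def)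
  then have "computable (tl :: 'b list \<Rightarrow> _)"
    by (intro computableI[of "\<lambda>c. snd (prod_decode (c - 1))"])
      (auto simp: total_computable_iff intro!: recursive_snd_prod_decode recursive_pred[unfolded One_nat_def] recursive_nth)
  from computable_comp[OF this assms] show ?thesis .
qed

text \<open>The default \<open>dec 0\<close> for the empty list is what decoding yields on its code
  0, which makes the function computable, unlike \<open>hd\<close> with its unspecified
  value.\<close>

definition head :: "'a::encodable list \<Rightarrow> 'a" where
  "head xs = (if xs = [] then dec 0 else hd xs)"

definition get :: "'a::encodable list \<Rightarrow> nat \<Rightarrow> 'a" where
  "get xs i = head (drop i xs)"

lemma head_Cons [simp]: "head (x # xs) = x"
  by (simp add: head_def)

lemma get_nth: "i < length xs \<Longrightarrow> get xs i = xs ! i"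
  by (auto simp: get_def head_def hd_drop_conv_nth)

lemma computable_head [comp_intros]:
  assumes "computable f"
  shows "computable (\<lambda>x. head (f x) :: 'b::bij_encodable)"
proof -
  have "fst (prod_decode 0) = 0" by (simp add: prod_decode_def prod_decode_aux.simps)
  then have "fst (prod_decode (enc xs - 1)) = enc (head xs)" for xs :: "'b list"
    by (cases xs) (auto simp: enc_list_def head_def)
  then have "computable (head :: 'b list \<Rightarrow> _)"
    by (intro computableI[of "\<lambda>c. fst (prod_decode (c - 1))"])
      (auto simp: total_computable_iff intro!: recursive_fst_prod_decode recursive_pred[unfolded One_nat_def] recursive_nth)
  from computable_comp[OF this assms] show ?thesis .
qed

text \<open>Serves as fuel: \<open>enc xs\<close> iterations certainly exhaust \<open>xs\<close>, so
  a fold can be run by primitive recursion.\<close>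

lemma length_le_enc: "length xs \<le> enc xs"
proof (induction xs)
  case (Cons x xs)
  have "enc xs \<le> prod_encode (enc x, enc xs)" by (rule le_prod_encode_2)
  then show ?case using Cons by (simp add: enc_list_def)
qed auto

lemma computable_foldl [comp_intros]:
  fixes f :: "'a::encodable \<Rightarrow> 'b::encodable \<Rightarrow> 'c::bij_encodable \<Rightarrow> 'b"
  assumes "computable (\<lambda>p. f (fst p) (fst (snd p)) (snd (snd p)))" "computable a" "computable xs"
  shows "computable (\<lambda>x. foldl (f x) (a x) (xs x))"
proof -
  \<comment> \<open>The state is the remaining list with the accumulator. It is stationary once the
    list is empty, so surplus iterations do no harm.\<close>
  define step where "step x st = (if fst st = [] then st
      else (tl (fst st), f x (snd st) (head (fst st))))" for x and st :: "'c list \<times> 'b"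
  have step: "computable (\<lambda>p. step (fst p) (snd (snd p)))"
    unfolding step_def by (intro comp_intros computable_comp3[OF assms(1)])
  have "computable (\<lambda>x. snd (rec_nat (xs x, a x) (\<lambda>i. step x) (enc (xs x))))"
    by (intro comp_intros assms step)
  moreover have "snd (rec_nat (ys, b) (\<lambda>i. step x) n) = foldl (f x) b ys"
    if "length ys \<le> n" for x ys n b
    using that
  proof (induction ys arbitrary: n b)
    case Nil
    have "rec_nat ([], b) (\<lambda>i. step x) n = ([], b)" by (induction n) (auto simp: step_def)
    then show ?case by simp
  next
    case (Cons y ys)
    then obtain m where m: "n = Suc m" by (cases n) auto
    have "rec_nat st (\<lambda>i. step x) (Suc k) = rec_nat (step x st) (\<lambda>i. step x) k" for st k
      by (induction k) auto
    then have "rec_nat (y # ys, b) (\<lambda>i. step x) n = rec_nat (ys, f x b y) (\<lambda>i. step x) m"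
      by (simp add: m step_def del: rec_nat_Suc_imp old.nat.rec)
    then show ?case using Cons m by simp
  qed
  ultimately show ?thesis by (simp add: length_le_enc)
qed

lemma computable_rev [comp_intros]:
  fixes f :: "'a::encodable \<Rightarrow> 'b::bij_encodable list"
  assumes "computable f"
  shows "computable (\<lambda>x. rev (f x))"
proof -
  have "computable (\<lambda>x. foldl (\<lambda>acc y. y # acc) [] (f x))"
    by (intro comp_intros assms)
  then show ?thesis by (simp add: foldl_conv_fold fold_Cons_rev[simplified])
qed

lemma computable_foldr [comp_intros]:
  fixes f :: "'a::encodable \<Rightarrow> 'c::bij_encodable \<Rightarrow> 'b::encodable \<Rightarrow> 'b"
  assumes "computable (\<lambda>p. f (fst p) (fst (snd p)) (snd (snd p)))" "computable xs" "computable a"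
  shows "computable (\<lambda>x. foldr (f x) (xs x) (a x))"
  unfolding foldr_conv_foldl
  by (intro comp_intros computable_comp3[OF assms(1)] assms)

lemma computable_length [comp_intros]:
  fixes f :: "'a::encodable \<Rightarrow> 'b::bij_encodable list"
  assumes "computable f"
  shows "computable (\<lambda>x. length (f x))"
proof -
  have "computable (\<lambda>x. foldr (\<lambda>y n. Suc n) (f x) 0)"
    by (intro comp_intros assms)
  moreover have "foldr (\<lambda>y n. Suc n) ys 0 = length ys" for ys :: "'b list"
    by (induction ys) auto
  ultimately show ?thesis by simp
qed

lemma computable_map [comp_intros]:
  fixes xs :: "'a::encodable \<Rightarrow> 'b::bij_encodable list"
  assumes "computable (\<lambda>p. g (fst p) (snd p))" "computable xs"
  shows "computable (\<lambda>x. map (g x) (xs x))"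
proof -
  have "computable (\<lambda>x. foldr (\<lambda>y acc. g x y # acc) (xs x) [])"
    by (intro comp_intros assms computable_comp2[OF assms(1)])
  moreover have "foldr (\<lambda>y acc. h y # acc) ys [] = map h ys" for ys and h :: "'b \<Rightarrow> 'c"
    by (induction ys) auto
  ultimately show ?thesis by simp
qed

lemma computable_Ball_set [comp_intros]:
  fixes xs :: "'a::encodable \<Rightarrow> 'b::bij_encodable list"
  assumes "computable (\<lambda>p. P (fst p) (snd p))" "computable xs"
  shows "computable (\<lambda>x. \<forall>y\<in>set (xs x). P x y)"
proof -
  have "computable (\<lambda>x. foldr (\<lambda>y b. P x y \<and> b) (xs x) True)"
    by (intro comp_intros assms computable_comp2[OF assms(1)])
  moreover have "foldr (\<lambda>y b. Q y \<and> b) ys True = (\<forall>y\<in>set ys. Q y)" for ys and Q :: "'b \<Rightarrow> bool"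
    by (induction ys) auto
  ultimately show ?thesis by simp
qed

lemma computable_Bex_set [comp_intros]:
  fixes xs :: "'a::encodable \<Rightarrow> 'b::bij_encodable list"
  assumes "computable (\<lambda>p. P (fst p) (snd p))" "computable xs"
  shows "computable (\<lambda>x. \<exists>y\<in>set (xs x). P x y)"
proof -
  have "computable (\<lambda>x. \<not> (\<forall>y\<in>set (xs x). \<not> P x y))"
    by (intro comp_intros assms)
  then show ?thesis by simp
qed

lemma computable_filter [comp_intros]:
  fixes xs :: "'a::encodable \<Rightarrow> 'b::bij_encodable list"
  assumes "computable (\<lambda>p. P (fst p) (snd p))" "computable xs"
  shows "computable (\<lambda>x. filter (P x) (xs x))"
proof -
  have "computable (\<lambda>x. foldr (\<lambda>y acc. if P x y then y # acc else acc) (xs x) [])"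
    by (intro comp_intros assms computable_comp2[OF assms(1)])
  moreover have "foldr (\<lambda>y acc. if Q y then y # acc else acc) ys [] = filter Q ys"
    for ys and Q :: "'b \<Rightarrow> bool"
    by (induction ys) auto
  ultimately show ?thesis by simp
qed

lemma computable_upt [comp_intros]:
  assumes "computable f"
  shows "computable (\<lambda>x. [0..<f x])"
proof -
  have "computable (\<lambda>x. rev (rec_nat [] (\<lambda>i acc. i # acc) (f x)))"
    by (intro comp_intros assms)
  moreover have "rec_nat [] (\<lambda>i acc. i # acc) n = rev [0..<n]" for n by (induction n) auto
  ultimately show ?thesis by simp
qed

lemma computable_get [comp_intros]:
  fixes f :: "'a::encodable \<Rightarrow> 'b::bij_encodable list"
  assumes "computable f" "computable n"
  shows "computable (\<lambda>x. get (f x) (n x))"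
proof -
  have "computable (\<lambda>x. head (rec_nat (f x) (\<lambda>i. tl) (n x)))"
    by (intro comp_intros assms)
  moreover have "rec_nat xs (\<lambda>i. tl) n = drop n xs" for n and xs :: "'b list"
    by (induction n) (auto simp: drop_Suc tl_drop)
  ultimately show ?thesis by (simp add: get_def)
qed

section \<open>Integer arithmetic\<close>

lemma enc_int_cases: "enc i = (if 0 \<le> i then 2 * nat i else Suc (2 * nat (- i - 1)))"
  by (simp add: enc_int_def int_encode_def sum_encode_def)

lemma computable_nat [comp_intros]: "computable f \<Longrightarrow> computable (\<lambda>x. nat (f x))"
proof -
  assume f: "computable f"
  have "computable (\<lambda>x. if 2 * (enc (f x) div 2) = enc (f x) then enc (f x) div 2 else 0)"
    by (intro comp_intros f)
  moreover have "(if 2 * (enc i div 2) = enc i then enc i div 2 else 0) = nat i" for i :: int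
    by (auto simp: enc_int_cases; presburger)
  ultimately show ?thesis by simp
qed

lemma computable_nat_uminus: "computable f \<Longrightarrow> computable (\<lambda>x. nat (- f x))"
proof -
  assume f: "computable f"
  have "computable (\<lambda>x. if 2 * (enc (f x) div 2) = enc (f x) then 0 else enc (f x) div 2 + 1)"
    by (intro comp_intros f)
  moreover have "(if 2 * (enc i div 2) = enc i then 0 else enc i div 2 + 1) = nat (- i)" for i :: int
    by (auto simp: enc_int_cases; presburger)
  ultimately show ?thesis by simp
qed

text \<open>The ring operations below reduce to this form: their arguments are split into positive
  and negative parts, on which natural number arithmetic is available.\<close>

lemma computable_int_diff:
  assumes "computable f" "computable g"
  shows "computable (\<lambda>x. int (f x) - int (g x))"
proof -
  have "computable (\<lambda>x. dec (if g x \<le> f x then 2 * (f x - g x) else Suc (2 * (g x - f x - 1))) :: int)"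
    by (intro comp_intros assms)
  moreover have "dec (if b \<le> a then 2 * (a - b) else Suc (2 * (b - a - 1))) = int a - int b" for a b
    by (auto simp: dec_int_def int_decode_def sum_decode_def)
  ultimately show ?thesis by simp
qed

lemma computable_int [comp_intros]: "computable f \<Longrightarrow> computable (\<lambda>x. int (f x))"
  using computable_int_diff[OF _ computable_const[of 0]] by simp

lemma computable_uminus_int [comp_intros]: "computable f \<Longrightarrow> computable (\<lambda>x. - f x :: int)"
proof -
  assume f: "computable f"
  have "computable (\<lambda>x. int (nat (- f x)) - int (nat (f x)))"
    by (intro computable_int_diff computable_nat_uminus comp_intros f)
  moreover have "int (nat (- i)) - int (nat i) = - i" for i by auto
  ultimately show ?thesis by simp
qed

lemma computable_add_int [comp_intros]:
  assumes "computable f" "computable g"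
  shows "computable (\<lambda>x. f x + g x :: int)"
proof -
  have "computable (\<lambda>x. int (nat (f x) + nat (g x)) - int (nat (- f x) + nat (- g x)))"
    by (intro computable_int_diff comp_intros computable_nat_uminus assms)
  moreover have "int (nat i + nat j) - int (nat (- i) + nat (- j)) = i + j" for i j by auto
  ultimately show ?thesis by simp
qed

lemma computable_diff_int [comp_intros]:
  assumes "computable f" "computable g"
  shows "computable (\<lambda>x. f x - g x :: int)"
  using computable_add_int[OF assms(1) computable_uminus_int[OF assms(2)]] by simp

lemma computable_mult_int [comp_intros]:
  assumes "computable f" "computable g"
  shows "computable (\<lambda>x. f x * g x :: int)"
proof -
  have "computable (\<lambda>x. int (nat (f x) * nat (g x) + nat (- f x) * nat (- g x))
      - int (nat (f x) * nat (- g x) + nat (- f x) * nat (g x)))"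
    by (intro computable_int_diff comp_intros computable_nat_uminus assms)
  moreover have "int (nat i * nat j + nat (- i) * nat (- j))
      - int (nat i * nat (- j) + nat (- i) * nat j) = i * j" for i j
    by (cases "i \<ge> 0"; cases "j \<ge> 0") auto
  ultimately show ?thesis by simp
qed

lemma computable_power_int [comp_intros]:
  fixes f :: "'a::encodable \<Rightarrow> int"
  assumes "computable f" "computable g"
  shows "computable (\<lambda>x. f x ^ g x)"
proof -
  have "computable (\<lambda>x. rec_nat 1 (\<lambda>i y. f x * y) (g x))"
    by (intro comp_intros assms computable_comp[OF assms(1)])
  moreover have "rec_nat 1 (\<lambda>i y. a * y) n = a ^ n" for a :: int and n
    by (induction n) auto
  ultimately show ?thesis by simp
qed

lemma computable_le_int [comp_intros]:
  assumes "computable f" "computable g"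
  shows "computable (\<lambda>x. f x \<le> (g x :: int))"
proof -
  have "computable (\<lambda>x. nat (f x - g x) = 0)" by (intro comp_intros assms)
  then show ?thesis by simp
qed

lemma computable_less_int [comp_intros]:
  assumes "computable f" "computable g"
  shows "computable (\<lambda>x. f x < (g x :: int))"
  using computable_not[OF computable_le_int[OF assms(2,1)]] by (simp add: not_le)

lemma computable_abs_int [comp_intros]: "computable f \<Longrightarrow> computable (\<lambda>x. \<bar>f x :: int\<bar>)"
  unfolding abs_if by (intro comp_intros)

section \<open>Approximating partial recursive functions by total ones\<close>

text \<open>\<open>steps r xs t\<close> runs \<open>r\<close> with every unbounded search cut off at \<open>t\<close>; it is \<open>0\<close> if
  the computation has not converged yet and the successor of the value otherwise.\<close>

primrec steps :: "recf \<Rightarrow> nat list \<Rightarrow> nat \<Rightarrow> nat" where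
  "steps Zr xs t = 1"
| "steps Sc xs t = (if xs = [] then 0 else Suc (Suc (get xs 0)))"
| "steps (Id n) xs t = (if n < length xs then Suc (get xs n) else 0)"
| "steps (Cn f gs) xs t =
    (if \<forall>y\<in>set (map (\<lambda>g. steps g xs t) gs). y \<noteq> 0
     then steps f (map (\<lambda>y. y - 1) (map (\<lambda>g. steps g xs t) gs)) t else 0)"
| "steps (Pr f g) xs t = (if xs = [] then 0 else
     rec_nat (steps f (tl xs) t)
       (\<lambda>i y. if y = 0 then 0 else steps g (i # (y - 1) # tl xs) t) (get xs 0))"
| "steps (Mn f) xs t =
    (if (LEAST n. t \<le> n \<or> steps f (n # xs) t \<le> 1) < t \<and>
        steps f ((LEAST n. t \<le> n \<or> steps f (n # xs) t \<le> 1) # xs) t = 1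
     then Suc (LEAST n. t \<le> n \<or> steps f (n # xs) t \<le> 1) else 0)"

lemma computable_steps: "computable (\<lambda>p. steps r (fst p) (snd p))"
proof (induction r)
  case (Cn f gs)
  have "computable (\<lambda>p. map (\<lambda>g. steps g (fst p) (snd p)) gs)"
    using Cn.IH(2) by (induction gs) (auto intro!: comp_intros)
  then show ?case by (simp only: steps.simps)
      (intro comp_intros computable_comp2[OF Cn.IH(1)])
next
  case (Pr f g)
  show ?case by (simp only: steps.simps)
     (intro comp_intros computable_comp2[OF Pr.IH(1)] computable_comp2[OF Pr.IH(2)])
next
  case (Mn f)
  have "computable (\<lambda>p. LEAST n. snd p \<le> n \<or> steps f (n # fst p) (snd p) \<le> 1)"
    by (intro comp_intros computable_comp2[OF Mn.IH]) auto
  then show ?case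
    by (simp only: steps.simps) (intro comp_intros computable_comp2[OF Mn.IH]; auto)
qed (simp_all only: steps.simps, (intro comp_intros)+)

text \<open>In the case \<open>Mn\<close> the minimum lies below the old cut-off and all smaller
  arguments have already converged to positive values. Converged values persist, so a larger cut-off
  finds the same minimum.\<close>

lemma steps_mono: "steps r xs t = Suc y \<Longrightarrow> t \<le> t' \<Longrightarrow> steps r xs t' = Suc y"
proof (induction r arbitrary: xs y)
  case (Cn f gs)
  then have nz: "\<forall>g\<in>set gs. steps g xs t \<noteq> 0" by (auto split: if_splits)
  have "steps g xs t' = steps g xs t" if "g \<in> set gs" for g
    using Cn.IH(2)[OF that, of xs] Cn.prems(2) nz that by (metis not0_implies_Suc)
  then have "map (\<lambda>g. steps g xs t') gs = map (\<lambda>g. steps g xs t) gs" by auto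
  then show ?case using Cn nz by (simp only: steps.simps split: if_splits) auto
next
  case (Pr f g)
  define R where "R t m = rec_nat (steps f (tl xs) t)
     (\<lambda>i y. if y = 0 then 0 else steps g (i # (y - 1) # tl xs) t) m" for t m
  have "R t' m = Suc z" if "R t m = Suc z" for m z
    using that
  proof (induction m arbitrary: z)
    case 0
    then show ?case using Pr by (simp add: R_def)
  next
    case (Suc m)
    then obtain w where w: "R t m = Suc w" by (cases "R t m") (auto simp: R_def)
    then have "R t' m = Suc w" using Suc.IH by auto
    then show ?case using Suc.prems w Pr by (simp add: R_def)
  qed
  then show ?case using Pr.prems by (auto simp: R_def split: if_splits)
next
  case (Mn f)
  define n where "n = (LEAST n. t \<le> n \<or> steps f (n # xs) t \<le> 1)"
  have n: "n < t" "steps f (n # xs) t = 1" "y = n"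
    using Mn.prems(1) by (auto simp: n_def split: if_splits)
  have less: "steps f (m # xs) t > 1" if "m < n" for m
    using not_less_Least[of m "\<lambda>n. t \<le> n \<or> steps f (n # xs) t \<le> 1"] that by (auto simp: n_def)
  have "(LEAST n. t' \<le> n \<or> steps f (n # xs) t' \<le> 1) = n"
  proof (rule Least_equality)
    show "t' \<le> n \<or> steps f (n # xs) t' \<le> 1" using Mn.IH[of "n # xs" 0] n Mn.prems(2) by simp
  next
    fix m assume m: "t' \<le> m \<or> steps f (m # xs) t' \<le> 1"
    show "n \<le> m"
    proof (rule ccontr)
      assume "\<not> n \<le> m"
      then have "m < n" by simp
      from less[OF this] obtain v where "steps f (m # xs) t = Suc (Suc v)"
        by (auto dest: less_imp_Suc_add)
      then have "steps f (m # xs) t' = Suc (Suc v)" using Mn.IH Mn.prems(2) by blast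
      then show False using m \<open>m < n\<close> n Mn.prems(2) by auto
    qed
  qed
  then show ?case using Mn.IH[of "n # xs" 0] n Mn.prems(2) by simp
qed (auto split: if_splits)

lemma steps_common_bound:
  assumes "\<forall>x\<in>set zs. \<exists>t. steps (r x) (a x) t = Suc (b x)"
  shows "\<exists>t. \<forall>x\<in>set zs. steps (r x) (a x) t = Suc (b x)"
  using assms
proof (induction zs)
  case (Cons z zs)
  then obtain t1 t2 where "\<forall>x\<in>set zs. steps (r x) (a x) t1 = Suc (b x)"
    "steps (r z) (a z) t2 = Suc (b z)" by auto
  then show ?case
    by (intro exI[of _ "max t1 t2"]) (auto intro: steps_mono max.cobounded1 max.cobounded2)
qed auto

text \<open>Replaces the inductive relation by the existence of a halting time for a total
  computable function, so that halting of \<open>U\<close> can be one component of a decidable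
  witness.\<close>

theorem eval_rf_iff_steps: "eval_rf r xs y \<longleftrightarrow> (\<exists>t. steps r xs t = Suc y)"
proof (induction r arbitrary: xs y)
  case Sc
  then show ?case by (cases xs) (auto simp: eval_Sc eval_Sc_Nil get_nth)
next
  case (Cn f gs)
  show ?case
  proof
    assume "eval_rf (Cn f gs) xs y"
    then obtain ys where ys: "list_all2 (\<lambda>g y. eval_rf g xs y) gs ys" "eval_rf f ys y"
      by (auto simp: eval_Cn)
    have "\<forall>p\<in>set (zip gs ys). \<exists>t. steps (fst p) xs t = Suc (snd p)"
      using ys(1) Cn.IH(2) by (fastforce simp: list_all2_iff dest: set_zip_leftD)
    from steps_common_bound[OF this] obtain t1
      where t1: "\<forall>p\<in>set (zip gs ys). steps (fst p) xs t1 = Suc (snd p)" by blast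
    obtain t2 where t2: "steps f ys t2 = Suc y" using Cn.IH(1) ys(2) by blast
    define t where "t = max t1 t2"
    have "\<forall>p\<in>set (zip gs ys). steps (fst p) xs t = Suc (snd p)"
      using t1 by (auto simp: t_def intro: steps_mono[of _ _ t1])
    then have m: "map (\<lambda>g. steps g xs t) gs = map Suc ys"
      using ys(1) by (intro nth_equalityI) (auto simp: list_all2_conv_all_nth set_zip)
    have "steps f ys t = Suc y" using t2 by (auto simp: t_def intro: steps_mono[of _ _ t2])
    then have "steps (Cn f gs) xs t = Suc y" by (simp only: steps.simps m) (simp add: o_def)
    then show "\<exists>t. steps (Cn f gs) xs t = Suc y" ..
  next
    assume "\<exists>t. steps (Cn f gs) xs t = Suc y"
    then obtain t where t: "steps (Cn f gs) xs t = Suc y" ..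
    define ys where "ys = map (\<lambda>g. steps g xs t - 1) gs"
    have nz: "\<forall>g\<in>set gs. steps g xs t \<noteq> 0" using t by (auto split: if_splits)
    then have "steps f ys t = Suc y" using t by (simp add: ys_def o_def)
    moreover have "list_all2 (\<lambda>g y. eval_rf g xs y) gs ys"
      using nz Cn.IH(2) by (auto simp: ys_def list_all2_conv_all_nth)
    ultimately show "eval_rf (Cn f gs) xs y" using Cn.IH(1) by (auto simp: eval_Cn)
  qed
next
  case (Pr f g)
  show ?case
  proof (cases xs)
    case Nil
    then show ?thesis by (simp add: eval_Pr_Nil)
  next
    case (Cons n zs)
    define R where "R t m = rec_nat (steps f zs t)
       (\<lambda>i y. if y = 0 then 0 else steps g (i # (y - 1) # zs) t) m" for t m
    have R: "steps (Pr f g) (m # zs) t = R t m" for m t by (simp add: R_def get_nth cong: if_cong)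
    have "eval_rf (Pr f g) (m # zs) z \<longleftrightarrow> (\<exists>t. R t m = Suc z)" for m z
    proof (induction m arbitrary: z)
      case 0
      then show ?case using Pr.IH(1) by (simp add: eval_Pr_0 R_def)
    next
      case (Suc m)
      have RS: "R t (Suc m) = (if R t m = 0 then 0 else steps g (m # (R t m - 1) # zs) t)" for t
        by (simp add: R_def)
      show ?case
      proof
        assume "eval_rf (Pr f g) (Suc m # zs) z"
        then obtain y t1 t2 where "R t1 m = Suc y" "steps g (m # y # zs) t2 = Suc z"
          using Suc.IH Pr.IH(2) by (auto simp: eval_Pr_Suc)
        then have "R (max t1 t2) m = Suc y" "steps g (m # y # zs) (max t1 t2) = Suc z"
          by (auto simp: R[symmetric] simp del: steps.simps intro: steps_mono max.cobounded1 max.cobounded2)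
        then show "\<exists>t. R t (Suc m) = Suc z" by (intro exI[of _ "max t1 t2"]) (simp add: RS)
      next
        assume "\<exists>t. R t (Suc m) = Suc z"
        then obtain t where t: "R t (Suc m) = Suc z" ..
        then obtain y where "R t m = Suc y" by (cases "R t m") (auto simp: RS)
        then show "eval_rf (Pr f g) (Suc m # zs) z"
          using t Suc.IH Pr.IH(2) by (auto simp: eval_Pr_Suc RS)
      qed
    qed
    then show ?thesis by (simp only: Cons R)
  qed
next
  case (Mn f)
  show ?case
  proof
    assume "eval_rf (Mn f) xs y"
    then obtain t0 h where t0: "steps f (y # xs) t0 = Suc 0"
      and "\<forall>m<y. h m > 0 \<and> eval_rf f (m # xs) (h m)"
      using Mn.IH by (auto simp: eval_Mn) metis
    then have h: "\<forall>m\<in>set [0..<y]. \<exists>t. steps f (m # xs) t = Suc (h m)" "\<forall>m<y. h m > 0"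
      using Mn.IH by auto
    from steps_common_bound[OF h(1)] obtain t1
      where t1: "\<forall>m\<in>set [0..<y]. steps f (m # xs) t1 = Suc (h m)" by blast
    \<comment> \<open>The cut-off must exceed \<open>y\<close> itself, since the search only looks
      at arguments below it.\<close>
    define t where "t = max (Suc y) (max t0 t1)"
    have a: "steps f (y # xs) t = Suc 0" using t0 by (auto simp: t_def intro: steps_mono[of _ _ t0])
    have b: "steps f (m # xs) t = Suc (h m)" if "m < y" for m
      using t1 that by (auto simp: t_def intro: steps_mono[of _ _ t1])
    have "(LEAST n. t \<le> n \<or> steps f (n # xs) t \<le> 1) = y"
    proof (rule Least_equality)
      fix m assume "t \<le> m \<or> steps f (m # xs) t \<le> 1"
      then show "y \<le> m" using b[of m] h(2) by (cases "m < y") (auto simp: t_def)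
    qed (simp add: a)
    then have "steps (Mn f) xs t = Suc y" using a by (simp add: t_def)
    then show "\<exists>t. steps (Mn f) xs t = Suc y" ..
  next
    assume "\<exists>t. steps (Mn f) xs t = Suc y"
    then obtain t where t: "steps (Mn f) xs t = Suc y" ..
    define n where "n = (LEAST n. t \<le> n \<or> steps f (n # xs) t \<le> 1)"
    have n: "n < t" "steps f (n # xs) t = Suc 0" "y = n"
      using t by (auto simp: n_def split: if_splits)
    have "\<exists>v>0. eval_rf f (m # xs) v" if "m < n" for m
    proof -
      have "steps f (m # xs) t > 1"
        using not_less_Least[of m "\<lambda>n. t \<le> n \<or> steps f (n # xs) t \<le> 1"] that by (auto simp: n_def)
      then obtain v where "steps f (m # xs) t = Suc (Suc v)" by (auto dest: less_imp_Suc_add)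
      then show ?thesis using Mn.IH by blast
    qed
    then show "eval_rf (Mn f) xs y" using n Mn.IH by (auto simp: eval_Mn)
  qed
qed (auto simp: eval_Zr eval_Id get_nth)

text \<open>The source of properly partial functions: the search diverges exactly when no
  \<open>m\<close> fits, which is how a machine built from requests gets its domain.\<close>

lemma eval_rf_search:
  assumes P: "computable (\<lambda>p. P (fst p) (snd p))" and out: "computable out"
  shows "\<exists>r. \<forall>x y :: nat. eval_rf r [x] y \<longleftrightarrow> (\<exists>m::nat. P x m) \<and> y = out (LEAST m. P x m)"
proof -
  obtain p where p: "total_computable p" "\<And>q. p (enc q) = enc (P (fst q) (snd q))"
    using P unfolding computable_def by metis
  have "recursive 2 (\<lambda>xs. 1 - p (prod_encode (xs ! 1, xs ! 0)))"
    by (intro recursive_diff recursive_const total_computable_recursive[OF p(1)]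
        recursive_prod_encode recursive_nth) auto
  moreover have "1 - p (prod_encode (x, m)) = (if P x m then 0 else 1)" for x m
    using p(2)[of "(x, m)"] by (simp add: enc_prod_def enc_nat_def enc_bool_def)
  moreover obtain rp where "realizes 2 rp (\<lambda>xs. 1 - p (prod_encode (xs ! 1, xs ! 0)))"
    using calculation by (auto simp: recursive_def)
  ultimately have rp: "\<And>m x y. eval_rf rp [m, x] y \<longleftrightarrow> y = (if P x m then 0 else 1)"
    by (auto simp: realizes_def)
  obtain ro where ro: "\<And>m y. eval_rf ro [m] y \<longleftrightarrow> y = out m"
    using out by (auto simp: computable_nat_iff total_computable_def partial_computable_def eq_commute)
  have "eval_rf (Mn rp) [x] m \<longleftrightarrow> P x m \<and> (\<forall>k<m. \<not> P x k)" for x m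
    by (auto simp: eval_Mn rp)
  also have "P x m \<and> (\<forall>k<m. \<not> P x k) \<longleftrightarrow> (\<exists>m. P x m) \<and> m = (LEAST m. P x m)" for x m
    by (metis LeastI_ex Least_equality leI not_less_Least)
  finally have "eval_rf (Cn ro [Mn rp]) [x] y \<longleftrightarrow> (\<exists>m. P x m) \<and> y = out (LEAST m. P x m)" for x y
    by (auto simp: eval_Cn list_all2_Cons1 ro)
  then show ?thesis by blast
qed

section \<open>Evaluation of integer polynomials\<close>

abbreviation ipoly :: "int list \<Rightarrow> complex poly" where
  "ipoly cs \<equiv> Poly (map of_int cs)"

definition gval :: "int \<times> int \<Rightarrow> complex" where
  "gval z = Complex (of_int (fst z)) (of_int (snd z))"

definition gnorm2 :: "int \<times> int \<Rightarrow> int" where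
  "gnorm2 z = fst z * fst z + snd z * snd z"

text \<open>Horner's scheme with denominators cleared. The accumulator carries the current power of
  \<open>D\<close>, and for a list of length \<open>n > 0\<close> the Gaussian integer obtained is
  \<open>D ^ (n - 1)\<close> times the value of the polynomial at \<open>z / D\<close>.\<close>

definition heval_aux :: "int list \<Rightarrow> int \<times> int \<Rightarrow> int \<Rightarrow> (int \<times> int) \<times> int" where
  "heval_aux cs z D = foldr (\<lambda>c st.
     ((c * snd st + (fst z * fst (fst st) - snd z * snd (fst st)),
       fst z * snd (fst st) + snd z * fst (fst st)), D * snd st)) cs ((0, 0), 1)"

definition heval :: "int list \<Rightarrow> int \<times> int \<Rightarrow> int \<Rightarrow> int \<times> int" where
  "heval cs z D = fst (heval_aux cs z D)"

definition ieval :: "int list \<Rightarrow> int \<Rightarrow> int" where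
  "ieval cs t = foldr (\<lambda>c a. c + t * a) cs 0"

text \<open>This is the leading coefficient only for lists without trailing zeros; hence the
  recurring hypothesis \<open>lead cs \<noteq> 0\<close>.\<close>

definition lead :: "int list \<Rightarrow> int" where
  "lead cs = get cs (length cs - 1)"

definition dlist :: "int list \<Rightarrow> int list" where
  "dlist cs = map (\<lambda>j. int (Suc j) * get cs (Suc j)) [0..<length cs - 1]"

lemma computable_gnorm2 [comp_intros]: "computable f \<Longrightarrow> computable (\<lambda>x. gnorm2 (f x))"
  unfolding gnorm2_def by (intro comp_intros)

lemma computable_heval [comp_intros]:
  assumes "computable f" "computable g" "computable h"
  shows "computable (\<lambda>x. heval (f x) (g x) (h x))"
  by (rule computable_comp3[OF _ assms]) (unfold heval_def heval_aux_def, intro comp_intros)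

lemma computable_ieval [comp_intros]:
  assumes "computable f" "computable g"
  shows "computable (\<lambda>x. ieval (f x) (g x))"
  by (rule computable_comp2[OF _ assms]) (unfold ieval_def, intro comp_intros)

lemma computable_lead [comp_intros]: "computable f \<Longrightarrow> computable (\<lambda>x. lead (f x))"
  unfolding lead_def by (intro comp_intros)

lemma computable_dlist [comp_intros]: "computable f \<Longrightarrow> computable (\<lambda>x. dlist (f x))"
  by (rule computable_comp[of dlist]) (unfold dlist_def, intro comp_intros)

lemma of_int_ieval: "of_int (ieval cs t) = poly (Poly (map of_int cs)) (of_int t)"
  by (induction cs) (auto simp: ieval_def)

lemma heval_aux_Cons: "heval_aux (c # cs) z D =
    ((c * snd (heval_aux cs z D) + (fst z * fst (fst (heval_aux cs z D)) - snd z * snd (fst (heval_aux cs z D))),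
       fst z * snd (fst (heval_aux cs z D)) + snd z * fst (fst (heval_aux cs z D))), D * snd (heval_aux cs z D))"
  by (simp add: heval_aux_def)

lemma snd_heval_aux: "snd (heval_aux cs z D) = D ^ length cs"
proof (induction cs)
  case (Cons c cs)
  then show ?case by (simp add: heval_aux_Cons)
qed (simp add: heval_aux_def)

lemma heval_Cons: "gval (heval (c # cs) z D) = of_int c * of_int D ^ length cs + gval z * gval (heval cs z D)"
  by (auto simp: heval_def heval_aux_Cons snd_heval_aux gval_def complex_eq_iff simp flip: of_int_power)

lemma gval_heval:
  assumes "D \<noteq> 0"
  shows "of_int D * gval (heval cs z D) = of_int D ^ length cs * poly (ipoly cs) (gval z / of_int D)"
proof (induction cs)
  case Nil
  then show ?case by (simp add: heval_def heval_aux_def gval_def complex_eq_iff)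
next
  case (Cons c cs)
  have "of_int D * gval (heval (c # cs) z D) =
      of_int D * (of_int c * of_int D ^ length cs) + gval z * (of_int D * gval (heval cs z D))"
    by (simp add: heval_Cons algebra_simps)
  also have "\<dots> = of_int D ^ length (c # cs) * of_int c +
      (of_int D * (gval z / of_int D)) * (of_int D ^ length cs * poly (ipoly cs) (gval z / of_int D))"
    using assms by (simp add: Cons)
  also have "\<dots> = of_int D ^ length (c # cs) * poly (ipoly (c # cs)) (gval z / of_int D)"
    by (simp add: distrib_left mult_ac)
  finally show ?case .
qed

lemma ipoly_eq_0_iff: "ipoly cs = 0 \<longleftrightarrow> (\<forall>c\<in>set cs. c = 0)"
  by (induction cs) auto

lemma degree_ipoly: "cs \<noteq> [] \<Longrightarrow> lead cs \<noteq> 0 \<Longrightarrow> degree (ipoly cs) = length cs - 1"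
  and lead_coeff_ipoly: "cs \<noteq> [] \<Longrightarrow> lead cs \<noteq> 0 \<Longrightarrow> lead_coeff (ipoly cs) = of_int (lead cs)"
proof -
  assume *: "cs \<noteq> []" "lead cs \<noteq> 0"
  have last: "lead cs = last cs" using * by (simp add: lead_def get_nth last_conv_nth)
  have co: "coeffs (ipoly cs) = map of_int cs"
    using * last by (simp add: coeffs_Poly no_trailing_map no_trailing_unfold last_map)
  then show "degree (ipoly cs) = length cs - 1"
    by (simp add: degree_eq_length_coeffs)
  have "ipoly cs \<noteq> 0" using * co by (metis coeffs_0_eq_Nil map_is_Nil_conv)
  then show "lead_coeff (ipoly cs) = of_int (lead cs)"
    using * last co by (metis last_coeffs_eq_coeff_degree last_map)
qed

lemma ipoly_nonzero: "cs \<noteq> [] \<Longrightarrow> lead cs \<noteq> 0 \<Longrightarrow> ipoly cs \<noteq> 0"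
  by (metis coeff_0 lead_coeff_ipoly of_int_eq_0_iff)

lemma degree_ipoly_le: "degree (Poly xs) \<le> length xs - 1"
proof (induction xs)
  case (Cons x xs)
  then show ?case by (cases xs) (auto simp: degree_pCons_eq_if)
qed auto

lemma ipoly_dlist: "ipoly (dlist cs) = pderiv (ipoly cs)"
proof (rule poly_eqI)
  fix n
  show "coeff (ipoly (dlist cs)) n = coeff (pderiv (ipoly cs)) n"
    by (auto simp: coeff_pderiv coeff_Poly_eq nth_default_def dlist_def get_nth)
qed

lemma ipoly_cnj: "poly (ipoly cs) (cnj z) = cnj (poly (ipoly cs) z)"
  by (induction cs) auto

lemma cmod_gval: "(cmod (gval z))\<^sup>2 = of_int (gnorm2 z)"
  unfolding cmod_power2 by (simp add: gval_def gnorm2_def power2_eq_square)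

text \<open>The product of the distances from a point to the roots is
  \<open>|p(c)| / |lead p|\<close>, so a small value forces a close root.\<close>

definition rootin :: "int list \<Rightarrow> int \<times> int \<Rightarrow> int \<Rightarrow> int \<Rightarrow> bool" where
  "rootin cs z D R \<longleftrightarrow> lead cs \<noteq> 0 \<and> cs \<noteq> [] \<and>
     gnorm2 (heval cs z D) < lead cs * lead cs * R ^ (2 * (length cs - 1))"

lemma computable_rootin [comp_intros]:
  assumes "computable f" "computable g" "computable h" "computable k"
  shows "computable (\<lambda>x. rootin (f x) (g x) (h x) (k x))"
  unfolding rootin_def by (intro comp_intros assms)

text \<open>Roots are split off one at a time; each linear factor contributes at least
  \<open>r\<close> at the point \<open>c\<close>.\<close>

lemma poly_ge_if_roots_far:
  fixes p :: "complex poly"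
  assumes "p \<noteq> 0" "r \<ge> 0" "\<And>w. poly p w = 0 \<Longrightarrow> r \<le> cmod (c - w)"
  shows "cmod (lead_coeff p) * r ^ degree p \<le> cmod (poly p c)"
  using assms
proof (induction "degree p" arbitrary: p)
  case 0
  then obtain a where "p = [:a:]" by (metis degree_eq_zeroE)
  then show ?case by simp
next
  case (Suc n)
  then have "\<not> constant (poly p)" by (simp add: constant_degree)
  then obtain w where w: "poly p w = 0" using fundamental_theorem_of_algebra by blast
  then obtain q where q: "p = [:- w, 1:] * q" by (meson dvdE poly_eq_0_iff_dvd)
  have q0: "q \<noteq> 0" using q Suc.prems by auto
  have deg: "degree p = Suc (degree q)" using q q0 by (simp add: degree_mult_eq del: mult_pCons_left)
  have lc: "lead_coeff p = lead_coeff q" using q by (simp add: lead_coeff_mult del: mult_pCons_left)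
  have "cmod (lead_coeff q) * r ^ degree q \<le> cmod (poly q c)"
  proof (rule Suc.hyps(1))
    show "n = degree q" using Suc.hyps(2) deg by simp
    show "r \<le> cmod (c - w)" if "poly q w = 0" for w
      using Suc.prems(3)[of w] that by (simp add: q)
  qed (use q0 Suc.prems in auto)
  moreover have "r \<le> cmod (c - w)" using Suc.prems w by auto
  ultimately have "r * (cmod (lead_coeff q) * r ^ degree q) \<le> cmod (c - w) * cmod (poly q c)"
    using Suc.prems by (intro mult_mono) auto
  moreover have "poly p c = (c - w) * poly q c" by (simp add: q algebra_simps)
  ultimately show ?case unfolding lc unfolding deg by (simp add: norm_mult mult_ac)
qed

text \<open>The integer test is the analytic inequality multiplied by \<open>D ^ degree\<close> and
  squared, which removes fractions and moduli.\<close>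

lemma rootin_iff:
  assumes "D > 0" "R \<ge> 0" "cs \<noteq> []" "lead cs \<noteq> 0"
  shows "rootin cs z D R \<longleftrightarrow> cmod (poly (ipoly cs) (gval z / of_int D)) <
    cmod (lead_coeff (ipoly cs)) * (of_int R / of_int D) ^ degree (ipoly cs)"
proof -
  define n where "n = length cs - 1"
  have n: "length cs = Suc n" using assms(3) by (cases cs) (auto simp: n_def)
  define P where "P = cmod (poly (ipoly cs) (gval z / of_int D))"
  have "of_int D * cmod (gval (heval cs z D)) = of_int D * (of_int D ^ n * P)"
    using arg_cong[OF gval_heval[of D cs z], of cmod] assms(1)
    by (simp add: norm_mult norm_power n P_def)
  then have h: "cmod (gval (heval cs z D)) = of_int D ^ n * P" using assms(1) by simp
  have "rootin cs z D R \<longleftrightarrow> real_of_int (gnorm2 (heval cs z D)) < of_int (lead cs * lead cs * R ^ (2 * n))"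
    using assms by (simp only: rootin_def n_def of_int_less_iff) simp
  also have "\<dots> \<longleftrightarrow> (of_int D ^ n * P)\<^sup>2 < (\<bar>of_int (lead cs)\<bar> * of_int R ^ n)\<^sup>2"
    by (simp add: cmod_gval[symmetric] h power_mult_distrib power_mult[symmetric] power2_eq_square[of "of_int (lead cs)"] mult.commute)
  also have "\<dots> \<longleftrightarrow> of_int D ^ n * P < \<bar>of_int (lead cs)\<bar> * of_int R ^ n"
    using assms power_mono_iff[of "\<bar>of_int (lead cs)\<bar> * of_int R ^ n" "of_int D ^ n * P" 2]
    by (auto simp: P_def simp flip: not_le)
  also have "\<dots> \<longleftrightarrow> P < \<bar>of_int (lead cs)\<bar> * (of_int R / of_int D) ^ n"
    using assms(1) by (simp add: power_divide pos_less_divide_eq mult.commute)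
  finally show ?thesis
    unfolding lead_coeff_ipoly[OF assms(3,4)] unfolding degree_ipoly[OF assms(3,4)]
    by (simp add: P_def n_def)
qed

lemma rootin_imp_root:
  assumes "rootin cs z D R" "D > 0" "R \<ge> 0"
  shows "\<exists>w. poly (ipoly cs) w = 0 \<and> cmod (w - gval z / of_int D) < of_int R / of_int D"
proof (rule ccontr)
  assume *: "\<not> ?thesis"
  have cs: "cs \<noteq> []" "lead cs \<noteq> 0" using assms(1) by (auto simp: rootin_def)
  then have "ipoly cs \<noteq> 0" by (rule ipoly_nonzero)
  then have "cmod (lead_coeff (ipoly cs)) * (of_int R / of_int D) ^ degree (ipoly cs)
      \<le> cmod (poly (ipoly cs) (gval z / of_int D))"
  proof (rule poly_ge_if_roots_far)
    fix w assume "poly (ipoly cs) w = 0"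
    then have "\<not> cmod (w - gval z / of_int D) < of_int R / of_int D" using * by blast
    then show "of_int R / of_int D \<le> cmod (gval z / of_int D - w)"
      by (simp add: norm_minus_commute)
  qed (use assms(2,3) in auto)
  then show False using assms(1) rootin_iff[OF assms(2,3) cs, of z] by linarith
qed

text \<open>Completeness counterpart of \<open>rootin_imp_root\<close>, by continuity at the root.
  The radius \<open>R / D\<close> is held fixed while the denominator may vary, so refining the grid
  of centres eventually makes the test succeed.\<close>

lemma rootin_near_root:
  assumes "cs \<noteq> []" "lead cs \<noteq> 0" "poly (ipoly cs) w = 0" "(r::real) > 0"
  shows "\<exists>\<delta>>0. \<forall>z D R. D > 0 \<longrightarrow> of_int R / of_int D = r \<longrightarrow>
    cmod (gval z / of_int D - w) < \<delta> \<longrightarrow> rootin cs z D R"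
proof -
  define L where "L = cmod (lead_coeff (ipoly cs)) * r ^ degree (ipoly cs)"
  have "L > 0" using assms by (simp add: L_def lead_coeff_ipoly del: coeff_Poly_eq)
  moreover have "isCont (poly (ipoly cs)) w" by (rule poly_isCont)
  ultimately obtain \<delta> where \<delta>: "\<delta> > 0" "\<And>x. cmod (x - w) < \<delta> \<Longrightarrow> cmod (poly (ipoly cs) x) < L"
    using assms(3) unfolding continuous_at_eps_delta dist_norm
    by (metis diff_zero)
  have "rootin cs z D R" if *: "D > 0" "of_int R / of_int D = r" "cmod (gval z / of_int D - w) < \<delta>" for z D R
  proof -
    have "R > 0" using * assms(4) by (auto simp: zero_less_divide_iff)
    then show ?thesis
      using rootin_iff[OF *(1) _ assms(1,2), of R z] \<delta>(2)[OF *(3)] by (simp add: *(2) L_def del: coeff_Poly_eq)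
  qed
  then show ?thesis using \<delta>(1) by blast
qed

section \<open>Certified root isolation\<close>

text \<open>A certificate for a code of an algebraic number consists of the coefficients \<open>cs\<close> without
  trailing zeros, two integer polynomials with \<open>u p = v p'\<close>, and as many pairwise disjoint discs
  (centres \<open>z / D\<close>, common radius \<open>R / D\<close>) as the degree of \<open>v\<close>, each containing a root of \<open>p\<close>.
  As \<open>v\<close> vanishes at all roots of \<open>p\<close>, each disc contains exactly one root. Roots on the boundary
  of the rectangle are recognised by a real divisor of the restriction of \<open>p\<close> to the boundary line:
  it has a root in the disc together with its conjugate, so by uniqueness the root is on the line.\<close>

type_synonym bnds = "(int \<times> nat) list"
type_synonym disc = "(int \<times> int) \<times> nat \<times> (int list \<times> int list \<times> int list) \<times> int"
type_synonym cert = "(int list \<times> int list \<times> int list) \<times> (int \<times> int) \<times> disc list"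

definition bnum :: "bnds \<Rightarrow> nat \<Rightarrow> int" where "bnum bs l = fst (get bs l)"
definition bden :: "bnds \<Rightarrow> nat \<Rightarrow> int" where "bden bs l = int (Suc (snd (get bs l)))"
definition bound :: "bnds \<Rightarrow> nat \<Rightarrow> real" where "bound bs l = of_int (bnum bs l) / of_int (bden bs l)"

definition disc_inside :: "bnds \<Rightarrow> int \<times> int \<Rightarrow> int \<Rightarrow> int \<Rightarrow> bool" where
  "disc_inside bs z D R \<longleftrightarrow>
     bnum bs 0 * D < (fst z - R) * bden bs 0 \<and> (fst z + R) * bden bs 1 < bnum bs 1 * D \<and>
     bnum bs 2 * D < (snd z - R) * bden bs 2 \<and> (snd z + R) * bden bs 3 < bnum bs 3 * D"

definition disc_outside :: "bnds \<Rightarrow> int \<times> int \<Rightarrow> int \<Rightarrow> int \<Rightarrow> bool" where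
  "disc_outside bs z D R \<longleftrightarrow>
     (fst z + R) * bden bs 0 \<le> bnum bs 0 * D \<or> bnum bs 1 * D \<le> (fst z - R) * bden bs 1 \<or>
     (snd z + R) * bden bs 2 \<le> bnum bs 2 * D \<or> bnum bs 3 * D \<le> (snd z - R) * bden bs 3"

text \<open>Bounds 0 and 1 restrict the real part, 2 and 3 the imaginary part, so
  \<open>l < 2\<close> selects a vertical boundary line. After division by \<open>d\<close> the
  point has the fixed coordinate \<open>n / d\<close> and the running coordinate
  \<open>t\<close>.\<close>

definition line_point :: "nat \<Rightarrow> int \<Rightarrow> int \<Rightarrow> int \<Rightarrow> int \<times> int" where
  "line_point l n d t = (if l < 2 then (n, d * t) else (d * t, n))"

definition across :: "nat \<Rightarrow> int \<times> int \<Rightarrow> int" where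
  "across l z = (if l < 2 then fst z else snd z)"

definition along :: "nat \<Rightarrow> int \<times> int \<Rightarrow> int" where
  "along l z = (if l < 2 then snd z else fst z)"

text \<open>Says that \<open>g\<close> divides the restriction of the polynomial to the line, with
  quotient \<open>h1 + \<i> h2\<close> up to a constant factor. The number of integer test points
  exceeds the degree of both sides, so finitely many evaluations decide a polynomial
  identity.\<close>

definition line_identity ::
  "int list \<Rightarrow> nat \<Rightarrow> int \<Rightarrow> int \<Rightarrow> int list \<Rightarrow> int list \<Rightarrow> int list \<Rightarrow> int \<Rightarrow> bool" where
  "line_identity cs l n d g h1 h2 e \<longleftrightarrow> e \<noteq> 0 \<and>
     (\<forall>t<length cs + length g + length h1 + length h2.
        e * fst (heval cs (line_point l n d (int t)) d) = ieval g (int t) * ieval h1 (int t) \<and>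
        e * snd (heval cs (line_point l n d (int t)) d) = ieval g (int t) * ieval h2 (int t))"

text \<open>A \<open>disc\<close> lists the centre, the number of a boundary line, the polynomials
  \<open>g, h1, h2\<close> and the multiplier \<open>e\<close>. The centre has to lie exactly on the
  line: only then is the disc symmetric under reflection in it, which is conjugation of the
  parameter.\<close>

definition disc_on_line :: "bnds \<Rightarrow> int list \<Rightarrow> int \<Rightarrow> int \<Rightarrow> disc \<Rightarrow> bool" where
  "disc_on_line bs cs D R q \<longleftrightarrow> fst (snd q) < 4 \<and>
     across (fst (snd q)) (fst q) * bden bs (fst (snd q)) = bnum bs (fst (snd q)) * D \<and>
     rootin (fst (fst (snd (snd q)))) (along (fst (snd q)) (fst q), 0) D R \<and>
     line_identity cs (fst (snd q)) (bnum bs (fst (snd q))) (bden bs (fst (snd q)))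
       (fst (fst (snd (snd q)))) (fst (snd (fst (snd (snd q))))) (snd (snd (fst (snd (snd q)))))
       (snd (snd (snd q)))"

definition strips_to :: "int list \<Rightarrow> int list \<Rightarrow> bool" where
  "strips_to cs cs0 \<longleftrightarrow> cs0 \<noteq> [] \<and> lead cs0 \<noteq> 0 \<and> length cs0 \<le> length cs \<and>
     (\<forall>j<length cs. get cs j = (if j < length cs0 then get cs0 j else 0))"

text \<open>Bounds the number of distinct roots from above by the degree of \<open>v\<close>. The
  checker neither factors nor computes a gcd; it only compares values at more points than either
  degree.\<close>

definition deriv_identity :: "int list \<Rightarrow> int list \<Rightarrow> int list \<Rightarrow> bool" where
  "deriv_identity cs u v \<longleftrightarrow> (\<exists>c\<in>set v. c \<noteq> 0) \<and>
     (\<forall>t<length u + length v + length cs.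
        ieval u (int t) * ieval cs (int t) = ieval v (int t) * ieval (dlist cs) (int t))"

definition valid_discs :: "bnds \<Rightarrow> int list \<Rightarrow> int \<Rightarrow> int \<Rightarrow> disc list \<Rightarrow> bool" where
  "valid_discs bs cs D R ds \<longleftrightarrow>
     (\<forall>q\<in>set ds. rootin cs (fst q) D R \<and>
        (disc_inside bs (fst q) D R \<or> disc_outside bs (fst q) D R \<or> disc_on_line bs cs D R q)) \<and>
     (\<forall>i<length ds. \<forall>j<i. 4 * R * R <
        gnorm2 (fst (fst (get ds i)) - fst (fst (get ds j)), snd (fst (get ds i)) - snd (fst (get ds j))))"

definition valid_cert :: "int list \<Rightarrow> bnds \<Rightarrow> nat \<Rightarrow> cert \<Rightarrow> bool" where
  "valid_cert cs bs t w \<longleftrightarrow> strips_to cs (fst (fst w)) \<and>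
     deriv_identity (fst (fst w)) (fst (snd (fst w))) (snd (snd (fst w))) \<and>
     length (snd (snd (fst w))) = Suc (length (snd (snd w))) \<and>
     0 < fst (fst (snd w)) \<and> 0 \<le> snd (fst (snd w)) \<and>
     snd (fst (snd w)) * int (Suc t) \<le> fst (fst (snd w)) \<and>
     valid_discs bs (fst (fst w)) (fst (fst (snd w))) (snd (fst (snd w))) (snd (snd w))"

text \<open>The default \<open>(0, 0)\<close> follows the convention that a rectangle not isolating
  a single root denotes 0.\<close>

definition cert_value :: "bnds \<Rightarrow> cert \<Rightarrow> (int \<times> int) \<times> int" where
  "cert_value bs w =
     (if length (filter (\<lambda>q. disc_inside bs (fst q) (fst (fst (snd w))) (snd (fst (snd w)))) (snd (snd w))) = 1
      then fst (get (filter (\<lambda>q. disc_inside bs (fst q) (fst (fst (snd w))) (snd (fst (snd w)))) (snd (snd w))) 0)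
      else (0, 0), fst (fst (snd w)))"

lemma computable_disc_inside [comp_intros]:
  assumes "computable f" "computable g" "computable h" "computable k"
  shows "computable (\<lambda>x. disc_inside (f x) (g x) (h x) (k x))"
  unfolding disc_inside_def bnum_def bden_def by (intro comp_intros assms)

lemma computable_disc_outside [comp_intros]:
  assumes "computable f" "computable g" "computable h" "computable k"
  shows "computable (\<lambda>x. disc_outside (f x) (g x) (h x) (k x))"
  unfolding disc_outside_def bnum_def bden_def by (intro comp_intros assms)

lemma computable_line_identity [comp_intros]:
  assumes "computable a" "computable b" "computable c" "computable d" "computable e"
    "computable f" "computable g" "computable h"
  shows "computable (\<lambda>x. line_identity (a x) (b x) (c x) (d x) (e x) (f x) (g x) (h x))"
  unfolding line_identity_def line_point_def
  by (intro comp_intros assms assms[THEN computable_comp])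

lemma computable_disc_on_line [comp_intros]:
  assumes "computable a" "computable b" "computable c" "computable d" "computable e"
  shows "computable (\<lambda>x. disc_on_line (a x) (b x) (c x) (d x) (e x))"
  unfolding disc_on_line_def bnum_def bden_def across_def along_def
  by (intro comp_intros assms)

lemma computable_strips_to [comp_intros]:
  assumes "computable a" "computable b"
  shows "computable (\<lambda>x. strips_to (a x) (b x))"
  unfolding strips_to_def by (intro comp_intros assms assms[THEN computable_comp])

lemma computable_deriv_identity [comp_intros]:
  assumes "computable a" "computable b" "computable c"
  shows "computable (\<lambda>x. deriv_identity (a x) (b x) (c x))"
  unfolding deriv_identity_def by (intro comp_intros assms assms[THEN computable_comp])

lemma computable_valid_discs [comp_intros]:
  assumes "computable a" "computable b" "computable c" "computable d" "computable e"
  shows "computable (\<lambda>x. valid_discs (a x) (b x) (c x) (d x) (e x))"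
  unfolding valid_discs_def by (intro comp_intros assms assms[THEN computable_comp])

lemma computable_valid_cert [comp_intros]:
  assumes "computable a" "computable b" "computable c" "computable d"
  shows "computable (\<lambda>x. valid_cert (a x) (b x) (c x) (d x))"
  unfolding valid_cert_def by (intro comp_intros assms)

lemma computable_cert_value [comp_intros]:
  assumes "computable a" "computable b"
  shows "computable (\<lambda>x. cert_value (a x) (b x))"
  unfolding cert_value_def by (intro comp_intros assms assms[THEN computable_comp])

section \<open>Soundness of certificates\<close>

definition line_complex :: "nat \<Rightarrow> real \<Rightarrow> complex \<Rightarrow> complex" where
  "line_complex l a y = (if l < 2 then of_real a + \<i> * y else y + \<i> * of_real a)"

lemma gval_line_point:
  assumes "d \<noteq> 0"
  shows "gval (line_point l n d t) / of_int d = line_complex l (of_int n / of_int d) (of_int t)"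
  using assms by (auto simp: gval_def line_point_def line_complex_def complex_eq_iff Re_divide Im_divide
      power2_eq_square)

text \<open>Agreement at more points than the degrees forces equality of polynomials, so the
  identity may be used at a parameter \<open>y\<close> that is not yet known to be real.\<close>

lemma line_identity_root:
  assumes "line_identity cs l n d g h1 h2 e" "d > 0" "cs \<noteq> []" "poly (ipoly g) y = 0"
  shows "poly (ipoly cs) (line_complex l (of_int n / of_int d) y) = 0"
proof -
  define a where "a = real_of_int n / of_int d"
  define L where "L = (if l < 2 then [:of_real a, \<i>:] else [:\<i> * of_real a, 1:])"
  have L: "poly L y = line_complex l a y" for y by (simp add: L_def line_complex_def)
  have degL: "degree L = 1" by (simp add: L_def)
  define N where "N = length cs + length g + length h1 + length h2"
  define P where "P = smult (of_int e * of_int d ^ length cs) (pcompose (ipoly cs) L)"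
  define Q where "Q = smult (of_int d) (ipoly g * (ipoly h1 + smult \<i> (ipoly h2)))"
  have "P = Q"
  proof (rule poly_eqI_degree)
    fix x :: complex assume "x \<in> of_nat ` {..<N}"
    then obtain t where t: "x = of_nat t" "t < N" by auto
    define H where "H = heval cs (line_point l n d (int t)) d"
    have "of_int e * gval H = of_int (ieval g (int t)) *
        (of_int (ieval h1 (int t)) + \<i> * of_int (ieval h2 (int t)))"
      using assms(1) t(2) by (auto simp: line_identity_def N_def gval_def H_def complex_eq_iff
          simp flip: of_int_mult)
    then have "of_int e * gval H = poly (ipoly g) x * (poly (ipoly h1) x + \<i> * poly (ipoly h2) x)"
      by (simp add: of_int_ieval t)
    moreover have "of_int d * gval H = of_int d ^ length cs * poly (ipoly cs) (poly L x)"
      using gval_heval[of d cs] assms(2) gval_line_point[of d l n "int t"] by (simp add: H_def L t a_def)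
    ultimately have "of_int d * (of_int e * gval H) = poly Q x" "of_int e * (of_int d * gval H) = poly P x"
      by (simp_all add: P_def Q_def poly_pcompose algebra_simps)
    then show "poly P x = poly Q x" by (simp add: mult.left_commute)
  next
    have card: "card ((of_nat :: nat \<Rightarrow> complex) ` {..<N}) = N" by (simp add: card_image)
    have pos: "length cs > 0" using assms(3) by simp
    have "degree P \<le> degree (ipoly cs) * degree L"
      unfolding P_def using degree_smult_le degree_pcompose_le le_trans by blast
    also have "\<dots> < N" using degree_ipoly_le[of "map complex_of_int cs"] pos
      by (simp add: degL N_def del: length_greater_0_conv)
    finally show "degree P < card ((of_nat :: nat \<Rightarrow> complex) ` {..<N})" by (simp add: card)
    have "degree (ipoly h1 + smult \<i> (ipoly h2)) \<le> length h1 + length h2"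
      using degree_ipoly_le[of "map complex_of_int h1"] degree_ipoly_le[of "map complex_of_int h2"]
      by (intro degree_add_le) auto
    then have "degree Q \<le> (length g - 1) + (length h1 + length h2)"
      unfolding Q_def using degree_ipoly_le[of "map complex_of_int g"]
      by (intro order.trans[OF degree_smult_le] order.trans[OF degree_mult_le] add_mono) auto
    then show "degree Q < card ((of_nat :: nat \<Rightarrow> complex) ` {..<N})" 
      unfolding card using pos by (simp add: N_def del: length_greater_0_conv)
  qed
  then have "poly P y = poly Q y" by simp
  moreover have "e \<noteq> 0" using assms(1) by (simp add: line_identity_def)
  ultimately show ?thesis using assms(2,4) by (simp add: P_def Q_def poly_pcompose L a_def)
qed

text \<open>Compare orders of vanishing at \<open>z\<close>: differentiation lowers the order of
  \<open>p\<close> by one, and only a zero of \<open>v\<close> can make up for this.\<close>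

lemma roots_of_pderiv_relation:
  fixes p :: "complex poly"
  assumes "u * p = v * pderiv p" "p \<noteq> 0" "v \<noteq> 0" "poly p z = 0"
  shows "poly v z = 0"
proof (rule ccontr)
  assume "poly v z \<noteq> 0"
  then have v: "order z v = 0" by (simp add: order_0I)
  have d: "pderiv p \<noteq> 0"
  proof
    assume "pderiv p = 0"
    then obtain c where "p = [:c:]" using pderiv_eq_0_iff[of p] degree_eq_zeroE by blast
    then show False using assms by auto
  qed
  have "v * pderiv p \<noteq> 0" using assms d by simp
  then have "order z u + order z p = order z v + order z (pderiv p)"
    using assms(1) by (metis order_mult)
  then show False using order_pderiv[OF assms(2,4)] v by simp
qed

lemma deriv_identity_root:
  assumes "deriv_identity cs u v" "cs \<noteq> []" "lead cs \<noteq> 0" "poly (ipoly cs) z = 0"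
  shows "poly (ipoly v) z = 0"
proof -
  define N where "N = length u + length v + length cs"
  have v: "ipoly v \<noteq> 0" using assms(1) by (auto simp: deriv_identity_def ipoly_eq_0_iff)
  have pos: "length cs > 0" using assms(2) by simp
  have "ipoly u * ipoly cs = ipoly v * ipoly (dlist cs)"
  proof (rule poly_eqI_degree)
    fix x :: complex assume "x \<in> of_nat ` {..<N}"
    then obtain t where t: "x = of_nat t" "t < N" by auto
    have "complex_of_int (ieval u (int t) * ieval cs (int t)) =
        of_int (ieval v (int t) * ieval (dlist cs) (int t))"
      using assms(1) t(2) by (simp only: deriv_identity_def N_def)
    then show "poly (ipoly u * ipoly cs) x = poly (ipoly v * ipoly (dlist cs)) x"
      by (simp add: of_int_ieval t)
  next
    have card: "card ((of_nat :: nat \<Rightarrow> complex) ` {..<N}) = N" by (simp add: card_image)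
    have "degree (ipoly u * ipoly cs) \<le> length u + (length cs - 1)"
      using degree_ipoly_le[of "map complex_of_int u"] degree_ipoly_le[of "map complex_of_int cs"]
      by (intro order.trans[OF degree_mult_le] add_mono) auto
    then show "degree (ipoly u * ipoly cs) < card ((of_nat :: nat \<Rightarrow> complex) ` {..<N})"
      unfolding card using pos by (simp add: N_def del: length_greater_0_conv)
    have "degree (ipoly v * ipoly (dlist cs)) \<le> length v + (length cs - 1)"
      using degree_ipoly_le[of "map complex_of_int v"] degree_ipoly_le[of "map complex_of_int (dlist cs)"]
      by (intro order.trans[OF degree_mult_le] add_mono) (auto simp: dlist_def)
    then show "degree (ipoly v * ipoly (dlist cs)) < card ((of_nat :: nat \<Rightarrow> complex) ` {..<N})"
      unfolding card using pos by (simp add: N_def del: length_greater_0_conv)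
  qed
  then show ?thesis
    using roots_of_pderiv_relation[of "ipoly u" "ipoly cs" "ipoly v" z] v ipoly_nonzero[OF assms(2,3)] assms(4)
    by (simp add: ipoly_dlist)
qed

lemma bden_pos: "bden bs l > 0"
  by (simp add: bden_def)

lemma disc_coords:
  assumes "D > 0" "cmod (w - gval z / of_int D) < of_int R / of_int D"
  shows "(of_int (fst z) - of_int R) / of_int D < Re w" "Re w < (of_int (fst z) + of_int R) / of_int D"
    "(of_int (snd z) - of_int R) / of_int D < Im w" "Im w < (of_int (snd z) + of_int R) / of_int D"
proof -
  have "Re (gval z / of_int D) = of_int (fst z) / of_int D" "Im (gval z / of_int D) = of_int (snd z) / of_int D"
    using assms(1) by (simp_all add: gval_def)
  then show "(of_int (fst z) - of_int R) / of_int D < Re w" "Re w < (of_int (fst z) + of_int R) / of_int D"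
    "(of_int (snd z) - of_int R) / of_int D < Im w" "Im w < (of_int (snd z) + of_int R) / of_int D"
    using abs_Re_le_cmod[of "w - gval z / of_int D"] abs_Im_le_cmod[of "w - gval z / of_int D"] assms(2)
    by (auto simp: add_divide_distrib diff_divide_distrib)
qed

definition in_rect :: "bnds \<Rightarrow> complex \<Rightarrow> bool" where
  "in_rect bs z \<longleftrightarrow> bound bs 0 < Re z \<and> Re z < bound bs 1 \<and> bound bs 2 < Im z \<and> Im z < bound bs 3"

lemma bound_less_iff:
  assumes "D > 0"
  shows "bound bs l < of_int x / of_int D \<longleftrightarrow> bnum bs l * D < x * bden bs l"
    "of_int x / of_int D < bound bs l \<longleftrightarrow> x * bden bs l < bnum bs l * D"
    "bound bs l \<le> of_int x / of_int D \<longleftrightarrow> bnum bs l * D \<le> x * bden bs l"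
    "of_int x / of_int D \<le> bound bs l \<longleftrightarrow> x * bden bs l \<le> bnum bs l * D"
proof -
  have *: "real_of_int D > 0" "real_of_int (bden bs l) > 0" using assms bden_pos[of bs l] by simp_all
  show "bound bs l < of_int x / of_int D \<longleftrightarrow> bnum bs l * D < x * bden bs l"
    "of_int x / of_int D < bound bs l \<longleftrightarrow> x * bden bs l < bnum bs l * D"
    "bound bs l \<le> of_int x / of_int D \<longleftrightarrow> bnum bs l * D \<le> x * bden bs l"
    "of_int x / of_int D \<le> bound bs l \<longleftrightarrow> x * bden bs l \<le> bnum bs l * D"
    using * unfolding bound_def by (simp_all add: field_simps flip: of_int_mult)
qed

lemma disc_inside_iff:
  assumes "D > 0"
  shows "disc_inside bs z D R \<longleftrightarrow>
     bound bs 0 < (of_int (fst z) - of_int R) / of_int D \<and> (of_int (fst z) + of_int R) / of_int D < bound bs 1 \<and>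
     bound bs 2 < (of_int (snd z) - of_int R) / of_int D \<and> (of_int (snd z) + of_int R) / of_int D < bound bs 3"
  unfolding disc_inside_def by (simp add: bound_less_iff[OF assms] flip: of_int_add of_int_diff)

lemma disc_outside_iff:
  assumes "D > 0"
  shows "disc_outside bs z D R \<longleftrightarrow>
     (of_int (fst z) + of_int R) / of_int D \<le> bound bs 0 \<or> bound bs 1 \<le> (of_int (fst z) - of_int R) / of_int D \<or>
     (of_int (snd z) + of_int R) / of_int D \<le> bound bs 2 \<or> bound bs 3 \<le> (of_int (snd z) - of_int R) / of_int D"
  unfolding disc_outside_def by (simp add: bound_less_iff[OF assms] flip: of_int_add of_int_diff)

text \<open>Pigeonhole: the disjoint discs yield \<open>length ds\<close> distinct zeros of
  \<open>v\<close>, which has no more than that many. These are therefore all zeros of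
  \<open>v\<close>, and in particular they include every root of \<open>cs\<close>.\<close>

lemma valid_discs_roots:
  assumes "valid_discs bs cs D R ds" "deriv_identity cs u v" "length v = Suc (length ds)"
    "cs \<noteq> []" "lead cs \<noteq> 0" "D > 0" "R \<ge> 0"
  obtains W where
    "\<And>i. i < length ds \<Longrightarrow> poly (ipoly cs) (W i) = 0"
    "\<And>i. i < length ds \<Longrightarrow> cmod (W i - gval (fst (ds ! i)) / of_int D) < of_int R / of_int D"
    "\<And>z. poly (ipoly cs) z = 0 \<Longrightarrow> \<exists>i<length ds. z = W i"
    "\<And>i z. i < length ds \<Longrightarrow> poly (ipoly cs) z = 0 \<Longrightarrow>
       cmod (z - gval (fst (ds ! i)) / of_int D) < of_int R / of_int D \<Longrightarrow> z = W i"
    "inj_on W {..<length ds}"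
proof -
  define c where "c i = gval (fst (ds ! i)) / of_int D" for i
  define r where "r = real_of_int R / of_int D"
  have "\<forall>i<length ds. \<exists>w. poly (ipoly cs) w = 0 \<and> cmod (w - c i) < r"
    using assms(1,6,7) by (auto simp: valid_discs_def c_def r_def intro!: rootin_imp_root)
  then obtain W where W: "\<And>i. i < length ds \<Longrightarrow> poly (ipoly cs) (W i) = 0"
    "\<And>i. i < length ds \<Longrightarrow> cmod (W i - c i) < r" by metis
  have far: "2 * r < cmod (c i - c j)" if "i < length ds" "j < i" for i j
  proof -
    define z where "z = (fst (fst (ds ! i)) - fst (fst (ds ! j)), snd (fst (ds ! i)) - snd (fst (ds ! j)))"
    have "4 * R * R < gnorm2 z"
      using assms(1) that unfolding valid_discs_def z_def by (force simp: get_nth)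
    then have "real_of_int (4 * R * R) < of_int (gnorm2 z)" by (simp only: of_int_less_iff)
    then have "(2 * of_int R)\<^sup>2 < (cmod (gval z))\<^sup>2" 
      unfolding cmod_gval by (simp add: power2_eq_square)
    then have "2 * of_int R < cmod (gval z)" by (rule power2_less_imp_less) simp
    moreover have "c i - c j = gval z / of_int D"
      using assms(6) by (simp add: c_def gval_def z_def complex_eq_iff diff_divide_distrib)
    ultimately show ?thesis using assms(6) by (simp add: r_def norm_divide divide_strict_right_mono)
  qed
  have disj: "i = j" if "i < length ds" "j < length ds" "cmod (z - c i) < r" "cmod (z - c j) < r" for i j z
  proof (rule ccontr)
    assume "i \<noteq> j"
    then have "2 * r < cmod (c i - c j)" using far[of i j] far[of j i] that by (metis linorder_neqE_nat norm_minus_commute)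
    moreover have "cmod (c i - c j) \<le> cmod (z - c i) + cmod (z - c j)"
      using norm_triangle_ineq4[of "z - c j" "z - c i"] by (simp add: add.commute)
    ultimately show False using that by simp
  qed
  have inj: "inj_on W {..<length ds}"
    using disj W(2) by (metis (no_types, lifting) inj_onI lessThan_iff)
  have fin: "finite {z. poly (ipoly v) z = 0}" and v0: "ipoly v \<noteq> 0"
    using assms(2) by (auto simp: deriv_identity_def ipoly_eq_0_iff intro!: poly_roots_finite)
  have "card {z. poly (ipoly v) z = 0} \<le> length ds"
    using card_poly_roots_bound[OF v0] degree_ipoly_le[of "map complex_of_int v"] assms(3) by simp
  moreover have "card (W ` {..<length ds}) = length ds" using inj by (simp add: card_image)
  moreover have sub: "W ` {..<length ds} \<subseteq> {z. poly (ipoly v) z = 0}"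
    using W(1) deriv_identity_root[OF assms(2,4,5)] by auto
  ultimately have eq: "W ` {..<length ds} = {z. poly (ipoly v) z = 0}"
    using fin by (metis card_seteq)
  have all: "\<exists>i<length ds. z = W i" if "poly (ipoly cs) z = 0" for z
  proof -
    have "z \<in> W ` {..<length ds}" using deriv_identity_root[OF assms(2,4,5) that] eq by simp
    then show ?thesis by auto
  qed
  have "z = W i" if "i < length ds" "poly (ipoly cs) z = 0" "cmod (z - c i) < r" for i z
    using all[OF that(2)] disj[OF that(1) _ that(3)] W(2) by blast
  then show ?thesis using W all inj by (intro that[of W]) (auto simp: c_def r_def)
qed

lemma disc_on_line_not_in_rect:
  assumes "disc_on_line bs cs D R q" "D > 0" "R \<ge> 0" "cs \<noteq> []"
    "poly (ipoly cs) w = 0" "cmod (w - gval (fst q) / of_int D) < of_int R / of_int D"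
    "\<And>z. poly (ipoly cs) z = 0 \<Longrightarrow> cmod (z - gval (fst q) / of_int D) < of_int R / of_int D \<Longrightarrow> z = w"
  shows "\<not> in_rect bs w"
proof -
  obtain z l g h1 h2 e where q: "q = (z, l, (g, h1, h2), e)" by (metis prod.exhaust)
  have l: "l < 4" and ac: "across l z * bden bs l = bnum bs l * D"
    and ri: "rootin g (along l z, 0) D R"
    and li: "line_identity cs l (bnum bs l) (bden bs l) g h1 h2 e"
    using assms(1) by (simp_all add: disc_on_line_def q)
  define a where "a = bound bs l"
  have a: "of_int (across l z) / of_int D = a"
    using ac assms(2) bden_pos[of bs l] by (simp add: a_def bound_def field_simps flip: of_int_mult)
  obtain y where y: "poly (ipoly g) y = 0" "cmod (y - of_int (along l z) / of_int D) < of_int R / of_int D"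
    using rootin_imp_root[OF ri assms(2,3)] by (auto simp: gval_def complex_of_real_def[symmetric])
  have cn: "gval z / of_int D = line_complex l a (of_int (along l z) / of_int D)"
    using a assms(2) by (auto simp: gval_def line_complex_def across_def along_def complex_eq_iff
        split: if_splits)
  have *: "line_complex l a x = w" if "poly (ipoly g) x = 0" "cmod (x - of_int (along l z) / of_int D) < of_int R / of_int D" for x
  proof (rule assms(7))
    show "poly (ipoly cs) (line_complex l a x) = 0"
      using line_identity_root[OF li bden_pos assms(4) that(1)] by (simp add: a_def bound_def)
    have "cmod (line_complex l a x - line_complex l a x') = cmod (x - x')" for x'
      by (auto simp: line_complex_def norm_mult simp flip: right_diff_distrib)
    then show "cmod (line_complex l a x - gval (fst q) / complex_of_int D) < of_int R / of_int D"
      using that(2) by (simp add: q cn)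
  qed
  have "cmod (cnj y - of_int (along l z) / of_int D) = cmod (cnj (y - of_int (along l z) / of_int D))"
    by simp
  then have "cmod (cnj y - of_int (along l z) / of_int D) < of_int R / of_int D"
    using y(2) by (simp only: complex_mod_cnj)
  then have "line_complex l a (cnj y) = w" using *[of "cnj y"] y(1) by (simp add: ipoly_cnj)
  moreover have w: "line_complex l a y = w" using * y by blast
  ultimately have "cnj y = y" by (auto simp: line_complex_def split: if_splits)
  then have "Im y = 0" by (simp add: complex_eq_iff)
  then have "(if l < 2 then Re w else Im w) = a" using w by (auto simp: line_complex_def)
  moreover have "l = 0 \<or> l = 1 \<or> l = 2 \<or> l = 3" using l by auto
  ultimately show ?thesis by (auto simp: in_rect_def a_def)
qed

definition rect_root :: "int list \<Rightarrow> bnds \<Rightarrow> complex" where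
  "rect_root cs bs = (if card {z. poly (ipoly cs) z = 0 \<and> in_rect bs z} = 1
     then the_elem {z. poly (ipoly cs) z = 0 \<and> in_rect bs z} else 0)"

lemma alg_decode_enc:
  "alg_decode (enc (cs :: int list, bs :: bnds)) =
    (if (\<exists>c\<in>set cs. c \<noteq> 0) \<and> length bs = 4 then rect_root cs bs else 0)"
proof -
  have cs: "map (\<lambda>c. of_int (int_decode c)) (list_decode (enc cs)) = map complex_of_int cs"
    by (simp add: enc_list_def o_def enc_int_def)
  have bs: "map rat_decode (list_decode (enc bs)) = map (\<lambda>b. of_int (fst b) / of_int (int (Suc (snd b)))) bs"
    by (simp add: enc_list_def o_def enc_prod_def enc_int_def enc_nat_def rat_decode_def)
  have "map rat_decode (list_decode (enc bs)) ! l = bound bs l" if "l < length bs" for l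
    using that by (simp add: bs bound_def bnum_def bden_def get_nth)
  then have "{z. poly (ipoly cs) z = 0 \<and> length (map rat_decode (list_decode (enc bs))) = 4 \<and>
       map rat_decode (list_decode (enc bs)) ! 0 < Re z \<and> Re z < map rat_decode (list_decode (enc bs)) ! 1 \<and>
       map rat_decode (list_decode (enc bs)) ! 2 < Im z \<and> Im z < map rat_decode (list_decode (enc bs)) ! 3}
     = (if length bs = 4 then {z. poly (ipoly cs) z = 0 \<and> in_rect bs z} else {})"
    unfolding in_rect_def by (auto simp: enc_list_def)
  then show ?thesis
    unfolding alg_decode_def Let_def enc_prod_def fst_conv snd_conv prod_encode_inverse prod.case cs
    by (simp add: rect_root_def ipoly_eq_0_iff)
qed

lemma strips_to_ipoly:
  assumes "strips_to cs cs0"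
  shows "ipoly cs = ipoly cs0"
proof (rule poly_eqI)
  fix n
  show "coeff (ipoly cs) n = coeff (ipoly cs0) n"
    using assms by (auto simp: strips_to_def coeff_Poly_eq nth_default_def get_nth split: if_splits)
qed

text \<open>Every root sits in exactly one disc, and the classification of that disc decides whether
  the root lies in the rectangle. If one disc is inside, its centre is within \<open>R / D\<close>
  of the root; otherwise the value 0 is exact.\<close>

theorem valid_cert_approx:
  assumes "valid_cert cs bs t w" "cert_value bs w = (x, D)"
  shows "D > 0" "cmod (rect_root cs bs - gval x / of_int D) \<le> 1 / of_nat (Suc t)"
proof -
  obtain cs0 u v D' R ds where w: "w = ((cs0, u, v), (D', R), ds)" by (metis prod.exhaust)
  have D': "D' = D" using assms(2) by (simp add: w cert_value_def)
  have st: "strips_to cs cs0" and de: "deriv_identity cs0 u v" and lv: "length v = Suc (length ds)"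
    and D: "D > 0" and R: "R \<ge> 0" and pr: "R * int (Suc t) \<le> D" and vd: "valid_discs bs cs0 D R ds"
    using assms(1) by (simp_all add: valid_cert_def w D')
  show "D > 0" by (rule D)
  have c0: "cs0 \<noteq> []" "lead cs0 \<noteq> 0" using st by (auto simp: strips_to_def)
  obtain W where W: "\<And>i. i < length ds \<Longrightarrow> poly (ipoly cs0) (W i) = 0"
    "\<And>i. i < length ds \<Longrightarrow> cmod (W i - gval (fst (ds ! i)) / of_int D) < of_int R / of_int D"
    "\<And>z. poly (ipoly cs0) z = 0 \<Longrightarrow> \<exists>i<length ds. z = W i"
    "\<And>i z. i < length ds \<Longrightarrow> poly (ipoly cs0) z = 0 \<Longrightarrow>
       cmod (z - gval (fst (ds ! i)) / of_int D) < of_int R / of_int D \<Longrightarrow> z = W i"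
    "inj_on W {..<length ds}"
    by (rule valid_discs_roots[OF vd de lv c0 D R]) (rule that; blast)
  define ins where "ins q = disc_inside bs (fst q) D R" for q :: disc
  have in_iff: "in_rect bs (W i) \<longleftrightarrow> ins (ds ! i)" if i: "i < length ds" for i
  proof
    assume "ins (ds ! i)"
    then show "in_rect bs (W i)"
      using disc_coords[OF D W(2)[OF i]] unfolding ins_def disc_inside_iff[OF D] in_rect_def by linarith
  next
    assume ir: "in_rect bs (W i)"
    have "\<not> disc_outside bs (fst (ds ! i)) D R"
      using disc_coords[OF D W(2)[OF i]] ir unfolding disc_outside_iff[OF D] in_rect_def by linarith
    moreover have "\<not> disc_on_line bs cs0 D R (ds ! i)"
      using disc_on_line_not_in_rect[OF _ D R c0(1) W(1)[OF i] W(2)[OF i] W(4)[OF i]] ir by blast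
    ultimately show "ins (ds ! i)" using vd i unfolding valid_discs_def ins_def by (meson nth_mem)
  qed
  have set_eq: "{z. poly (ipoly cs) z = 0 \<and> in_rect bs z} = W ` {i. i < length ds \<and> ins (ds ! i)}"
    unfolding strips_to_ipoly[OF st] using W(1,3) in_iff by blast
  have card_eq: "card {z. poly (ipoly cs) z = 0 \<and> in_rect bs z} = length (filter ins ds)"
    unfolding set_eq length_filter_conv_card by (rule card_image) (rule inj_on_subset[OF W(5)], auto)
  have xval: "x = (if length (filter ins ds) = 1 then fst (get (filter ins ds) 0) else (0, 0))"
    using assms(2) unfolding cert_value_def w D' fst_conv snd_conv ins_def[abs_def] by auto
  show "cmod (rect_root cs bs - gval x / of_int D) \<le> 1 / of_nat (Suc t)"
  proof (cases "length (filter ins ds) = 1")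
    case True
    then obtain q where q: "filter ins ds = [q]" by (auto simp: length_Suc_conv)
    have "q \<in> set (filter ins ds)" by (simp add: q)
    then obtain i where i: "i < length ds" "ds ! i = q" "ins q" by (auto simp: in_set_conv_nth)
    have xq: "x = fst q" using xval q by (simp add: get_nth)
    have "W i \<in> {z. poly (ipoly cs) z = 0 \<and> in_rect bs z}" using i set_eq by auto
    then have "{z. poly (ipoly cs) z = 0 \<and> in_rect bs z} = {W i}"
      using card_eq True by (metis card_1_singletonE singletonD)
    then have "rect_root cs bs = W i" by (simp add: rect_root_def)
    moreover have "real_of_int R / of_int D \<le> 1 / of_nat (Suc t)"
    proof -
      have "real_of_int (R * int (Suc t)) \<le> of_int D" using pr by (simp only: of_int_le_iff)
      then show ?thesis using D by (simp add: field_simps)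
    qed
    ultimately show ?thesis using W(2)[OF i(1)] by (simp add: xq i(2))
  next
    case False
    then show ?thesis using xval card_eq by (simp add: rect_root_def gval_def complex_eq_iff norm_complex_def)
  qed
qed

section \<open>Existence of certificates\<close>

abbreviation rp :: "rat poly \<Rightarrow> complex poly" where
  "rp P \<equiv> map_poly of_rat P"

lemma rp_add: "rp (P + Q) = rp P + rp Q"
  by (rule poly_eqI) (simp add: coeff_map_poly of_rat_add)

lemma rp_diff: "rp (P - Q) = rp P - rp Q"
  by (rule poly_eqI) (simp add: coeff_map_poly of_rat_diff)

lemma rp_mult: "rp (P * Q) = rp P * rp Q"
  by (rule poly_eqI) (simp add: coeff_map_poly coeff_mult of_rat_sum of_rat_mult)

lemma rp_pderiv: "rp (pderiv P) = pderiv (rp P)"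
  by (rule poly_eqI) (simp add: coeff_map_poly coeff_pderiv of_rat_mult of_rat_add)

lemma rp_eq_0_iff: "rp P = 0 \<longleftrightarrow> P = 0"
  by (rule map_poly_eq_0_iff) auto

lemma degree_rp: "degree (rp P) = degree P"
  by (rule degree_map_poly) auto

lemma ipoly_eq_rp: "ipoly cs = rp (Poly (map of_int cs))"
  by (rule poly_eqI) (simp add: coeff_map_poly coeff_Poly_eq nth_default_def)

lemma rp_real: "poly (rp P) (complex_of_real y) \<in> \<real>"
proof (induction P)
  case (pCons a P)
  have "complex_of_rat a \<in> \<real>" by (cases a) (auto simp: of_rat_rat)
  then show ?case using pCons by (auto simp: map_poly_pCons)
qed auto

lemma ipoly_map_mult: "ipoly (map ((*) k) cs) = smult (of_int k) (ipoly cs)"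
  by (rule poly_eqI) (auto simp: coeff_Poly_eq nth_default_def)

lemma common_denominator: "\<exists>e>0. \<exists>cs. map rat_of_int cs = map ((*) (of_int e)) xs"
proof (induction xs)
  case Nil
  show ?case by (rule exI[of _ 1]) simp
next
  case (Cons x xs)
  then obtain e cs where e: "e > 0" "map rat_of_int cs = map ((*) (of_int e)) xs" by blast
  obtain a b where x: "x = of_int a / of_int b" "b > 0"
    by (metis quotient_of_denom_pos quotient_of_div surj_pair)
  have "map rat_of_int (map ((*) b) cs) = map ((*) (of_int b)) (map ((*) (of_int e)) xs)"
    unfolding e(2)[symmetric] by (simp add: o_def)
  then have "map rat_of_int ((a * e) # map ((*) b) cs) = map ((*) (of_int (b * e))) (x # xs)"
    using x by (simp add: o_def mult.assoc)
  then show ?case using e(1) x(2) by (metis mult_pos_pos)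
qed

text \<open>\<open>coeffs P\<close> has no trailing zeros, so clearing denominators preserves the
  length and keeps the last entry nonzero.\<close>

lemma rat_poly_to_int:
  obtains e cs where "e > 0" "length cs = length (coeffs P)"
    "ipoly cs = smult (of_int e) (rp P)" "P \<noteq> 0 \<Longrightarrow> cs \<noteq> [] \<and> lead cs \<noteq> 0"
proof -
  obtain e cs where e: "e > 0" "map rat_of_int cs = map ((*) (of_int e)) (coeffs P)"
    using common_denominator by blast
  have len: "length cs = length (coeffs P)" using e(2) by (metis length_map)
  have nth: "rat_of_int (cs ! i) = of_int e * coeffs P ! i" if "i < length cs" for i
    using arg_cong[OF e(2), of "\<lambda>xs. xs ! i"] that len by simp
  have "coeff (ipoly cs) i = coeff (smult (of_int e) (rp P)) i" for i
  proof (cases "i < length cs")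
    case True
    have "complex_of_int (cs ! i) = of_rat (rat_of_int (cs ! i))" by simp
    also have "\<dots> = of_int e * of_rat (coeffs P ! i)" unfolding nth[OF True] by (simp add: of_rat_mult)
    finally show ?thesis
      using True len by (simp add: coeff_Poly_eq nth_default_def coeff_map_poly
          flip: nth_default_coeffs_eq[of P])
  next
    case False
    then have "coeff P i = 0" using len by (metis nth_default_beyond not_less nth_default_coeffs_eq)
    then show ?thesis using False by (simp add: coeff_Poly_eq nth_default_def coeff_map_poly)
  qed
  then have "ipoly cs = smult (of_int e) (rp P)" by (rule poly_eqI)
  moreover have "cs \<noteq> [] \<and> lead cs \<noteq> 0" if "P \<noteq> 0"
  proof -
    have ne: "coeffs P \<noteq> []" using that by simp
    then have ne': "cs \<noteq> []" using len by (metis length_0_conv)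
    then have "rat_of_int (lead cs) = of_int e * last (coeffs P)"
      using nth[of "length cs - 1"] len ne by (simp add: lead_def get_nth last_conv_nth)
    moreover have "last (coeffs P) \<noteq> 0" using that by (simp add: last_coeffs_eq_coeff_degree)
    ultimately show ?thesis using ne' e(1) by auto
  qed
  ultimately show ?thesis using e(1) len that by blast
qed

lemma card_roots_rsquarefree:
  assumes "rsquarefree (p :: complex poly)"
  shows "card {z. poly p z = 0} = degree p"
proof -
  have p0: "p \<noteq> 0" using assms by (simp add: rsquarefree_def)
  have "p = smult (lead_coeff p) (\<Prod>z|poly p z = 0. [:-z, 1:])"
    using complex_poly_decompose_rsquarefree[OF assms] by simp
  then have "degree p = degree (\<Prod>z|poly p z = 0. [:-z, 1:])"
    using p0 by (metis degree_smult_eq leading_coeff_0_iff)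
  also have "\<dots> = (\<Sum>z|poly p z = 0. degree [:-z, 1:])"
    by (rule degree_prod_eq_sum_degree) auto
  finally show ?thesis by simp
qed

text \<open>Over the rationals take \<open>v\<close> and \<open>u\<close> as the quotients of
  \<open>P\<close> and \<open>pderiv P\<close> by their gcd. Then \<open>v\<close> is squarefree
  with the roots of \<open>P\<close>, so its degree is the number of distinct roots. Constants are
  treated separately because the decomposition needs a nonzero derivative.\<close>

lemma exists_deriv_identity:
  assumes "cs \<noteq> []" "lead cs \<noteq> 0"
  obtains u v where "deriv_identity cs u v" "length v = Suc (card {z. poly (ipoly cs) z = 0})"
proof (cases "length cs = 1")
  case True
  then obtain c where c: "cs = [c]" by (auto simp: length_Suc_conv)
  then have "c \<noteq> 0" using assms by (simp add: lead_def get_nth)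
  then have "deriv_identity cs [] [1]" "{z. poly (ipoly cs) z = 0} = {}"
    using c by (auto simp: deriv_identity_def ieval_def dlist_def)
  then show ?thesis using that[of "[]" "[1]"] by simp
next
  case False
  define P where "P = Poly (map rat_of_int cs)"
  have iP: "ipoly cs = rp P" by (simp add: P_def ipoly_eq_rp)
  have P0: "P \<noteq> 0" using ipoly_nonzero[OF assms] iP by (auto simp: rp_eq_0_iff)
  have "degree P = length cs - 1" using degree_ipoly[OF assms] degree_rp[of P] iP by simp
  moreover have "length cs \<ge> 2" using False assms(1) by (cases cs) (auto simp: Suc_le_eq)
  ultimately have "degree P > 0" by simp
  then have dP0: "pderiv P \<noteq> 0" by (simp add: pderiv_eq_0_iff)
  define d where "d = gcd P (pderiv P)"
  obtain V where V: "P = V * d" unfolding d_def by (metis dvdE gcd_dvd1 mult.commute)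
  obtain U where U: "pderiv P = U * d" unfolding d_def by (metis dvdE gcd_dvd2 mult.commute)
  obtain r s where rs: "d = r * P + s * pderiv P"
    using bezout_coefficients_fst_snd[of P "pderiv P"] unfolding d_def by metis
  have "rsquarefree (rp V) \<and> (\<forall>a. poly (rp V) a = 0 \<longleftrightarrow> poly (rp P) a = 0)"
  proof (rule poly_squarefree_decomp)
    show "pderiv (rp P) \<noteq> 0" using dP0 by (simp add: rp_eq_0_iff flip: rp_pderiv)
    show "rp P = rp V * rp d" by (metis V rp_mult)
    show "pderiv (rp P) = rp U * rp d" by (metis U rp_mult rp_pderiv)
    show "rp d = rp r * rp P + rp s * pderiv (rp P)" by (metis rs rp_add rp_mult rp_pderiv)
  qed
  then have card: "card {z. poly (ipoly cs) z = 0} = degree V"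
    using card_roots_rsquarefree[of "rp V"] by (simp add: iP degree_rp)
  have V0: "V \<noteq> 0" using V P0 by auto
  obtain eu u where u: "eu > 0" "ipoly u = smult (of_int eu) (rp U)" by (rule rat_poly_to_int[of U])
  obtain ev v where v: "ev > 0" "ipoly v = smult (of_int ev) (rp V)" "length v = length (coeffs V)"
    by (rule rat_poly_to_int[of V])
  \<comment> \<open>Each list is multiplied by the denominator of the other, so that both carry the
    same factor \<open>eu * ev\<close> and the identity survives.\<close>
  define u' where "u' = map ((*) ev) u"
  define v' where "v' = map ((*) eu) v"
  have iu: "ipoly u' = smult (of_int (eu * ev)) (rp U)" and iv: "ipoly v' = smult (of_int (eu * ev)) (rp V)"
    unfolding u'_def v'_def ipoly_map_mult u v by (simp_all add: mult.commute)
  have UP: "rp U * rp P = rp V * pderiv (rp P)"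
    by (metis U V mult.assoc mult.commute rp_mult rp_pderiv)
  have id: "ipoly u' * ipoly cs = ipoly v' * ipoly (dlist cs)"
    by (simp add: iu iv ipoly_dlist iP UP)
  have "deriv_identity cs u' v'"
    unfolding deriv_identity_def
  proof (intro conjI allI impI)
    have "ipoly v' \<noteq> 0" using iv V0 u(1) v(1) by (simp add: rp_eq_0_iff)
    then show "\<exists>c\<in>set v'. c \<noteq> 0" by (simp add: ipoly_eq_0_iff)
    fix t
    have "complex_of_int (ieval u' (int t) * ieval cs (int t)) =
        of_int (ieval v' (int t) * ieval (dlist cs) (int t))"
      using arg_cong[OF id, of "\<lambda>p. poly p (of_int (int t))"] by (simp add: of_int_ieval)
    then show "ieval u' (int t) * ieval cs (int t) = ieval v' (int t) * ieval (dlist cs) (int t)"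
      by (simp only: of_int_eq_iff)
  qed
  moreover have "length v' = Suc (card {z. poly (ipoly cs) z = 0})"
    using V0 by (simp add: v'_def v card length_coeffs)
  ultimately show ?thesis by (rule that)
qed

lemma pcompose_rat_decomposition:
  assumes "L = rp L1 + smult \<i> (rp L2)"
  shows "\<exists>A B. pcompose (ipoly cs) L = rp A + smult \<i> (rp B)"
proof (induction cs)
  case Nil
  have "pcompose (ipoly []) L = rp 0 + smult \<i> (rp 0)" by simp
  then show ?case by blast
next
  case (Cons c cs)
  then obtain A B where AB: "pcompose (ipoly cs) L = rp A + smult \<i> (rp B)" by blast
  have c: "[:of_int c:] = rp [:of_int c:]" by (simp add: map_poly_pCons)
  have "pcompose (ipoly (c # cs)) L = rp [:of_int c:] + (rp L1 + smult \<i> (rp L2)) * (rp A + smult \<i> (rp B))"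
    using AB by (simp add: pcompose_pCons c[symmetric]) (simp add: AB flip: assms)
  also have "\<dots> = rp ([:of_int c:] + (L1 * A - L2 * B)) + smult \<i> (rp (L1 * B + L2 * A))"
    by (simp only: rp_add rp_diff rp_mult) (simp add: algebra_simps smult_add_right)
  finally show ?case by blast
qed

text \<open>The restriction to the line is \<open>A + \<i> B\<close> with rational \<open>A\<close>
  and \<open>B\<close>. At a real parameter it vanishes only if both do, and by Bezout their gcd
  vanishes there as well; this gcd is the divisor sought.\<close>

lemma exists_line_identity:
  assumes "cs \<noteq> []" "lead cs \<noteq> 0" "d > 0" "poly (ipoly cs) (line_complex l (of_int n / of_int d) (of_real y)) = 0"
  obtains g h1 h2 e where "line_identity cs l n d g h1 h2 e" "g \<noteq> []" "lead g \<noteq> 0" "poly (ipoly g) (of_real y) = 0"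
proof -
  define a where "a = rat_of_int n / of_int d"
  define L1 where "L1 = (if l < 2 then [:a:] else [:0, 1:])"
  define L2 where "L2 = (if l < 2 then [:0, 1:] else [:a:])"
  define L where "L = rp L1 + smult \<i> (rp L2)"
  have ra: "of_rat a = complex_of_real (of_int n / of_int d)" by (simp add: a_def of_rat_divide)
  have L: "poly L x = line_complex l (of_int n / of_int d) x" for x
    by (simp add: L_def L1_def L2_def line_complex_def map_poly_pCons ra)
  have degL: "degree L = 1"
    by (simp add: L_def L1_def L2_def map_poly_pCons)
  obtain A B where AB: "pcompose (ipoly cs) L = rp A + smult \<i> (rp B)"
    using pcompose_rat_decomposition[OF L_def] by blast
  have "pcompose (ipoly cs) L \<noteq> 0"
    using ipoly_nonzero[OF assms(1,2)] degL pcompose_eq_0[of "ipoly cs" L] by auto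
  then have AB0: "A \<noteq> 0 \<or> B \<noteq> 0" using AB by auto
  define G where "G = gcd A B"
  have G0: "G \<noteq> 0" using AB0 by (simp add: G_def)
  obtain H1 where H1: "A = G * H1" unfolding G_def by (metis dvdE gcd_dvd1)
  obtain H2 where H2: "B = G * H2" unfolding G_def by (metis dvdE gcd_dvd2)
  obtain r s where rs: "G = r * A + s * B"
    using bezout_coefficients_fst_snd[of A B] unfolding G_def by metis
  have "poly (rp A) (of_real y) + \<i> * poly (rp B) (of_real y) = 0"
    using assms(4) arg_cong[OF AB, of "\<lambda>p. poly p (of_real y)"] by (simp add: poly_pcompose L)
  moreover obtain a' b' where "poly (rp A) (complex_of_real y) = of_real a'" "poly (rp B) (complex_of_real y) = of_real b'"
    using rp_real[of A y] rp_real[of B y] by (auto elim!: Reals_cases)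
  ultimately have AB_y: "poly (rp A) (of_real y) = 0" "poly (rp B) (of_real y) = 0"
    by (auto simp: complex_eq_iff)
  have "rp G = rp r * rp A + rp s * rp B" by (metis rs rp_add rp_mult)
  then have Gy: "poly (rp G) (of_real y) = 0" using AB_y by simp
  obtain eg g where g: "eg > 0" "ipoly g = smult (of_int eg) (rp G)" "g \<noteq> []" "lead g \<noteq> 0"
    using rat_poly_to_int[of G] G0 by metis
  obtain e1 k1 where k1: "e1 > 0" "ipoly k1 = smult (of_int e1) (rp H1)" by (rule rat_poly_to_int[of H1])
  obtain e2 k2 where k2: "e2 > 0" "ipoly k2 = smult (of_int e2) (rp H2)" by (rule rat_poly_to_int[of H2])
  define m where "m = length cs"
  \<comment> \<open>The factor \<open>d ^ m\<close> here and the factor \<open>d\<close> in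
    \<open>e\<close> account for the power of the denominator contained in \<open>heval\<close>;
    \<open>e1\<close> and \<open>e2\<close> are crossed to give real and imaginary part a common
    multiplier.\<close>
  define h1 where "h1 = map ((*) (e2 * d ^ m)) k1"
  define h2 where "h2 = map ((*) (e1 * d ^ m)) k2"
  define e where "e = eg * e1 * e2 * d"
  have "line_identity cs l n d g h1 h2 e"
    unfolding line_identity_def
  proof (intro conjI allI impI)
    show "e \<noteq> 0" using g k1 k2 assms(3) by (simp add: e_def)
    fix t
    define H where "H = heval cs (line_point l n d (int t)) d"
    define x where "x = complex_of_int (int t)"
    have "of_int d * gval H = of_int d ^ m * poly (pcompose (ipoly cs) L) x"
      using gval_heval[of d cs "line_point l n d (int t)"] gval_line_point[of d l n "int t"] assms(3)
      by (simp add: H_def m_def poly_pcompose L x_def)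
    also have "poly (pcompose (ipoly cs) L) x = poly (rp G) x * (poly (rp H1) x + \<i> * poly (rp H2) x)"
      unfolding AB H1 H2 by (simp add: rp_mult algebra_simps)
    finally have dH: "of_int d * gval H =
        of_int d ^ m * (poly (rp G) x * (poly (rp H1) x + \<i> * poly (rp H2) x))" .
    have "of_int e * gval H = of_int (eg * e1 * e2) * (of_int d * gval H)" by (simp add: e_def)
    also have "\<dots> = (of_int eg * poly (rp G) x) *
        (of_int (e2 * d ^ m) * (of_int e1 * poly (rp H1) x) + \<i> * (of_int (e1 * d ^ m) * (of_int e2 * poly (rp H2) x)))"
      unfolding dH by (simp add: algebra_simps)
    also have "\<dots> = of_int (ieval g (int t)) * (of_int (ieval h1 (int t)) + \<i> * of_int (ieval h2 (int t)))"
      unfolding of_int_ieval h1_def h2_def ipoly_map_mult g k1 k2 by (simp add: x_def)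
    finally have eq: "of_int e * gval H = of_int (ieval g (int t)) * (of_int (ieval h1 (int t)) + \<i> * of_int (ieval h2 (int t)))" .
    have "real_of_int (e * fst H) = of_int (ieval g (int t) * ieval h1 (int t))"
      using arg_cong[OF eq, of Re] by (simp add: gval_def)
    moreover have "real_of_int (e * snd H) = of_int (ieval g (int t) * ieval h2 (int t))"
      using arg_cong[OF eq, of Im] by (simp add: gval_def)
    ultimately show
      "e * fst (heval cs (line_point l n d (int t)) d) = ieval g (int t) * ieval h1 (int t)"
      "e * snd (heval cs (line_point l n d (int t)) d) = ieval g (int t) * ieval h2 (int t)"
      by (simp_all only: H_def of_int_eq_iff)
  qed
  moreover have "poly (ipoly g) (of_real y) = 0" using Gy by (simp add: g)
  ultimately show ?thesis using g by (intro that)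
qed

definition coord :: "nat \<Rightarrow> complex \<Rightarrow> real" where
  "coord l z = (if l < 2 then Re z else Im z)"

lemma floor_approx:
  assumes "D > 0"
  shows "\<bar>of_int \<lfloor>of_int D * x\<rfloor> / of_int D - x\<bar> \<le> 1 / real_of_int D"
proof -
  have "\<bar>of_int \<lfloor>of_int D * x\<rfloor> - of_int D * x\<bar> \<le> 1" by linarith
  moreover have "of_int \<lfloor>of_int D * x\<rfloor> / of_int D - x = (of_int \<lfloor>of_int D * x\<rfloor> - of_int D * x) / of_int D"
    using assms by (simp add: field_simps)
  ultimately show ?thesis using assms by (simp add: divide_right_mono)
qed

text \<open>The radius is always \<open>1 / T\<close>, while the denominator
  \<open>T * W * B\<close> grows with \<open>W\<close> and moves the centre as close to
  \<open>z\<close> as needed. The factor \<open>B\<close> makes each bound a multiple of the grid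
  width, so a centre can be placed exactly on a boundary line. A root off all four lines is more
  than two radii away from each, which puts its disc strictly on one side. The claim covers all
  large \<open>W\<close> so that one \<open>W\<close> can serve all roots.\<close>

lemma exists_root_disc:
  assumes cs: "cs \<noteq> []" "lead cs \<noteq> 0" and z: "poly (ipoly cs) z = 0" and T: "T > 0"
    and margin: "\<And>l. l < 4 \<Longrightarrow> coord l z = bound bs l \<or> 2 / of_int T < \<bar>coord l z - bound bs l\<bar>"
  defines "B \<equiv> \<Prod>l<4. bden bs l"
  shows "\<exists>W0. \<forall>W\<ge>W0. \<exists>q::disc. cmod (gval (fst q) / of_int (T * W * B) - z) \<le> 2 / of_int (T * W * B) \<and>
     rootin cs (fst q) (T * W * B) (W * B) \<and>
     (disc_inside bs (fst q) (T * W * B) (W * B) \<or> disc_outside bs (fst q) (T * W * B) (W * B) \<or>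
      disc_on_line bs cs (T * W * B) (W * B) q)"
proof -
  have B: "B > 0" by (simp add: B_def prod_pos bden_pos)
  define r where "r = 1 / real_of_int T"
  have r: "r > 0" using T by (simp add: r_def)
  have small: "\<exists>W0>1. \<forall>W\<ge>W0. 2 / of_int (T * W * B) < \<delta>" if "\<delta> > 0" for \<delta> :: real
  proof -
    define W0 where "W0 = max 2 (\<lceil>2 / \<delta>\<rceil> + 1)"
    have "2 / of_int (T * W * B) < \<delta>" if "W \<ge> W0" for W
    proof -
      have W: "W \<ge> 2" "of_int W > 2 / \<delta>" using that unfolding W0_def by linarith+
      have "1 \<le> T * B" using T B by (metis int_one_le_iff_zero_less mult_pos_pos)
      then have "1 * W \<le> T * B * W" using W by (intro mult_right_mono) auto
      then have "W \<le> T * W * B" by (simp add: mult_ac)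
      then have "real_of_int W \<le> of_int (T * W * B)" by (simp only: of_int_le_iff)
      then have "of_int (T * W * B) > 2 / \<delta>" using W by linarith
      moreover have "real_of_int (T * W * B) > 0" using W T B by simp
      ultimately show ?thesis using \<open>\<delta> > 0\<close> by (simp only: field_simps)
    qed
    moreover have "W0 > 1" by (simp add: W0_def)
    ultimately show ?thesis by blast
  qed
  have DR: "T * W * B > 0 \<and> of_int (W * B) / real_of_int (T * W * B) = r" if "W > 1" for W
    using that T B by (simp add: r_def)
  obtain \<delta>1 where \<delta>1: "\<delta>1 > 0" "\<And>x D R. D > 0 \<Longrightarrow> of_int R / of_int D = r \<Longrightarrow>
      cmod (gval x / of_int D - z) < \<delta>1 \<Longrightarrow> rootin cs x D R"
    using rootin_near_root[OF cs z r] by blast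
  show ?thesis
  proof (cases "\<exists>l<4. coord l z = bound bs l")
    case True
    then obtain l where l: "l < 4" "coord l z = bound bs l" by blast
    define y where "y = (if l < 2 then Im z else Re z)"
    have zl: "z = line_complex l (of_int (bnum bs l) / of_int (bden bs l)) (of_real y)"
      using l(2) by (auto simp: line_complex_def coord_def y_def bound_def complex_eq_iff)
    obtain g h1 h2 e where g: "line_identity cs l (bnum bs l) (bden bs l) g h1 h2 e" "g \<noteq> []" "lead g \<noteq> 0"
      "poly (ipoly g) (of_real y) = 0"
      using exists_line_identity[OF cs bden_pos[of bs l]] z zl by metis
    obtain \<delta>2 where \<delta>2: "\<delta>2 > 0" "\<And>x D R. D > 0 \<Longrightarrow> of_int R / of_int D = r \<Longrightarrow>
        cmod (gval x / of_int D - of_real y) < \<delta>2 \<Longrightarrow> rootin g x D R"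
      using rootin_near_root[OF g(2-4) r] by blast
    obtain W0 where W0: "W0 > 1" "\<And>W. W \<ge> W0 \<Longrightarrow> 2 / of_int (T * W * B) < min \<delta>1 \<delta>2"
      using small[of "min \<delta>1 \<delta>2"] \<delta>1 \<delta>2 by auto
    have "bden bs l dvd B" unfolding B_def using l(1) by (intro dvd_prodI) auto
    then obtain B' where B': "B = bden bs l * B'" by (elim dvdE)
    show ?thesis
    proof (intro exI[of _ W0] allI impI)
      fix W assume W: "W0 \<le> W"
      define D where "D = T * W * B"
      have D: "D > 0" "of_int (W * B) / of_int D = r" using DR[of W] W0 W by (auto simp: D_def)
      define A where "A = bnum bs l * (T * W * B')"
      define Y where "Y = \<lfloor>of_int D * y\<rfloor>"
      define x where "x = (if l < 2 then (A, Y) else (Y, A))"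
      have A: "A * bden bs l = bnum bs l * D" by (simp add: A_def D_def B')
      then have "real_of_int A * of_int (bden bs l) = of_int (bnum bs l) * of_int D" by (metis of_int_mult)
      then have A': "of_int A / of_int D = coord l z"
        using D(1) bden_pos[of bs l] by (simp add: l(2) bound_def field_simps)
      have Y: "\<bar>of_int Y / of_int D - y\<bar> \<le> 1 / of_int D" unfolding Y_def by (rule floor_approx[OF D(1)])
      have "gval x / of_int D - z = (if l < 2 then \<i> else 1) * of_real (of_int Y / of_int D - y)"
        using A' D(1) by (auto simp: x_def gval_def complex_eq_iff coord_def y_def)
      then have "cmod (gval x / of_int D - z) = \<bar>of_int Y / of_int D - y\<bar>"
        by (simp add: norm_mult del: of_real_diff)
      then have c1: "cmod (gval x / of_int D - z) \<le> 1 / of_int D" using Y by simp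
      then have c2: "cmod (gval x / of_int D - z) \<le> 2 / of_int D" using D(1) by (simp add: field_simps)
      have lt: "2 / of_int D < min \<delta>1 \<delta>2" using W0(2)[OF W] by (simp add: D_def)
      then have R1: "rootin cs x D (W * B)" using \<delta>1(2)[OF D] c2 by simp
      have "gval (Y, 0) / of_int D - of_real y = of_real (of_int Y / of_int D - y)"
        using D(1) by (simp add: gval_def complex_eq_iff)
      then have "cmod (gval (Y, 0) / of_int D - of_real y) = \<bar>of_int Y / of_int D - y\<bar>"
        by (metis norm_of_real real_norm_def)
      moreover have "1 / real_of_int D \<le> 2 / of_int D" using D(1) by (simp add: field_simps)
      ultimately have R2: "rootin g (Y, 0) D (W * B)" using \<delta>2(2)[OF D] lt Y by simp
      define q :: disc where "q = (x, l, (g, h1, h2), e)"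
      have "across l x = A" "along l x = Y" by (auto simp: across_def along_def x_def)
      then have "disc_on_line bs cs D (W * B) q"
        using l(1) A R2 g(1) by (simp add: disc_on_line_def q_def)
      then show "\<exists>q::disc. cmod (gval (fst q) / of_int (T * W * B) - z) \<le> 2 / of_int (T * W * B) \<and>
         rootin cs (fst q) (T * W * B) (W * B) \<and>
         (disc_inside bs (fst q) (T * W * B) (W * B) \<or> disc_outside bs (fst q) (T * W * B) (W * B) \<or>
          disc_on_line bs cs (T * W * B) (W * B) q)"
        using c2 R1 unfolding D_def by (intro exI[of _ q]) (simp add: q_def)
    qed
  next
    case False
    obtain W0 where W0: "W0 > 1" "\<And>W. W \<ge> W0 \<Longrightarrow> 2 / of_int (T * W * B) < min \<delta>1 r"
      using small[of "min \<delta>1 r"] \<delta>1 r by auto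
    show ?thesis
    proof (intro exI[of _ W0] allI impI)
      fix W assume W: "W0 \<le> W"
      define D where "D = T * W * B"
      have D: "D > 0" "of_int (W * B) / of_int D = r" using DR[of W] W0 W by (auto simp: D_def)
      define x where "x = (\<lfloor>of_int D * Re z\<rfloor>, \<lfloor>of_int D * Im z\<rfloor>)"
      define a where "a = real_of_int (fst x) / of_int D"
      define b where "b = real_of_int (snd x) / of_int D"
      have ab: "\<bar>a - Re z\<bar> \<le> 1 / of_int D" "\<bar>b - Im z\<bar> \<le> 1 / of_int D"
        unfolding a_def b_def x_def fst_conv snd_conv by (rule floor_approx[OF D(1)])+
      have gx: "gval x / of_int D = Complex a b" using D(1) by (simp add: gval_def a_def b_def complex_eq_iff)
      then have c2: "cmod (gval x / of_int D - z) \<le> 2 / of_int D"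
        using cmod_le[of "Complex a b - z"] ab by simp
      have lt: "2 / of_int D < min \<delta>1 r" using W0(2)[OF W] by (simp add: D_def)
      then have R1: "rootin cs x D (W * B)" using \<delta>1(2)[OF D] c2 by simp
      have "1 / of_int D \<le> 2 / real_of_int D" using D(1) by (simp add: divide_right_mono)
      moreover have "2 / of_int D < r" using lt by simp
      ultimately have sh: "\<bar>a - Re z\<bar> < r" "\<bar>b - Im z\<bar> < r" using ab by linarith+
      have m: "coord l z + 2 * r < bound bs l \<or> bound bs l + 2 * r < coord l z" if "l < 4" for l
        using margin[OF that] False that by (auto simp: r_def)
      have div: "(of_int (fst x) + of_int (W * B)) / of_int D = a + r" "(of_int (fst x) - of_int (W * B)) / of_int D = a - r"
         "(of_int (snd x) + of_int (W * B)) / of_int D = b + r" "(of_int (snd x) - of_int (W * B)) / of_int D = b - r"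
        unfolding D(2)[symmetric] a_def b_def by (simp_all add: add_divide_distrib diff_divide_distrib)
      have "disc_inside bs x D (W * B) \<or> disc_outside bs x D (W * B)"
        unfolding disc_inside_iff[OF D(1)] disc_outside_iff[OF D(1)] div
        using m[of 0] m[of 1] m[of 2] m[of 3] sh by (auto simp: coord_def)
      then show "\<exists>q::disc. cmod (gval (fst q) / of_int (T * W * B) - z) \<le> 2 / of_int (T * W * B) \<and>
         rootin cs (fst q) (T * W * B) (W * B) \<and>
         (disc_inside bs (fst q) (T * W * B) (W * B) \<or> disc_outside bs (fst q) (T * W * B) (W * B) \<or>
          disc_on_line bs cs (T * W * B) (W * B) q)"
        using c2 R1 unfolding D_def by (intro exI[of _ "(x, undefined)"]) auto
    qed
  qed
qed

lemma exists_strips_to: "\<exists>c\<in>set cs. c \<noteq> 0 \<Longrightarrow> \<exists>cs0. strips_to cs cs0"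
proof (induction cs rule: rev_induct)
  case (snoc c cs)
  show ?case
  proof (cases "c = 0")
    case True
    then obtain cs0 where "strips_to cs cs0" using snoc by auto
    then have "strips_to (cs @ [c]) cs0"
      using True by (auto simp: strips_to_def get_nth nth_append less_Suc_eq)
    then show ?thesis ..
  next
    case False
    then have "strips_to (cs @ [c]) (cs @ [c])"
      by (simp add: strips_to_def lead_def get_nth)
    then show ?thesis ..
  qed
qed simp

lemma finite_pos_lower_bound:
  assumes "finite A" "\<And>a. a \<in> A \<Longrightarrow> (0::real) < a"
  shows "\<exists>\<epsilon>>0. \<forall>a\<in>A. \<epsilon> < a"
proof (cases "A = {}")
  case False
  then have "Min A > 0" using assms by simp
  moreover have "Min A / 2 < a" if "a \<in> A" for a
    using Min_le[OF assms(1) that] calculation by linarith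
  ultimately show ?thesis by (intro exI[of _ "Min A / 2"]) auto
qed (auto intro: exI[of _ 1])

theorem exists_valid_cert:
  assumes "\<exists>c\<in>set cs. c \<noteq> 0"
  shows "\<exists>w. valid_cert cs bs t w"
proof -
  obtain cs0 where st: "strips_to cs cs0" using exists_strips_to[OF assms] ..
  have c0: "cs0 \<noteq> []" "lead cs0 \<noteq> 0" using st by (auto simp: strips_to_def)
  define Z where "Z = {z. poly (ipoly cs0) z = 0}"
  have fin: "finite Z" unfolding Z_def by (rule poly_roots_finite[OF ipoly_nonzero[OF c0]])
  define A where "A = ((\<lambda>(l, z). \<bar>coord l z - bound bs l\<bar>) ` ({..<4} \<times> Z) \<union> (\<lambda>(z, z'). cmod (z - z')) ` (Z \<times> Z)) - {0}"
  have "\<exists>\<epsilon>>0. \<forall>a\<in>A. \<epsilon> < a"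
    using fin by (intro finite_pos_lower_bound) (auto simp: A_def)
  then obtain \<epsilon> where \<epsilon>: "\<epsilon> > 0" "\<And>a. a \<in> A \<Longrightarrow> \<epsilon> < a" by blast
  \<comment> \<open>Gives \<open>4 / T < \<epsilon>\<close>: centres deviate from their roots by at
    most \<open>1 / T\<close> each, so distinct roots still have centres more than two radii
    \<open>1 / T\<close> apart.\<close>
  define T where "T = max (int t + 1) (\<lceil>4 / \<epsilon>\<rceil> + 1)"
  have T: "T > 0" "int t + 1 \<le> T" and "of_int T > 4 / \<epsilon>"
    unfolding T_def by linarith+
  then have Teps: "4 / of_int T < \<epsilon>" using \<epsilon>(1) by (simp add: field_simps)
  have margin: "coord l z = bound bs l \<or> 2 / of_int T < \<bar>coord l z - bound bs l\<bar>" if "l < 4" "z \<in> Z" for l z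
  proof (cases "coord l z = bound bs l")
    case False
    then have "\<bar>coord l z - bound bs l\<bar> \<in> A" using that by (force simp: A_def)
    then have "\<epsilon> < \<bar>coord l z - bound bs l\<bar>" by (rule \<epsilon>(2))
    moreover have "2 / real_of_int T \<le> 4 / of_int T" using T by (simp add: divide_right_mono)
    ultimately show ?thesis using Teps by linarith
  qed simp
  have sep: "4 / of_int T < cmod (z - z')" if "z \<in> Z" "z' \<in> Z" "z \<noteq> z'" for z z'
  proof -
    have "cmod (z - z') \<in> A" using that by (force simp: A_def)
    then show ?thesis using \<epsilon>(2) Teps by fastforce
  qed
  define B where "B = (\<Prod>l<4. bden bs l)"
  have B: "B > 0" by (simp add: B_def prod_pos bden_pos)
  define good where "good W z q \<longleftrightarrow> cmod (gval (fst q) / of_int (T * W * B) - z) \<le> 2 / of_int (T * W * B) \<and>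
     rootin cs0 (fst q) (T * W * B) (W * B) \<and>
     (disc_inside bs (fst q) (T * W * B) (W * B) \<or> disc_outside bs (fst q) (T * W * B) (W * B) \<or>
      disc_on_line bs cs0 (T * W * B) (W * B) q)" for W z and q :: disc
  have "\<forall>z\<in>Z. \<exists>W0. \<forall>W\<ge>W0. \<exists>q. good W z q"
    unfolding good_def B_def using exists_root_disc[OF c0 _ T(1) margin] by (simp add: Z_def)
  then obtain W0 where W0: "\<And>z W. z \<in> Z \<Longrightarrow> W \<ge> W0 z \<Longrightarrow> \<exists>q. good W z q" by metis
  \<comment> \<open>The value 2 ensures \<open>2 / D \<le> 1 / T\<close>, the bound on the deviation
    of the centres.\<close>
  define W where "W = Max (insert 2 (W0 ` Z))"
  have W: "W \<ge> 2" "\<And>z. z \<in> Z \<Longrightarrow> W0 z \<le> W" using fin by (auto simp: W_def)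
  have "\<forall>z\<in>Z. \<exists>q. good W z q" using W W0 by blast
  then obtain q where q: "\<And>z. z \<in> Z \<Longrightarrow> good W z (q z)" using bchoice[of Z "good W"] by blast
  define D where "D = T * W * B"
  define R where "R = W * B"
  have D: "D > 0" "R \<ge> 0" "of_int R / of_int D = 1 / real_of_int T"
    using T(1) W(1) B by (auto simp: D_def R_def)
  obtain zs where zs: "set zs = Z" "distinct zs" using finite_distinct_list[OF fin] by blast
  define ds where "ds = map q zs"
  obtain u v where uv: "deriv_identity cs0 u v" "length v = Suc (card Z)"
    using exists_deriv_identity[OF c0] unfolding Z_def by blast
  have len: "length ds = card Z" using zs by (metis ds_def distinct_card length_map)
  have two: "2 / of_int D \<le> 1 / real_of_int T"
  proof -
    have "2 * 1 \<le> W * B" using W(1) B by (intro mult_mono) auto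
    then have "T * 2 \<le> D" unfolding D_def using T(1) by (simp add: mult.assoc)
    then have "real_of_int (T * 2) \<le> of_int D" by (simp only: of_int_le_iff)
    then show ?thesis using T(1) D(1) by (simp add: field_simps)
  qed
  have "valid_discs bs cs0 D R ds"
    unfolding valid_discs_def
  proof (intro conjI ballI allI impI)
    fix p assume "p \<in> set ds"
    then obtain z where "z \<in> Z" "p = q z" using zs by (auto simp: ds_def)
    then show "rootin cs0 (fst p) D R" "disc_inside bs (fst p) D R \<or> disc_outside bs (fst p) D R \<or> disc_on_line bs cs0 D R p"
      using q by (auto simp: good_def D_def R_def)
  next
    fix i j assume ij: "i < length ds" "j < i"
    then have z: "zs ! i \<in> Z" "zs ! j \<in> Z" "zs ! i \<noteq> zs ! j"
      using zs by (auto simp: ds_def nth_eq_iff_index_eq)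
    define ci where "ci = gval (fst (ds ! i)) / of_int D"
    define cj where "cj = gval (fst (ds ! j)) / of_int D"
    have "cmod (ci - zs ! i) \<le> 2 / of_int D" "cmod (cj - zs ! j) \<le> 2 / of_int D"
      using q[OF z(1)] q[OF z(2)] ij by (auto simp: good_def ci_def cj_def ds_def D_def)
    moreover have "cmod (zs ! i - zs ! j) \<le> cmod (ci - cj) + cmod (ci - zs ! i) + cmod (cj - zs ! j)"
      using norm_triangle_ineq4[of "ci - cj" "(ci - zs ! i) - (cj - zs ! j)"]
        norm_triangle_ineq4[of "ci - zs ! i" "cj - zs ! j"] by (simp add: algebra_simps)
    ultimately have far: "2 * (of_int R / of_int D) < cmod (ci - cj)"
      using sep[OF z] two unfolding D(3) by linarith
    define d where "d = (fst (fst (ds ! i)) - fst (fst (ds ! j)), snd (fst (ds ! i)) - snd (fst (ds ! j)))"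
    have "ci - cj = gval d / of_int D"
      using D(1) by (simp add: ci_def cj_def gval_def d_def complex_eq_iff diff_divide_distrib)
    then have "2 * of_int R < cmod (gval d)" using far D(1) by (simp add: norm_divide divide_less_cancel)
    then have "(2 * of_int R)\<^sup>2 < (cmod (gval d))\<^sup>2" using D(2) by (intro power_strict_mono) auto
    then have "real_of_int (4 * R * R) < of_int (gnorm2 d)"
      unfolding cmod_gval by (simp add: power2_eq_square)
    then have "4 * R * R < gnorm2 d" by (simp only: of_int_less_iff)
    then show "4 * R * R < gnorm2 (fst (fst (get ds i)) - fst (fst (get ds j)), snd (fst (get ds i)) - snd (fst (get ds j)))"
      using ij by (simp add: d_def get_nth)
  qed
  moreover have "R * int (Suc t) \<le> D"
  proof -
    have "R * int (Suc t) \<le> R * T" using T(2) D(2) by (intro mult_left_mono) auto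
    then show ?thesis by (simp add: D_def R_def mult_ac)
  qed
  ultimately have "valid_cert cs bs t ((cs0, u, v), (D, R), ds)"
    using st uv len D by (simp add: valid_cert_def)
  then show ?thesis ..
qed

section \<open>Computable approximations of algebraic numbers\<close>

text \<open>Split off before the search: the zero polynomial has no certificate, and with a wrong
  number of bounds a certificate could describe a value other than 0.\<close>

definition trivial_code :: "int list \<times> bnds \<Rightarrow> bool" where
  "trivial_code k \<longleftrightarrow> (\<forall>c\<in>set (fst k). c = 0) \<or> length (snd k) \<noteq> 4"

text \<open>The disjunct \<open>trivial_code\<close> inside the search makes it succeed on every
  input, as \<open>computable_Least\<close> demands.\<close>

definition approx :: "(int list \<times> bnds) \<times> nat \<Rightarrow> (int \<times> int) \<times> int" where
  "approx p = (if trivial_code (fst p) then ((0, 0), 1)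
     else cert_value (snd (fst p))
       (dec (LEAST n. trivial_code (fst p) \<or> valid_cert (fst (fst p)) (snd (fst p)) (snd p) (dec n))))"

lemma computable_approx [comp_intros]: "computable f \<Longrightarrow> computable (\<lambda>x. approx (f x))"
proof -
  have tr: "computable trivial_code"
    unfolding trivial_code_def by (intro comp_intros)
  have ex: "\<exists>n. trivial_code (fst p) \<or> valid_cert (fst (fst p)) (snd (fst p)) (snd p) (dec n)" for p
    using exists_valid_cert[of "fst (fst p)" "snd (fst p)" "snd p"]
    by (metis dec_enc trivial_code_def)
  have "computable approx"
    unfolding approx_def by (intro comp_intros computable_comp[OF tr] ex)
  then show "computable f \<Longrightarrow> ?thesis" by (rule computable_comp)
qed

theorem approx_alg_decode:
  assumes "approx (dec k, t) = (x, D)"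
  shows "D > 0" "cmod (alg_decode k - gval x / of_int D) \<le> 1 / of_nat (Suc t)"
proof -
  obtain cs bs where k: "dec k = (cs :: int list, bs :: bnds)" by (metis prod.exhaust)
  have k': "alg_decode k = (if (\<exists>c\<in>set cs. c \<noteq> 0) \<and> length bs = 4 then rect_root cs bs else 0)"
    using alg_decode_enc[of cs bs] by (metis enc_dec k)
  have "D > 0 \<and> cmod (alg_decode k - gval x / of_int D) \<le> 1 / of_nat (Suc t)"
  proof (cases "trivial_code (cs, bs)")
    case True
    then have "alg_decode k = 0" "x = (0, 0)" "D = 1"
      using assms k' by (auto simp: trivial_code_def approx_def k)
    then show ?thesis by (simp add: gval_def Complex_eq)
  next
    case False
    define w where "w = (dec (LEAST n. valid_cert cs bs t (dec n)) :: cert)"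
    have "\<exists>c\<in>set cs. c \<noteq> 0" using False by (auto simp: trivial_code_def)
    then obtain w0 where "valid_cert cs bs t w0" using exists_valid_cert by blast
    then have "valid_cert cs bs t (dec (enc w0))" by simp
    then have "valid_cert cs bs t w" unfolding w_def by (rule LeastI)
    moreover have "cert_value bs w = (x, D)"
      using assms False by (simp add: approx_def k w_def)
    ultimately show ?thesis
      using valid_cert_approx[of cs bs t w x D] False by (auto simp: k' trivial_code_def)
  qed
  then show "D > 0" "cmod (alg_decode k - gval x / of_int D) \<le> 1 / of_nat (Suc t)" by auto
qed

text \<open>\<open>near k z E t\<close> separates \<open>|alg_decode k - z / E| < 1 / (t + 1)\<close> from
  \<open>|alg_decode k - z / E| \<ge> 2 / (t + 1)\<close>; in between the answer depends on the approximation.\<close>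

definition near :: "nat \<Rightarrow> int \<times> int \<Rightarrow> int \<Rightarrow> nat \<Rightarrow> bool" where
  "near k z E t \<longleftrightarrow>
     4 * int (Suc t) * int (Suc t) *
       gnorm2 (fst (fst (approx (dec k, 4 * t + 3))) * E - fst z * snd (approx (dec k, 4 * t + 3)),
               snd (fst (approx (dec k, 4 * t + 3))) * E - snd z * snd (approx (dec k, 4 * t + 3)))
     \<le> 9 * snd (approx (dec k, 4 * t + 3)) * snd (approx (dec k, 4 * t + 3)) * E * E"

lemma computable_near [comp_intros]:
  assumes "computable f" "computable g" "computable h" "computable k"
  shows "computable (\<lambda>x. near (f x) (g x) (h x) (k x))"
  unfolding near_def by (intro comp_intros assms)

lemma near_iff:
  assumes "E > 0" "approx (dec k, 4 * t + 3) = (x, D)"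
  shows "near k z E t \<longleftrightarrow> cmod (gval x / of_int D - gval z / of_int E) \<le> 3 / 2 / of_nat (Suc t)"
proof -
  have D: "D > 0" using approx_alg_decode(1)[OF assms(2)] .
  define s where "s = int (Suc t)"
  define w where "w = (fst x * E - fst z * D, snd x * E - snd z * D)"
  have "gval x / of_int D - gval z / of_int E = gval w / of_int (D * E)"
    using D assms(1) by (simp add: gval_def w_def complex_eq_iff field_simps)
  then have "cmod (gval x / of_int D - gval z / of_int E) = cmod (gval w) / of_int (D * E)"
    using D assms(1) by (simp add: norm_divide norm_mult)
  moreover have "v / M \<le> 3 / 2 / of_nat (Suc t) \<longleftrightarrow> 2 * of_int s * v \<le> 3 * M" if "M > 0" for v M :: real
    using that by (simp add: s_def field_simps)
  moreover have "real_of_int (D * E) > 0" using D assms(1) by simp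
  ultimately have "cmod (gval x / of_int D - gval z / of_int E) \<le> 3 / 2 / of_nat (Suc t) \<longleftrightarrow>
      2 * of_int s * cmod (gval w) \<le> 3 * of_int (D * E)"
    by metis
  also have "\<dots> \<longleftrightarrow> (2 * of_int s * cmod (gval w))\<^sup>2 \<le> (3 * of_int (D * E))\<^sup>2"
    using D assms(1) by (intro power_mono_iff[symmetric]) (auto simp: s_def)
  also have "\<dots> \<longleftrightarrow> real_of_int (4 * s * s * gnorm2 w) \<le> of_int (9 * D * D * E * E)"
    unfolding power_mult_distrib cmod_gval by (simp add: power2_eq_square mult_ac)
  also have "\<dots> \<longleftrightarrow> near k z E t"
    unfolding of_int_le_iff near_def by (simp add: assms(2) s_def w_def)
  finally show ?thesis ..
qed

text \<open>\<open>Suc (4 * t + 3)\<close> is \<open>4 * Suc t\<close>, so the approximation errs by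
  at most a quarter of \<open>h = 1 / Suc t\<close>. The test compares with
  \<open>3 / 2 * h\<close>, and \<open>1 + 1/4 < 3/2\<close> and \<open>3/2 + 1/4 < 2\<close> leave
  room on both sides.\<close>

theorem near_imp: "E > 0 \<Longrightarrow> near k z E t \<Longrightarrow> cmod (alg_decode k - gval z / of_int E) < 2 / of_nat (Suc t)"
  and imp_near: "E > 0 \<Longrightarrow> cmod (alg_decode k - gval z / of_int E) < 1 / of_nat (Suc t) \<Longrightarrow> near k z E t"
proof -
  obtain x D where xD: "approx (dec k, 4 * t + 3) = (x, D)" by (metis prod.exhaust)
  define c where "c = gval x / of_int D"
  define y where "y = gval z / of_int E"
  define h where "h = 1 / real (Suc t)"
  have "cmod (alg_decode k - c) \<le> 1 / of_nat (Suc (4 * t + 3))"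
    unfolding c_def by (rule approx_alg_decode(2)[OF xD])
  also have "\<dots> = h / 4" by (simp add: h_def field_simps)
  finally have c: "cmod (alg_decode k - c) \<le> h / 4" .
  have h: "h > 0" "3 / 2 / of_nat (Suc t) = 3 / 2 * h" "2 / of_nat (Suc t) = 2 * h"
    by (simp_all add: h_def)
  have t1: "cmod (alg_decode k - y) \<le> cmod (alg_decode k - c) + cmod (c - y)"
    using norm_triangle_ineq[of "alg_decode k - c" "c - y"] by simp
  have t2: "cmod (c - y) \<le> cmod (alg_decode k - c) + cmod (alg_decode k - y)"
    using norm_triangle_ineq4[of "alg_decode k - y" "alg_decode k - c"] by simp
  show "cmod (alg_decode k - gval z / of_int E) < 2 / of_nat (Suc t)" if "E > 0" "near k z E t"
    using near_iff[OF that(1) xD, of z] that(2) t1 c h unfolding c_def[symmetric] y_def[symmetric] by simp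
  show "near k z E t" if "E > 0" "cmod (alg_decode k - gval z / of_int E) < 1 / of_nat (Suc t)"
    using near_iff[OF that(1) xD, of z] that(2) t2 c h
    unfolding c_def[symmetric] y_def[symmetric] h_def[symmetric] by simp
qed

section \<open>Codes of the numbers used by the tests and machines\<close>

text \<open>A positive coordinate gets the interval \<open>(0, M)\<close>, a negative one
  \<open>(-M, 0)\<close> and a vanishing one \<open>(-M, M)\<close>, since the rectangle is
  open.\<close>

definition box_lo :: "int \<Rightarrow> int \<Rightarrow> int" where "box_lo M a = (if a > 0 then 0 else - M)"
definition box_hi :: "int \<Rightarrow> int \<Rightarrow> int" where "box_hi M a = (if a < 0 then 0 else M)"

text \<open>The code of \<open>w = z / sqrt N\<close>: the polynomial \<open>(N x^2 - z^2) (N x^2 - (cnj z)^2)\<close> has the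
  roots \<open>w, - w, cnj w, - cnj w\<close>, and the signs of the coordinates single out \<open>w\<close>.\<close>

definition alg_code :: "int \<times> int \<Rightarrow> int \<Rightarrow> nat" where
  "alg_code z N = enc (
     [gnorm2 z * gnorm2 z, 0, - (2 * N * (fst z * fst z - snd z * snd z)), 0, N * N],
     [(box_lo (\<bar>fst z\<bar> + \<bar>snd z\<bar> + 1) (fst z), 0::nat), (box_hi (\<bar>fst z\<bar> + \<bar>snd z\<bar> + 1) (fst z), 0),
      (box_lo (\<bar>fst z\<bar> + \<bar>snd z\<bar> + 1) (snd z), 0), (box_hi (\<bar>fst z\<bar> + \<bar>snd z\<bar> + 1) (snd z), 0)])"

lemma computable_alg_code [comp_intros]:
  assumes "computable f" "computable g"
  shows "computable (\<lambda>x. alg_code (f x) (g x))"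
  unfolding alg_code_def box_lo_def box_hi_def by (intro comp_intros assms)

text \<open>The box is large enough because \<open>N \<ge> 1\<close> makes the coordinates of
  \<open>w\<close> no larger than those of \<open>z\<close>. A root with a reversed sign in some
  coordinate fits into the box only if that coordinate is 0, and then the reversal changes
  nothing.\<close>

lemma alg_decode_alg_code:
  assumes "N > 0"
  shows "alg_decode (alg_code z N) = gval z / of_real (sqrt (of_int N))"
proof -
  obtain a b where z: "z = (a, b)" by (cases z)
  define g where "g = gval z"
  define s where "s = sqrt (real_of_int N)"
  have s2: "s * s = of_int N" and s1: "s \<ge> 1" using assms by (simp_all add: s_def)
  define M where "M = \<bar>a\<bar> + \<bar>b\<bar> + 1"
  define cs where "cs = [gnorm2 z * gnorm2 z, 0, - (2 * N * (fst z * fst z - snd z * snd z)), 0, N * N]"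
  define bs :: bnds where "bs = [(box_lo M a, 0), (box_hi M a, 0), (box_lo M b, 0), (box_hi M b, 0)]"
  have N2: "complex_of_int N = of_real s * of_real s" using s2 by (simp flip: of_real_mult)
  have gg: "g * g + cnj g * cnj g = of_int (2 * (a * a - b * b))" "g * cnj g = of_int (gnorm2 z)"
    by (simp_all add: g_def gval_def z complex_eq_iff gnorm2_def)
  have factor: "poly (ipoly cs) x = ((of_real s * x) * (of_real s * x) - g * g) * ((of_real s * x) * (of_real s * x) - cnj g * cnj g)" for x
  proof -
    have "poly (ipoly cs) x = (g * cnj g) * (g * cnj g) - complex_of_int N * (g * g + cnj g * cnj g) * (x * x)
        + of_int N * of_int N * (x * x * x * x)"
      unfolding gg by (simp add: cs_def z algebra_simps)
    also have "\<dots> = ((of_real s * x) * (of_real s * x) - g * g) * ((of_real s * x) * (of_real s * x) - cnj g * cnj g)"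
      unfolding N2 by (simp add: algebra_simps)
    finally show ?thesis .
  qed
  have roots: "poly (ipoly cs) x = 0 \<longleftrightarrow> of_real s * x = g \<or> of_real s * x = - g \<or> of_real s * x = cnj g \<or> of_real s * x = - cnj g" for x
    unfolding factor by (auto simp: square_eq_iff)
  have b: "bound bs 0 = of_int (box_lo M a)" "bound bs 1 = of_int (box_hi M a)"
     "bound bs 2 = of_int (box_lo M b)" "bound bs 3 = of_int (box_hi M b)"
    by (simp_all add: bound_def bnum_def bden_def bs_def get_nth)
  define w where "w = g / of_real s"
  have w: "of_real s * w = g" using s1 by (simp add: w_def)
  have "in_rect bs w"
  proof -
    have "Re w = of_int a / s" "Im w = of_int b / s" by (simp_all add: w_def g_def gval_def z)
    moreover have "\<bar>of_int c / s\<bar> \<le> \<bar>of_int c\<bar>" for c using s1 by (simp add: divide_le_eq mult_le_cancel_left1)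
    ultimately have le: "\<bar>Re w\<bar> \<le> of_int \<bar>a\<bar>" "\<bar>Im w\<bar> \<le> of_int \<bar>b\<bar>" and sg: "Re w > 0 \<longleftrightarrow> a > 0" "Re w < 0 \<longleftrightarrow> a < 0"
      "Im w > 0 \<longleftrightarrow> b > 0" "Im w < 0 \<longleftrightarrow> b < 0"
      using s1 by (simp_all add: zero_less_divide_iff divide_less_0_iff)
    then have lt: "\<bar>Re w\<bar> < of_int M" "\<bar>Im w\<bar> < of_int M" unfolding M_def by linarith+
    show ?thesis unfolding in_rect_def b box_lo_def box_hi_def using lt sg by (auto simp: abs_less_iff)
  qed
  moreover have "x = w" if "poly (ipoly cs) x = 0" "in_rect bs x" for x
  proof -
    have a: "a > 0 \<Longrightarrow> Re x > 0" "a < 0 \<Longrightarrow> Re x < 0" "b > 0 \<Longrightarrow> Im x > 0" "b < 0 \<Longrightarrow> Im x < 0"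
      using that(2) unfolding in_rect_def b box_lo_def box_hi_def by (auto split: if_splits)
    have sgn: "s * Re x = of_int (- a) \<Longrightarrow> a = 0" "s * Im x = of_int (- b) \<Longrightarrow> b = 0"
      using a s1 mult_pos_pos[of s "Re x"] mult_pos_neg[of s "Re x"] mult_pos_pos[of s "Im x"] mult_pos_neg[of s "Im x"]
      by (smt (verit) of_int_0_less_iff of_int_less_0_iff)+
    have "of_real s * x = g"
      using roots[THEN iffD1, OF that(1)] sgn by (auto simp: complex_eq_iff g_def gval_def z)
    then show ?thesis using s1 by (auto simp: w_def field_simps)
  qed
  moreover have "poly (ipoly cs) w = 0" using roots w by blast
  ultimately have "{x. poly (ipoly cs) x = 0 \<and> in_rect bs x} = {w}" by blast
  then have "rect_root cs bs = w" by (simp add: rect_root_def)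
  moreover have "alg_code z N = enc (cs, bs)" by (simp add: alg_code_def cs_def bs_def M_def z)
  ultimately have "alg_decode (alg_code z N) = w"
    using alg_decode_enc[of cs bs] assms by (simp add: cs_def bs_def)
  then show ?thesis by (simp add: w_def g_def s_def)
qed

lemma algebraic_alg_decode: "algebraic (alg_decode k)"
proof -
  obtain cs bs where k: "dec k = (cs :: int list, bs :: bnds)" by (metis prod.exhaust)
  have k': "alg_decode k = (if (\<exists>c\<in>set cs. c \<noteq> 0) \<and> length bs = 4 then rect_root cs bs else 0)"
    using alg_decode_enc[of cs bs] by (metis enc_dec k)
  show ?thesis
  proof (cases "alg_decode k = 0")
    case True
    have "poly [:0, 1:] (alg_decode k) = 0" "[:0, 1 :: complex:] \<noteq> 0" using True by auto
    then show ?thesis by (intro algebraicI[of "[:0, 1:]"]) (auto simp: coeff_pCons split: nat.splits)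
  next
    case False
    then have nz: "\<exists>c\<in>set cs. c \<noteq> 0" "length bs = 4" and rr: "alg_decode k = rect_root cs bs"
      using k' by (auto split: if_splits)
    have "card {z. poly (ipoly cs) z = 0 \<and> in_rect bs z} = 1"
      using False rr by (auto simp: rect_root_def split: if_splits)
    then obtain w where w: "{z. poly (ipoly cs) z = 0 \<and> in_rect bs z} = {w}" by (rule card_1_singletonE)
    then have "alg_decode k = w" by (simp add: rr rect_root_def)
    moreover have "poly (ipoly cs) w = 0" using w by auto
    ultimately show ?thesis
      using nz by (intro algebraicI[of "ipoly cs"]) (auto simp: coeff_Poly_eq nth_default_def ipoly_eq_0_iff)
  qed
qed

section \<open>Orthonormal systems and projections\<close>

definition ip :: "nat \<Rightarrow> (nat \<Rightarrow> complex) \<Rightarrow> (nat \<Rightarrow> complex) \<Rightarrow> complex" where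
  "ip d v w = (\<Sum>j<d. cnj (v j) * w j)"

definition orthonormal :: "nat \<Rightarrow> nat \<Rightarrow> (nat \<Rightarrow> nat \<Rightarrow> complex) \<Rightarrow> bool" where
  "orthonormal d r e \<longleftrightarrow> (\<forall>i<r. \<forall>k<r. ip d (e i) (e k) = (if i = k then 1 else 0))"

definition pmat :: "nat \<Rightarrow> (nat \<Rightarrow> nat \<Rightarrow> complex) \<Rightarrow> cmat" where
  "pmat r e i j = (\<Sum>k<r. e k i * cnj (e k j))"

lemma ip_self: "ip d v v = of_real (\<Sum>j<d. (cmod (v j))\<^sup>2)"
  by (simp only: ip_def of_real_sum complex_norm_square mult.commute)

lemma sum_rotate: "(\<Sum>i\<in>A. \<Sum>j\<in>B. \<Sum>k\<in>C. f i j k) = (\<Sum>k\<in>C. \<Sum>i\<in>A. \<Sum>j\<in>B. f i j k)"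
proof -
  have "(\<Sum>i\<in>A. \<Sum>j\<in>B. \<Sum>k\<in>C. f i j k) = (\<Sum>i\<in>A. \<Sum>k\<in>C. \<Sum>j\<in>B. f i j k)"
    by (intro sum.cong refl sum.swap)
  also have "\<dots> = (\<Sum>k\<in>C. \<Sum>i\<in>A. \<Sum>j\<in>B. f i j k)" by (rule sum.swap)
  finally show ?thesis .
qed

lemma ip_self_eq_0: "ip d v v = 0 \<Longrightarrow> j < d \<Longrightarrow> v j = 0"
proof -
  assume "ip d v v = 0" "j < d"
  then have "(\<Sum>j<d. (cmod (v j))\<^sup>2) = 0" unfolding ip_self by (simp only: of_real_eq_0_iff)
  then show "v j = 0" using \<open>j < d\<close> by (subst (asm) sum_nonneg_eq_0_iff) auto
qed

lemma ip_commute: "ip d v w = cnj (ip d w v)"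
  by (simp add: ip_def mult.commute)

lemma hermitian_pmat: "hermitian d (pmat r e)"
  by (simp add: hermitian_def pmat_def mult.commute)

lemma pmat_idem:
  assumes "orthonormal d r e"
  shows "mmult d (pmat r e) (pmat r e) i j = pmat r e i j"
proof -
  have "mmult d (pmat r e) (pmat r e) i j = (\<Sum>m<d. \<Sum>k<r. \<Sum>l<r. e k i * cnj (e k m) * (e l m * cnj (e l j)))"
    by (simp add: mmult_def pmat_def sum_product)
  also have "\<dots> = (\<Sum>k<r. \<Sum>l<r. \<Sum>m<d. e k i * cnj (e k m) * (e l m * cnj (e l j)))"
    by (rule sum_rotate[symmetric])
  also have "\<dots> = (\<Sum>k<r. \<Sum>l<r. e k i * cnj (e l j) * ip d (e k) (e l))"
    by (simp add: ip_def sum_distrib_left mult_ac)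
  also have "\<dots> = (\<Sum>k<r. \<Sum>l<r. if k = l then e k i * cnj (e l j) else 0)"
    using assms by (intro sum.cong refl) (auto simp: orthonormal_def)
  finally show ?thesis by (simp add: pmat_def)
qed

lemma mtrace_pmat:
  assumes "orthonormal d r e"
  shows "mtrace d (pmat r e) = of_nat r"
proof -
  have "mtrace d (pmat r e) = (\<Sum>k<r. ip d (e k) (e k))"
    unfolding mtrace_def pmat_def ip_def by (subst sum.swap) (simp add: mult.commute)
  also have "\<dots> = (\<Sum>k<r. 1)" using assms by (intro sum.cong) (auto simp: orthonormal_def)
  finally show ?thesis by simp
qed

lemma mtrace_mmult_pmat: "mtrace d (mmult d A (pmat r e)) = (\<Sum>k<r. qform d A (e k))"
proof -
  have "mtrace d (mmult d A (pmat r e)) = (\<Sum>i<d. \<Sum>j<d. \<Sum>k<r. A i j * (e k j * cnj (e k i)))"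
    by (simp add: mtrace_def mmult_def pmat_def sum_distrib_left)
  also have "\<dots> = (\<Sum>k<r. \<Sum>i<d. \<Sum>j<d. A i j * (e k j * cnj (e k i)))"
    by (rule sum_rotate)
  finally show ?thesis by (simp add: qform_def mult_ac)
qed

text \<open>Induction on a bound for the trace. A nonzero column of \<open>S\<close>, normalised to
  \<open>e\<close>, is a unit vector fixed by \<open>S\<close>; subtracting the projection onto
  \<open>e\<close> leaves a Hermitian idempotent whose trace is smaller by one.\<close>

lemma projection_decomposition:
  assumes "hermitian d S" "\<And>i j. i < d \<Longrightarrow> j < d \<Longrightarrow> mmult d S S i j = S i j"
  shows "\<exists>r e. orthonormal d r e \<and> (\<forall>i<d. \<forall>j<d. S i j = pmat r e i j)"
proof -
  have "\<exists>r e. orthonormal d r e \<and> (\<forall>i<d. \<forall>j<d. S i j = pmat r e i j)"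
    if "hermitian d S" "\<And>i j. i < d \<Longrightarrow> j < d \<Longrightarrow> mmult d S S i j = S i j" "Re (mtrace d S) < real n" for S n
    using that
  proof (induction n arbitrary: S)
    \<comment> \<open>Hermitian and idempotent together make a diagonal entry the squared norm of
      its column, so the trace is nonnegative and the base case is vacuous.\<close>
    have diag: "S j j = ip d (\<lambda>i. S i j) (\<lambda>i. S i j)"
      if "hermitian d S" "\<And>i j. i < d \<Longrightarrow> j < d \<Longrightarrow> mmult d S S i j = S i j" "j < d" for S j
      using that(2)[OF that(3,3)] that(1,3) unfolding mmult_def ip_def hermitian_def
      by (metis (no_types, lifting) lessThan_iff sum.cong)
    case 0
    have "Re (mtrace d S) = (\<Sum>j<d. Re (S j j))" by (simp add: mtrace_def)
    also have "\<dots> \<ge> 0"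
      using diag[OF 0(1,2)] by (intro sum_nonneg) (simp add: ip_self sum_nonneg)
    finally show ?case using 0(3) by simp
  next
    have diag: "S j j = ip d (\<lambda>i. S i j) (\<lambda>i. S i j)"
      if "hermitian d S" "\<And>i j. i < d \<Longrightarrow> j < d \<Longrightarrow> mmult d S S i j = S i j" "j < d" for S j
      using that(2)[OF that(3,3)] that(1,3) unfolding mmult_def ip_def hermitian_def
      by (metis (no_types, lifting) lessThan_iff sum.cong)
    case (Suc n)
    show ?case
    proof (cases "\<forall>i<d. \<forall>j<d. S i j = 0")
      case True
      then have "orthonormal d 0 e \<and> (\<forall>i<d. \<forall>j<d. S i j = pmat 0 e i j)" for e
        by (simp add: orthonormal_def pmat_def)
      then show ?thesis by blast
    next
      case False
      then obtain m j where mj: "m < d" "j < d" "S m j \<noteq> 0" by blast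
      define N where "N = (\<Sum>i<d. (cmod (S i j))\<^sup>2)"
      have N: "ip d (\<lambda>i. S i j) (\<lambda>i. S i j) = of_real N" by (simp add: ip_self N_def)
      have N0: "N > 0"
      proof -
        have "0 < (cmod (S m j))\<^sup>2" using mj by simp
        also have "\<dots> \<le> N" unfolding N_def using mj(1) by (intro member_le_sum) auto
        finally show ?thesis .
      qed
      define e where "e i = S i j / of_real (sqrt N)" for i
      have ee: "ip d e e = 1"
      proof -
        have "ip d e e = ip d (\<lambda>i. S i j) (\<lambda>i. S i j) / (of_real (sqrt N) * of_real (sqrt N))"
          by (simp add: ip_def e_def sum_divide_distrib)
        then show ?thesis using N N0 by (simp flip: of_real_mult)
      qed
      have Se: "(\<Sum>k<d. S i k * e k) = e i" if "i < d" for i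
        using Suc.prems(2)[OF that mj(2)] by (simp add: e_def mmult_def sum_divide_distrib[symmetric])
      have eS: "(\<Sum>k<d. cnj (e k) * S k i) = cnj (e i)" if "i < d" for i
      proof -
        have "(\<Sum>k<d. cnj (e k) * S k i) = (\<Sum>k<d. cnj (S i k * e k))"
        proof (rule sum.cong[OF refl])
          fix k assume "k \<in> {..<d}"
          then have H: "S k i = cnj (S i k)" using Suc.prems(1) that unfolding hermitian_def by blast
          show "cnj (e k) * S k i = cnj (S i k * e k)" by (simp add: H)
        qed
        then show ?thesis by (simp only: cnj_sum[symmetric] Se[OF that])
      qed
      define S' where "S' i k = S i k - e i * cnj (e k)" for i k
      have S'e: "(\<Sum>k<d. S' i k * e k) = 0" if "i < d" for i
      proof -
        have "(\<Sum>k<d. S' i k * e k) = (\<Sum>k<d. S i k * e k) - e i * ip d e e"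
          by (simp add: S'_def ip_def left_diff_distrib sum_subtractf sum_distrib_left mult.assoc)
        then show ?thesis using Se[OF that] ee by simp
      qed
      have "\<exists>r f. orthonormal d r f \<and> (\<forall>i<d. \<forall>k<d. S' i k = pmat r f i k)"
      proof (rule Suc.IH)
        show "hermitian d S'"
          unfolding hermitian_def
        proof (intro allI impI)
          fix i k assume "i < d" "k < d"
          then have H: "S k i = cnj (S i k)" using Suc.prems(1) unfolding hermitian_def by blast
          show "S' k i = cnj (S' i k)" by (simp add: S'_def H)
        qed
        fix i k assume ik: "i < d" "k < d"
        have "mmult d S' S' i k = (\<Sum>l<d. S' i l * S l k) - (\<Sum>l<d. S' i l * e l) * cnj (e k)"
          by (simp add: mmult_def S'_def[of _ k] right_diff_distrib sum_subtractf sum_distrib_right mult.assoc)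
        also have "(\<Sum>l<d. S' i l * e l) = 0" by (rule S'e[OF ik(1)])
        also have "(\<Sum>l<d. S' i l * S l k) = mmult d S S i k - e i * (\<Sum>l<d. cnj (e l) * S l k)"
          by (simp add: mmult_def S'_def left_diff_distrib sum_subtractf sum_distrib_left mult.assoc)
        also have "\<dots> = S' i k" using eS[OF ik(2)] Suc.prems(2)[OF ik] by (simp add: S'_def)
        finally show "mmult d S' S' i k = S' i k" by simp
      next
        have "mtrace d S' = mtrace d S - ip d e e"
          by (simp add: mtrace_def S'_def ip_def sum_subtractf mult.commute)
        then show "Re (mtrace d S') < real n" using Suc.prems(3) ee by simp
      qed
      then obtain r f where f: "orthonormal d r f" "\<And>i k. i < d \<Longrightarrow> k < d \<Longrightarrow> S' i k = pmat r f i k" by blast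
      \<comment> \<open>\<open>S'\<close> annihilates \<open>e\<close>, hence the quadratic form of
        \<open>S'\<close> at \<open>e\<close>, which is the sum of the \<open>|<f k, e>|^2\<close>,
        vanishes; so \<open>e\<close> is orthogonal to all \<open>f k\<close>.\<close>
      have fe: "ip d (f k) e = 0" if "k < r" for k
      proof -
        have "0 = (\<Sum>i<d. cnj (e i) * (\<Sum>k<d. S' i k * e k))" using S'e by simp
        also have "\<dots> = (\<Sum>i<d. \<Sum>l<d. \<Sum>k<r. (cnj (e i) * f k i) * (cnj (f k l) * e l))"
          using f(2) by (intro sum.cong refl) (simp add: pmat_def sum_distrib_left sum_distrib_right mult_ac)
        also have "\<dots> = (\<Sum>k<r. \<Sum>i<d. \<Sum>l<d. (cnj (e i) * f k i) * (cnj (f k l) * e l))"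
          by (rule sum_rotate)
        also have "\<dots> = (\<Sum>k<r. ip d e (f k) * ip d (f k) e)"
          by (simp add: ip_def sum_product)
        also have "\<dots> = (\<Sum>k<r. of_real ((cmod (ip d (f k) e))\<^sup>2))"
          by (intro sum.cong refl) (simp only: ip_commute[of d e] complex_norm_square mult.commute)
        finally have "(\<Sum>k<r. (cmod (ip d (f k) e))\<^sup>2) = 0"
          by (metis of_real_eq_0_iff of_real_sum)
        then show ?thesis using that by (subst (asm) sum_nonneg_eq_0_iff) auto
      qed
      define h where "h k = (if k = r then e else f k)" for k
      have "ip d e (f k) = 0" if "k < r" for k using fe[OF that] ip_commute[of d e "f k"] by simp
      then have "orthonormal d (Suc r) h"
        using f(1) fe ee by (auto simp: orthonormal_def h_def less_Suc_eq)
      moreover have "S i k = pmat (Suc r) h i k" if "i < d" "k < d" for i k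
      proof -
        have "pmat (Suc r) h i k = pmat r f i k + e i * cnj (e k)"
          by (simp add: pmat_def h_def)
        then show ?thesis using f(2)[OF that] by (simp add: S'_def diff_eq_eq)
      qed
      ultimately show ?thesis by blast
    qed
  qed
  moreover obtain n :: nat where "Re (mtrace d S) < real n" using reals_Archimedean2 by blast
  ultimately show ?thesis using assms by blast
qed

section \<open>Orthogonal Gaussian integer vectors\<close>

definition gauss_rat :: "complex \<Rightarrow> bool" where
  "gauss_rat x \<longleftrightarrow> Re x \<in> \<rat> \<and> Im x \<in> \<rat>"

lemma gauss_rat_diff: "gauss_rat x \<Longrightarrow> gauss_rat y \<Longrightarrow> gauss_rat (x - y)"
  by (simp add: gauss_rat_def)

lemma gauss_rat_mult: "gauss_rat x \<Longrightarrow> gauss_rat y \<Longrightarrow> gauss_rat (x * y)"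
  by (simp add: gauss_rat_def)

lemma gauss_rat_divide: "gauss_rat x \<Longrightarrow> gauss_rat y \<Longrightarrow> gauss_rat (x / y)"
  by (simp add: gauss_rat_def Re_divide Im_divide)

lemma gauss_rat_cnj: "gauss_rat x \<Longrightarrow> gauss_rat (cnj x)"
  by (simp add: gauss_rat_def)

lemma gauss_rat_sum: "(\<And>i. i \<in> A \<Longrightarrow> gauss_rat (f i)) \<Longrightarrow> gauss_rat (sum f A)"
  by (induction A rule: infinite_finite_induct) (auto simp: gauss_rat_def)

lemma gauss_rat_ip: "(\<And>j. gauss_rat (v j)) \<Longrightarrow> (\<And>j. gauss_rat (w j)) \<Longrightarrow> gauss_rat (ip d v w)"
  unfolding ip_def by (intro gauss_rat_sum gauss_rat_mult gauss_rat_cnj)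

definition round_seq :: "complex \<Rightarrow> nat \<Rightarrow> complex" where
  "round_seq x t = Complex (of_int \<lfloor>of_int (int (Suc t)) * Re x\<rfloor> / of_int (int (Suc t)))
     (of_int \<lfloor>of_int (int (Suc t)) * Im x\<rfloor> / of_int (int (Suc t)))"

lemma gauss_rat_round_seq: "gauss_rat (round_seq x t)"
  by (simp add: gauss_rat_def round_seq_def)

lemma round_seq_tendsto: "round_seq x \<longlonglongrightarrow> x"
proof -
  have lim: "(\<lambda>t. of_int \<lfloor>of_int (int (Suc t)) * y\<rfloor> / of_int (int (Suc t))) \<longlonglongrightarrow> y" for y :: real
  proof (rule LIMSEQ_I)
    fix e :: real assume "e > 0"
    then obtain n where n: "inverse (real (Suc n)) < e" using reals_Archimedean by blast
    have "norm (of_int \<lfloor>of_int (int (Suc t)) * y\<rfloor> / of_int (int (Suc t)) - y) < e" if "t \<ge> n" for t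
    proof -
      have "norm (of_int \<lfloor>of_int (int (Suc t)) * y\<rfloor> / of_int (int (Suc t)) - y) \<le> 1 / of_int (int (Suc t))"
        using floor_approx[of "int (Suc t)" y] by (simp only: real_norm_def)
      also have "\<dots> \<le> inverse (real (Suc n))" using that by (simp add: field_simps)
      finally show ?thesis using n by simp
    qed
    then show "\<exists>n. \<forall>t\<ge>n. norm (of_int \<lfloor>of_int (int (Suc t)) * y\<rfloor> / of_int (int (Suc t)) - y) < e" by blast
  qed
  show ?thesis unfolding round_seq_def tendsto_complex_iff using lim[of "Re x"] lim[of "Im x"] by simp
qed

text \<open>Gram-Schmidt without normalisation stays inside the Gaussian rationals.\<close>

lemma orthogonal_rational_approx:
  assumes "orthonormal d r v"
  shows "\<exists>w. (\<forall>t i j. gauss_rat (w t i j)) \<and>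
     (\<forall>t. \<forall>i<r. \<forall>k<r. i \<noteq> k \<longrightarrow> ip d (w t i) (w t k) = 0) \<and>
     (\<forall>i<r. \<forall>j<d. (\<lambda>t. w t i j) \<longlonglongrightarrow> v i j)"
  using assms
proof (induction r)
  case 0
  then show ?case by (intro exI[of _ "\<lambda>t i j. 0"]) (simp add: gauss_rat_def)
next
  case (Suc r)
  then have orth_v: "orthonormal d r v" by (simp add: orthonormal_def)
  obtain w where w0: "\<forall>t i j. gauss_rat (w t i j)"
    "\<forall>t. \<forall>i<r. \<forall>k<r. i \<noteq> k \<longrightarrow> ip d (w t i) (w t k) = 0"
    "\<forall>i<r. \<forall>j<d. (\<lambda>t. w t i j) \<longlonglongrightarrow> v i j"
    using Suc.IH[OF orth_v] by (elim exE conjE) (rule that)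
  note w = w0[rule_format]
  define a where "a t j = round_seq (v r j) t" for t j
  define u where "u t j = a t j - (\<Sum>i<r. ip d (w t i) (a t) / ip d (w t i) (w t i) * w t i j)" for t j
  have qa: "gauss_rat (a t j)" for t j by (simp add: a_def gauss_rat_round_seq)
  have qu: "gauss_rat (u t j)" for t j
    unfolding u_def by (intro gauss_rat_diff gauss_rat_sum gauss_rat_mult gauss_rat_divide gauss_rat_ip qa w(1))
  have orth: "ip d (w t k) (u t) = 0" if k: "k < r" for t k
  proof -
    have "ip d (w t k) (u t) = ip d (w t k) (a t) -
        (\<Sum>j<d. \<Sum>i<r. cnj (w t k j) * (ip d (w t i) (a t) / ip d (w t i) (w t i) * w t i j))"
      by (simp add: ip_def u_def right_diff_distrib sum_subtractf sum_distrib_left)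
    also have "(\<Sum>j<d. \<Sum>i<r. cnj (w t k j) * (ip d (w t i) (a t) / ip d (w t i) (w t i) * w t i j))
        = (\<Sum>i<r. ip d (w t i) (a t) / ip d (w t i) (w t i) * ip d (w t k) (w t i))"
      by (subst sum.swap) (simp add: ip_def[of d "w t k"] sum_distrib_left sum_divide_distrib mult_ac)
    also have "\<dots> = (\<Sum>i<r. if i = k then ip d (w t k) (a t) / ip d (w t k) (w t k) * ip d (w t k) (w t k) else 0)"
      using w(2)[OF k] by (intro sum.cong refl) auto
    also have "\<dots> = ip d (w t k) (a t) / ip d (w t k) (w t k) * ip d (w t k) (w t k)"
      using k by simp
    \<comment> \<open>For small \<open>t\<close> the vector \<open>w t k\<close> may be zero, as
      only its limit is controlled. Then both sides vanish, because division by zero yields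
      0.\<close>
    also have "\<dots> = ip d (w t k) (a t)"
    proof (cases "ip d (w t k) (w t k) = 0")
      case True
      have "w t k j = 0" if "j < d" for j by (rule ip_self_eq_0[OF True that])
      then show ?thesis using True by (simp add: ip_def)
    qed simp
    finally show ?thesis by simp
  qed
  have lim_a: "(\<lambda>t. a t j) \<longlonglongrightarrow> v r j" for j unfolding a_def by (rule round_seq_tendsto)
  have lim_u: "(\<lambda>t. u t j) \<longlonglongrightarrow> v r j" if j: "j < d" for j
  proof -
    have "(\<lambda>t. ip d (w t i) (a t)) \<longlonglongrightarrow> ip d (v i) (v r)" if "i < r" for i
      unfolding ip_def using w(3)[OF that] by (intro tendsto_intros lim_a) auto
    moreover have iv: "ip d (v i) (v r) = 0" "ip d (v i) (v i) = 1" if "i < r" for i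
      using that Suc.prems by (simp_all add: orthonormal_def)
    ultimately have l1: "(\<lambda>t. ip d (w t i) (a t)) \<longlonglongrightarrow> 0" if "i < r" for i
      using that by metis
    have "(\<lambda>t. ip d (w t i) (w t i)) \<longlonglongrightarrow> ip d (v i) (v i)" if "i < r" for i
      unfolding ip_def using w(3)[OF that] by (intro tendsto_intros) auto
    then have l2: "(\<lambda>t. ip d (w t i) (w t i)) \<longlonglongrightarrow> 1" if "i < r" for i
      using that iv by metis
    have "(\<lambda>t. u t j) \<longlonglongrightarrow> v r j - (\<Sum>i<r. 0 / 1 * v i j)"
      unfolding u_def using j by (intro tendsto_intros lim_a l1 l2 w(3)) auto
    then show ?thesis by simp
  qed
  define w' where "w' t i = (if i = r then u t else w t i)" for t i
  have "ip d (u t) (w t k) = 0" if "k < r" for t k using orth[OF that] ip_commute[of d "u t"] by simp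
  then show ?case
    using w qu orth lim_u by (intro exI[of _ w']) (auto simp: w'_def less_Suc_eq)
qed

lemma finite_rats_common_denominator:
  assumes "finite A" "A \<subseteq> \<rat>"
  shows "\<exists>E>0::int. \<forall>x\<in>A. of_int E * x \<in> (\<int> :: real set)"
  using assms
proof (induction A rule: finite_induct)
  case empty
  then show ?case by (intro exI[of _ 1]) simp
next
  case (insert x A)
  then obtain E where E: "E > 0" "\<forall>x\<in>A. of_int E * x \<in> (\<int> :: real set)" by auto
  obtain a b where x: "x = of_int a / of_int b" "b > 0"
    using insert.prems by (auto elim: Rats_cases')
  have "of_int (E * b) * x = of_int (E * a)" using x by simp
  moreover have "of_int (E * b) * y \<in> \<int>" if "y \<in> A" for y
  proof -
    have "of_int (E * b) * y = of_int b * (of_int E * y)" by simp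
    then show ?thesis using E that by (metis Ints_mult Ints_of_int)
  qed
  ultimately have "\<forall>y\<in>insert x A. of_int (E * b) * y \<in> \<int>" by (metis Ints_of_int insertE)
  then show ?case using E x by (intro exI[of _ "E * b"]) auto
qed

type_synonym gvec = "(int \<times> int) list"

definition isum :: "(nat \<Rightarrow> int) \<Rightarrow> nat \<Rightarrow> int" where
  "isum f n = foldr (\<lambda>i a. f i + a) [0..<n] 0"

lemma isum_eq: "isum f n = (\<Sum>i<n. f i)"
proof -
  have "foldr (\<lambda>i a. f i + a) xs 0 = sum_list (map f xs)" for xs by (induction xs) auto
  then show ?thesis by (simp add: isum_def interv_sum_list_conv_sum_set_nat atLeast0LessThan)
qed

lemma computable_isum [comp_intros]:
  assumes "computable (\<lambda>p. f (fst p) (snd p))" "computable n"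
  shows "computable (\<lambda>x. isum (f x) (n x))"
  unfolding isum_def by (intro comp_intros assms computable_comp2[OF assms(1)])

definition gnormv :: "gvec \<Rightarrow> int" where
  "gnormv u = isum (\<lambda>j. gnorm2 (get u j)) (length u)"

definition gdot :: "gvec \<Rightarrow> gvec \<Rightarrow> int \<times> int" where
  "gdot u v =
    (isum (\<lambda>j. fst (get u j) * fst (get v j) + snd (get u j) * snd (get v j)) (length u),
     isum (\<lambda>j. fst (get u j) * snd (get v j) - snd (get u j) * fst (get v j)) (length u))"

definition ortho_list :: "nat \<Rightarrow> gvec list \<Rightarrow> bool" where
  "ortho_list d us \<longleftrightarrow> (\<forall>u\<in>set us. length u = d \<and> 0 < gnormv u) \<and>
     (\<forall>i<length us. \<forall>j<i. gdot (get us i) (get us j) = (0, 0))"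

lemma computable_gnormv [comp_intros]: "computable f \<Longrightarrow> computable (\<lambda>x. gnormv (f x))"
  unfolding gnormv_def by (intro comp_intros | erule computable_comp)+

lemma computable_gdot [comp_intros]:
  assumes "computable f" "computable g"
  shows "computable (\<lambda>x. gdot (f x) (g x))"
  unfolding gdot_def by (intro comp_intros assms assms[THEN computable_comp])

lemma computable_ortho_list [comp_intros]:
  assumes "computable f" "computable g"
  shows "computable (\<lambda>x. ortho_list (f x) (g x))"
  unfolding ortho_list_def by (intro comp_intros assms assms[THEN computable_comp])

text \<open>The lists stay unnormalised because norms may be irrational; the square root appears
  only here and in the codes of the vectors.\<close>

definition evec :: "gvec list \<Rightarrow> nat \<Rightarrow> nat \<Rightarrow> complex" where
  "evec us k j = gval (us ! k ! j) / of_real (sqrt (of_int (gnormv (us ! k))))"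

lemma gval_gdot:
  assumes "length u = d" "length v = d"
  shows "gval (gdot u v) = ip d (\<lambda>j. gval (u ! j)) (\<lambda>j. gval (v ! j))"
proof -
  have "gval (gdot u v) = (\<Sum>j<d. Complex (of_int (fst (u ! j) * fst (v ! j) + snd (u ! j) * snd (v ! j)))
     (of_int (fst (u ! j) * snd (v ! j) - snd (u ! j) * fst (v ! j))))"
    using assms by (simp add: gval_def gdot_def isum_eq complex_eq_iff get_nth)
  also have "\<dots> = ip d (\<lambda>j. gval (u ! j)) (\<lambda>j. gval (v ! j))"
    unfolding ip_def by (intro sum.cong refl) (simp add: gval_def complex_eq_iff)
  finally show ?thesis .
qed

lemma of_int_gnormv:
  "length u = d \<Longrightarrow> of_int (gnormv u) = (\<Sum>j<d. (cmod (gval (u ! j)))\<^sup>2)"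
  by (simp add: gnormv_def isum_eq get_nth cmod_gval)

lemma orthonormal_evec:
  assumes "ortho_list d us"
  shows "orthonormal d (length us) (evec us)"
  unfolding orthonormal_def
proof (intro allI impI)
  fix i k assume ik: "i < length us" "k < length us"
  define c where "c i = complex_of_real (sqrt (of_int (gnormv (us ! i))))" for i
  have len: "length (us ! i) = d" "length (us ! k) = d" and pos: "gnormv (us ! i) > 0"
    using assms ik by (auto simp: ortho_list_def)
  have "ip d (evec us i) (evec us k) = ip d (\<lambda>j. gval (us ! i ! j)) (\<lambda>j. gval (us ! k ! j)) / (c i * c k)"
    by (simp add: ip_def evec_def c_def sum_divide_distrib)
  moreover have "ip d (\<lambda>j. gval (us ! i ! j)) (\<lambda>j. gval (us ! k ! j)) = (if i = k then c i * c k else 0)"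
  proof (cases "i = k")
    case True
    have "ip d (\<lambda>j. gval (us ! i ! j)) (\<lambda>j. gval (us ! i ! j)) = of_real (of_int (gnormv (us ! i)))"
      unfolding ip_self of_int_gnormv[OF len(1)] ..
    also have "\<dots> = c i * c i" using pos by (simp add: c_def flip: of_real_mult)
    finally show ?thesis using True by simp
  next
    case False
    have z: "gdot (us ! a) (us ! b) = (0, 0)" if "b < a" "a < length us" for a b
      using assms that by (auto simp: ortho_list_def get_nth)
    have "gval (gdot (us ! i) (us ! k)) = 0 \<or> gval (gdot (us ! k) (us ! i)) = 0"
      using False z[of i k] z[of k i] ik by (cases "i < k") (auto simp: gval_def Complex_eq_0)
    then have "ip d (\<lambda>j. gval (us ! i ! j)) (\<lambda>j. gval (us ! k ! j)) = 0"
      unfolding gval_gdot[OF len] gval_gdot[OF len(2,1)]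
      using ip_commute[of d "\<lambda>j. gval (us ! k ! j)" "\<lambda>j. gval (us ! i ! j)"] by auto
    then show ?thesis using False by simp
  qed
  moreover have "c i \<noteq> 0" using pos by (simp add: c_def)
  ultimately show "ip d (evec us i) (evec us k) = (if i = k then 1 else 0)" by auto
qed

text \<open>A common denominator turns Gaussian rational vectors into integer ones without affecting
  orthogonality or the normalised vectors. Both estimates are needed: the one for coordinates is
  compared with output vectors of \<open>U\<close>, the one for matrices with the projections of a
  test.\<close>

lemma ortho_list_approx:
  assumes "orthonormal d r v" "\<eta> > 0"
  shows "\<exists>E>0. \<exists>us. length us = r \<and> ortho_list d us \<and>
     (\<forall>i<r. \<forall>j<d. cmod (gval (us ! i ! j) / of_int E - v i j) < \<eta>) \<and>
     (\<forall>i<d. \<forall>j<d. cmod (pmat r (evec us) i j - pmat r v i j) < \<eta>)"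
proof -
  obtain w where w0: "\<forall>t i j. gauss_rat (w t i j)"
    "\<forall>t. \<forall>i<r. \<forall>k<r. i \<noteq> k \<longrightarrow> ip d (w t i) (w t k) = 0"
    "\<forall>i<r. \<forall>j<d. (\<lambda>t. w t i j) \<longlonglongrightarrow> v i j"
    using orthogonal_rational_approx[OF assms(1)] by (elim exE conjE) (rule that)
  note w = w0[rule_format]
  define N where "N t i = (\<Sum>j<d. (cmod (w t i j))\<^sup>2)" for t i
  have N_lim: "(\<lambda>t. N t i) \<longlonglongrightarrow> 1" if "i < r" for i
  proof -
    have "(\<lambda>t. N t i) \<longlonglongrightarrow> (\<Sum>j<d. (cmod (v i j))\<^sup>2)"
      unfolding N_def using w(3)[OF that] by (intro tendsto_intros) auto
    moreover have "complex_of_real (\<Sum>j<d. (cmod (v i j))\<^sup>2) = 1"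
      using assms(1) that unfolding ip_self[symmetric] by (simp add: orthonormal_def)
    ultimately show ?thesis by (metis of_real_eq_1_iff)
  qed
  define f where "f t i j = w t i j / of_real (sqrt (N t i))" for t i j
  have f_lim: "(\<lambda>t. f t i j) \<longlonglongrightarrow> v i j" if "i < r" "j < d" for i j
  proof -
    have "(\<lambda>t. f t i j) \<longlonglongrightarrow> v i j / of_real (sqrt 1)"
      unfolding f_def using w(3)[OF that] N_lim[OF that(1)] by (intro tendsto_intros) auto
    then show ?thesis by simp
  qed
  have p_lim: "(\<lambda>t. pmat r (f t) i j) \<longlonglongrightarrow> pmat r v i j" if "i < d" "j < d" for i j
    unfolding pmat_def using that by (intro tendsto_intros f_lim) auto
  have e1: "\<forall>\<^sub>F t in sequentially. \<forall>i\<in>{..<r}. N t i > 0"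
    by (intro eventually_ball_finite ballI order_tendstoD(1)[OF N_lim]) auto
  have e2: "\<forall>\<^sub>F t in sequentially. \<forall>i\<in>{..<r}. \<forall>j\<in>{..<d}. cmod (w t i j - v i j) < \<eta>"
    using tendstoD[OF w(3) assms(2)] by (intro eventually_ball_finite ballI) (auto simp: dist_norm)
  have e3: "\<forall>\<^sub>F t in sequentially. \<forall>i\<in>{..<d}. \<forall>j\<in>{..<d}. cmod (pmat r (f t) i j - pmat r v i j) < \<eta>"
    using tendstoD[OF p_lim assms(2)] by (intro eventually_ball_finite ballI) (auto simp: dist_norm)
  obtain t where t0: "\<forall>i\<in>{..<r}. N t i > 0" "\<forall>i\<in>{..<r}. \<forall>j\<in>{..<d}. cmod (w t i j - v i j) < \<eta>"
    "\<forall>i\<in>{..<d}. \<forall>j\<in>{..<d}. cmod (pmat r (f t) i j - pmat r v i j) < \<eta>"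
    using eventually_happens'[OF _ eventually_conj[OF e1 eventually_conj[OF e2 e3]]] by auto
  then have t: "\<And>i. i < r \<Longrightarrow> N t i > 0" "\<And>i j. i < r \<Longrightarrow> j < d \<Longrightarrow> cmod (w t i j - v i j) < \<eta>"
    "\<And>i j. i < d \<Longrightarrow> j < d \<Longrightarrow> cmod (pmat r (f t) i j - pmat r v i j) < \<eta>" by auto
  define A where "A = (\<lambda>(i, j). Re (w t i j)) ` ({..<r} \<times> {..<d}) \<union> (\<lambda>(i, j). Im (w t i j)) ` ({..<r} \<times> {..<d})"
  have A: "finite A" "A \<subseteq> \<rat>" using w(1) by (auto simp: A_def gauss_rat_def)
  obtain E :: int where E: "E > 0" "\<forall>x\<in>A. of_int E * x \<in> \<int>"
    using finite_rats_common_denominator[OF A] by (elim exE conjE) (rule that)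
  define us where "us = map (\<lambda>i. map (\<lambda>j. (\<lfloor>of_int E * Re (w t i j)\<rfloor>, \<lfloor>of_int E * Im (w t i j)\<rfloor>)) [0..<d]) [0..<r]"
  have len: "length us = r" "\<And>i. i < r \<Longrightarrow> length (us ! i) = d" by (auto simp: us_def)
  have us: "gval (us ! i ! j) = of_int E * w t i j" if "i < r" "j < d" for i j
  proof -
    have "Re (w t i j) \<in> A" "Im (w t i j) \<in> A" using that by (force simp: A_def)+
    then have "of_int E * Re (w t i j) \<in> \<int>" "of_int E * Im (w t i j) \<in> \<int>" using E by auto
    then show ?thesis using that by (auto simp: us_def gval_def complex_eq_iff elim!: Ints_cases)
  qed
  have norm: "real_of_int (gnormv (us ! i)) = (of_int E)\<^sup>2 * N t i" if "i < r" for i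
    using us[OF that] unfolding of_int_gnormv[OF len(2)[OF that]] N_def sum_distrib_left
    by (intro sum.cong) (auto simp: norm_mult power_mult_distrib)
  have pos: "gnormv (us ! i) > 0" if "i < r" for i
  proof -
    have "0 < (of_int E)\<^sup>2 * N t i" using E(1) t(1)[OF that] by simp
    then show ?thesis unfolding norm[OF that, symmetric] by simp
  qed
  have "ortho_list d us"
    unfolding ortho_list_def
  proof (intro conjI ballI allI impI)
    fix u assume "u \<in> set us"
    then obtain i where "i < r" "u = us ! i" using len(1) by (metis in_set_conv_nth)
    then show "length u = d" "0 < gnormv u" using len pos by auto
  next
    fix i k assume ik: "i < length us" "k < i"
    then have ik': "i < r" "k < r" "i \<noteq> k" using len by auto
    have "gval (gdot (us ! i) (us ! k)) = ip d (\<lambda>j. of_int E * w t i j) (\<lambda>j. of_int E * w t k j)"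
      unfolding gval_gdot[OF len(2)[OF ik'(1)] len(2)[OF ik'(2)]] ip_def
      using us ik' by (intro sum.cong) auto
    also have "\<dots> = of_int E * of_int E * ip d (w t i) (w t k)"
      by (simp add: ip_def sum_distrib_left mult_ac)
    also have "\<dots> = 0" using w(2)[OF ik'] by simp
    finally have "gdot (us ! i) (us ! k) = (0, 0)" by (simp add: gval_def complex_eq_iff prod_eq_iff)
    then show "gdot (get us i) (get us k) = (0, 0)" using ik by (simp add: get_nth)
  qed
  moreover have "cmod (gval (us ! i ! j) / of_int E - v i j) < \<eta>" if "i < r" "j < d" for i j
    using t(2)[OF that] us[OF that] E(1) by simp
  moreover have "evec us i j = f t i j" if "i < r" "j < d" for i j
  proof -
    have "sqrt (of_int (gnormv (us ! i))) = of_int E * sqrt (N t i)"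
      unfolding norm[OF that(1)] using E(1) by (simp add: real_sqrt_mult)
    then show ?thesis using us[OF that] E(1) by (simp add: evec_def f_def)
  qed
  then have "pmat r (evec us) i j = pmat r (f t) i j" if "i < d" "j < d" for i j
    using that by (simp add: pmat_def)
  ultimately show ?thesis using E(1) len(1) t(3) by (intro exI[of _ E] conjI exI[of _ us]) auto
qed

section \<open>Density matrices\<close>

lemma sum_two_point:
  fixes f :: "nat \<Rightarrow> complex"
  assumes "i < d" "j < d" "i \<noteq> j"
  shows "(\<Sum>a<d. (if a = i then x else if a = j then y else 0) * f a) = x * f i + y * f j"
proof -
  have "(\<Sum>a<d. (if a = i then x else if a = j then y else 0) * f a)
      = (\<Sum>a<d. (if a = i then x * f i else 0) + (if a = j then y * f j else 0))"
    using assms by (intro sum.cong) auto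
  also have "\<dots> = x * f i + y * f j" using assms by (simp add: sum.distrib)
  finally show ?thesis .
qed

text \<open>Evaluate the form at the sum of the \<open>i\<close>-th basis vector and
  \<open>s\<close> times the \<open>j\<close>-th, with the phase \<open>s\<close> chosen so that
  \<open>s * A i j = - |A i j|\<close>. Positivity then bounds \<open>2 |A i j|\<close> by the sum
  of two diagonal entries, hence by the trace.\<close>

lemma density_matrix_entries:
  assumes "density_matrix n A" "i < 2 ^ n" "j < 2 ^ n"
  shows "cmod (A i j) \<le> 1"
proof -
  define d where "d = (2::nat) ^ n"
  have ij: "i < d" "j < d" using assms by (auto simp: d_def)
  have herm: "\<And>i j. i < d \<Longrightarrow> j < d \<Longrightarrow> A j i = cnj (A i j)"
    and psd: "\<And>v. Re (qform d A v) \<ge> 0" and tr: "mtrace d A = 1"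
    using assms(1) unfolding density_matrix_def hermitian_def d_def by blast+
  have dn: "Re (A k k) \<ge> 0" if "k < d" for k
  proof -
    have "qform d A (\<lambda>a. if a = k then 1 else 0) = (\<Sum>i<d. \<Sum>j<d. if j = k then (if i = k then A k k else 0) else 0)"
      unfolding qform_def by (intro sum.cong refl) auto
    then have "qform d A (\<lambda>a. if a = k then 1 else 0) = A k k" using that by simp
    then show ?thesis using psd by metis
  qed
  have tr': "(\<Sum>k<d. Re (A k k)) = 1" using arg_cong[OF tr, of Re] by (simp add: mtrace_def)
  show ?thesis
  proof (cases "i = j")
    case True
    have "A i i = cnj (A i i)" using herm[OF ij(1) ij(1)] .
    then have "Im (A i i) = 0" by (simp add: complex_eq_iff)
    then have "cmod (A i i) = Re (A i i)" using dn[OF ij(1)] by (simp add: cmod_eq_Re)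
    also have "\<dots> \<le> (\<Sum>k<d. Re (A k k))" using ij(1) dn by (intro member_le_sum) auto
    finally show ?thesis using True tr' by simp
  next
    case False
    define x where "x = A i j"
    define s where "s = (if x = 0 then 1 else - cnj x / of_real (cmod x))"
    have s1: "cmod s = 1" by (simp add: s_def norm_divide)
    have sx: "s * x = - of_real (cmod x)"
    proof (cases "x = 0")
      case False
      have "s * x = - (x * cnj x) / of_real (cmod x)" using False by (simp add: s_def mult.commute)
      also have "\<dots> = - of_real (cmod x)" using False
        by (simp add: power2_eq_square flip: complex_norm_square)
      finally show ?thesis .
    qed (simp add: s_def)
    define v where "v a = (if a = i then 1 else if a = j then s else 0)" for a
    have cv: "cnj (v a) = (if a = i then 1 else if a = j then cnj s else 0)" for a by (simp add: v_def)
    have row: "(\<Sum>b<d. A a b * v b) = A a i + s * A a j" for a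
      using sum_two_point[OF ij False, of 1 s "\<lambda>b. A a b"] by (simp add: v_def mult.commute)
    have "qform d A v = (\<Sum>a<d. cnj (v a) * (\<Sum>b<d. A a b * v b))"
      by (simp add: qform_def sum_distrib_left mult.assoc)
    also have "\<dots> = (\<Sum>a<d. (if a = i then 1 else if a = j then cnj s else 0) * (A a i + s * A a j))"
      unfolding row cv ..
    also have "\<dots> = A i i + s * x + cnj s * (cnj x + s * A j j)"
      using sum_two_point[OF ij False, of 1 "cnj s" "\<lambda>a. A a i + s * A a j"] herm[OF ij]
      by (simp add: x_def)
    also have "\<dots> = A i i + s * x + cnj (s * x) + (s * cnj s) * A j j"
      by (simp add: algebra_simps)
    also have "s * cnj s = 1" using s1 by (simp add: complex_norm_square[symmetric])
    finally have "qform d A v = A i i + A j j - 2 * of_real (cmod x)" by (simp add: sx)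
    then have "2 * cmod x \<le> Re (A i i) + Re (A j j)" using psd[of v] by simp
    also have "\<dots> = (\<Sum>k\<in>{i, j}. Re (A k k))" using False by simp
    also have "\<dots> \<le> (\<Sum>k<d. Re (A k k))" using ij dn by (intro sum_mono2) auto
    finally show ?thesis using tr' by (simp add: x_def)
  qed
qed

lemma mtrace_mmult_close:
  assumes "\<And>i j. i < d \<Longrightarrow> j < d \<Longrightarrow> cmod (A i j) \<le> 1" "\<And>i j. i < d \<Longrightarrow> j < d \<Longrightarrow> cmod (S i j - S' i j) \<le> \<eta>"
  shows "cmod (mtrace d (mmult d A S) - mtrace d (mmult d A S')) \<le> real d * real d * \<eta>"
proof -
  have "mtrace d (mmult d A S) - mtrace d (mmult d A S') = (\<Sum>i<d. \<Sum>k<d. A i k * (S k i - S' k i))"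
    by (simp add: mtrace_def mmult_def right_diff_distrib sum_subtractf)
  also have "cmod \<dots> \<le> (\<Sum>i<d. \<Sum>k<d. \<eta>)"
  proof (intro sum_norm_le)
    fix i k assume "i \<in> {..<d}" "k \<in> {..<d}"
    then have "cmod (A i k) * cmod (S k i - S' k i) \<le> 1 * \<eta>" using assms by (intro mult_mono) auto
    then show "cmod (A i k * (S k i - S' k i)) \<le> \<eta>" by (simp add: norm_mult)
  qed
  finally show ?thesis by simp
qed

lemma cnj_mult_close:
  assumes "cmod v \<le> 1" "cmod v' \<le> 1" "cmod (w - v) \<le> \<eta>" "cmod (w' - v') \<le> \<eta>" "\<eta> \<le> 1"
  shows "cmod (cnj w * w' - cnj v * v') \<le> 3 * \<eta>"
proof -
  have "\<eta> \<ge> 0" using assms(3) norm_ge_zero order_trans by blast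
  have "cmod w' \<le> 2" using norm_triangle_ineq[of "w' - v'" v'] assms by simp
  have "cnj w * w' - cnj v * v' = cnj (w - v) * w' + cnj v * (w' - v')" by (simp add: algebra_simps)
  also have "cmod \<dots> \<le> cmod (w - v) * cmod w' + cmod v * cmod (w' - v')"
    by (metis norm_triangle_ineq norm_mult complex_mod_cnj)
  also have "\<dots> \<le> \<eta> * 2 + 1 * \<eta>"
    using assms \<open>\<eta> \<ge> 0\<close> \<open>cmod w' \<le> 2\<close> by (intro add_mono mult_mono) auto
  finally show ?thesis by simp
qed

lemma qform_close:
  assumes "\<And>i j. i < d \<Longrightarrow> j < d \<Longrightarrow> cmod (A i j) \<le> 1" "\<And>j. j < d \<Longrightarrow> cmod (v j) \<le> 1"
    "\<And>j. j < d \<Longrightarrow> cmod (w j - v j) \<le> \<eta>" "\<eta> \<le> 1"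
  shows "cmod (qform d A w - qform d A v) \<le> real d * real d * (3 * \<eta>)"
proof -
  have "qform d A w - qform d A v = (\<Sum>i<d. \<Sum>j<d. A i j * (cnj (w i) * w j - cnj (v i) * v j))"
    by (simp add: qform_def right_diff_distrib sum_subtractf mult_ac)
  also have "cmod \<dots> \<le> (\<Sum>i<d. \<Sum>j<d. 3 * \<eta>)"
  proof (intro sum_norm_le)
    fix i j assume ij: "i \<in> {..<d}" "j \<in> {..<d}"
    have "cmod (cnj (w i) * w j - cnj (v i) * v j) \<le> 3 * \<eta>" using ij assms by (intro cnj_mult_close) auto
    then have "cmod (A i j) * cmod (cnj (w i) * w j - cnj (v i) * v j) \<le> 1 * (3 * \<eta>)"
      using ij assms by (intro mult_mono) auto
    then show "cmod (A i j * (cnj (w i) * w j - cnj (v i) * v j)) \<le> 3 * \<eta>" by (simp add: norm_mult)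
  qed
  finally show ?thesis by simp
qed

lemma norm_close:
  assumes "\<And>j. j < d \<Longrightarrow> cmod (v j) \<le> 1" "\<And>j. j < d \<Longrightarrow> cmod (w j - v j) \<le> \<eta>" "\<eta> \<le> 1"
  shows "\<bar>(\<Sum>j<d. (cmod (w j))\<^sup>2) - (\<Sum>j<d. (cmod (v j))\<^sup>2)\<bar> \<le> real d * (3 * \<eta>)"
proof -
  have "cmod (complex_of_real ((\<Sum>j<d. (cmod (w j))\<^sup>2) - (\<Sum>j<d. (cmod (v j))\<^sup>2))) \<le> real d * (3 * \<eta>)"
  proof -
    have "complex_of_real ((\<Sum>j<d. (cmod (w j))\<^sup>2) - (\<Sum>j<d. (cmod (v j))\<^sup>2)) = (\<Sum>j<d. cnj (w j) * w j - cnj (v j) * v j)"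
      unfolding of_real_diff ip_self[symmetric] ip_def by (simp add: sum_subtractf)
    also have "cmod \<dots> \<le> (\<Sum>j<d. 3 * \<eta>)" using assms by (intro sum_norm_le cnj_mult_close) auto
    finally show ?thesis by simp
  qed
  then show ?thesis by (simp only: norm_of_real real_norm_def)
qed

section \<open>Codes of projections and of orthonormal sets\<close>

text \<open>Numerator and denominator of an entry of the projection onto the span of
  \<open>us\<close>. Products of two normalised coordinates involve no square root, so the entry is
  a Gaussian rational; the fraction is left unreduced over the product of the norms.\<close>

definition pentry :: "gvec list \<Rightarrow> nat \<Rightarrow> nat \<Rightarrow> (int \<times> int) \<times> int" where
  "pentry us i j = foldr (\<lambda>u acc.
     ((gnormv u * fst (fst acc) + snd acc * (fst (get u i) * fst (get u j) + snd (get u i) * snd (get u j)),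
       gnormv u * snd (fst acc) + snd acc * (snd (get u i) * fst (get u j) - fst (get u i) * snd (get u j))),
      gnormv u * snd acc)) us ((0, 0), 1)"

text \<open>The denominator is squared because \<open>alg_code z N\<close> denotes
  \<open>z / sqrt N\<close>.\<close>

definition mcode :: "gvec list \<Rightarrow> nat \<Rightarrow> nat" where
  "mcode us d = enc (map (\<lambda>i. map (\<lambda>j. alg_code (fst (pentry us i j)) (snd (pentry us i j) * snd (pentry us i j)))
     [0..<d]) [0..<d])"

definition fcode :: "gvec list \<Rightarrow> nat" where
  "fcode us = enc (map (\<lambda>u. map (\<lambda>z. alg_code z (gnormv u)) u) us)"

lemma computable_pentry [comp_intros]:
  assumes "computable f" "computable g" "computable h"
  shows "computable (\<lambda>x. pentry (f x) (g x) (h x))"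
  unfolding pentry_def by (intro comp_intros assms assms[THEN computable_comp])

lemma computable_mcode [comp_intros]:
  assumes "computable f" "computable g"
  shows "computable (\<lambda>x. mcode (f x) (g x))"
  unfolding mcode_def by (intro comp_intros assms assms[THEN computable_comp])

lemma computable_fcode [comp_intros]: "computable f \<Longrightarrow> computable (\<lambda>x. fcode (f x))"
proof -
  have "computable fcode" unfolding fcode_def by (intro comp_intros)
  then show "computable f \<Longrightarrow> ?thesis" by (rule computable_comp)
qed

lemma pentry_value:
  assumes "\<forall>u\<in>set us. length u = d \<and> 0 < gnormv u" "i < d" "j < d"
  shows "snd (pentry us i j) > 0 \<and> gval (fst (pentry us i j)) / of_int (snd (pentry us i j)) =
    (\<Sum>u\<leftarrow>us. gval (u ! i) * cnj (gval (u ! j)) / of_int (gnormv u))"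
  using assms(1)
proof (induction us)
  case Nil
  then show ?case by (simp add: pentry_def gval_def Complex_eq_0)
next
  case (Cons u us)
  define p where "p = pentry us i j"
  have IH: "snd p > 0" "gval (fst p) / of_int (snd p) = (\<Sum>u\<leftarrow>us. gval (u ! i) * cnj (gval (u ! j)) / of_int (gnormv u))"
    using Cons by (auto simp: p_def)
  have u: "length u = d" "gnormv u > 0" using Cons.prems by auto
  have sn: "snd (pentry (u # us) i j) = gnormv u * snd p" by (simp add: pentry_def p_def)
  have "gval (fst (pentry (u # us) i j)) = of_int (gnormv u) * gval (fst p) + of_int (snd p) * (gval (u ! i) * cnj (gval (u ! j)))"
    using u(1) assms(2,3) by (simp add: pentry_def p_def gval_def complex_eq_iff get_nth algebra_simps)
  then have "gval (fst (pentry (u # us) i j)) / of_int (snd (pentry (u # us) i j)) =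
      gval (u ! i) * cnj (gval (u ! j)) / of_int (gnormv u) + gval (fst p) / of_int (snd p)"
    using u(2) IH(1) by (simp add: sn add_divide_distrib)
  then show ?case using IH u(2) by (simp add: sn)
qed

lemma pentry_pmat:
  assumes "ortho_list d us" "i < d" "j < d"
  shows "snd (pentry us i j) > 0" "gval (fst (pentry us i j)) / of_int (snd (pentry us i j)) = pmat (length us) (evec us) i j"
proof -
  have us: "\<forall>u\<in>set us. length u = d \<and> 0 < gnormv u" using assms(1) by (simp add: ortho_list_def)
  note * = pentry_value[OF us assms(2,3)]
  show "snd (pentry us i j) > 0" using * by simp
  have "(\<Sum>u\<leftarrow>us. gval (u ! i) * cnj (gval (u ! j)) / of_int (gnormv u)) =
      (\<Sum>k<length us. gval (us ! k ! i) * cnj (gval (us ! k ! j)) / of_int (gnormv (us ! k)))"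
    by (simp add: sum_list_sum_nth atLeast0LessThan)
  also have "\<dots> = pmat (length us) (evec us) i j"
    unfolding pmat_def
  proof (intro sum.cong refl)
    fix k assume "k \<in> {..<length us}"
    then have "gnormv (us ! k) > 0" using us by simp
    then have "complex_of_real (sqrt (of_int (gnormv (us ! k)))) * of_real (sqrt (of_int (gnormv (us ! k)))) = of_int (gnormv (us ! k))"
      by (simp flip: of_real_mult)
    then show "gval (us ! k ! i) * cnj (gval (us ! k ! j)) / of_int (gnormv (us ! k)) = evec us k i * cnj (evec us k j)"
      by (simp add: evec_def)
  qed
  finally show "gval (fst (pentry us i j)) / of_int (snd (pentry us i j)) = pmat (length us) (evec us) i j"
    using * by simp
qed

lemma mat_rows_enc: "mat_rows (enc (rs :: nat list list)) = map (map alg_decode) rs"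
  by (simp add: mat_rows_def enc_list_def vec_decode_def enc_nat_def o_def)

lemma fset_decode_enc: "fset_decode (enc (rs :: nat list list)) = map alg_decode ` set rs"
  by (simp add: fset_decode_def enc_list_def vec_decode_def enc_nat_def o_def image_image)

lemma mat_dim_mcode: "mat_dim (mcode us d) = d"
  by (simp add: mat_dim_def mcode_def mat_rows_enc)

lemma mat_decode_mcode:
  assumes "ortho_list d us" "i < d" "j < d"
  shows "mat_decode (mcode us d) i j = pmat (length us) (evec us) i j"
proof -
  have pos: "snd (pentry us i j) > 0" using pentry_pmat[OF assms] by simp
  have "mat_decode (mcode us d) i j = alg_decode (alg_code (fst (pentry us i j)) (snd (pentry us i j) * snd (pentry us i j)))"
    using assms(2,3) by (simp add: mat_decode_def mcode_def mat_rows_enc)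
  also have "\<dots> = gval (fst (pentry us i j)) / of_int (snd (pentry us i j))"
    using pos by (subst alg_decode_alg_code) auto
  finally show ?thesis using pentry_pmat[OF assms] by simp
qed

lemma mtrace_cong: "(\<And>i. i < d \<Longrightarrow> A i i = B i i) \<Longrightarrow> mtrace d A = mtrace d B"
  by (simp add: mtrace_def)

lemma mmult_cong: "(\<And>k. k < d \<Longrightarrow> A i k = A' i k) \<Longrightarrow> (\<And>k. k < d \<Longrightarrow> B k j = B' k j) \<Longrightarrow> mmult d A B i j = mmult d A' B' i j"
  by (simp add: mmult_def)

lemma special_proj_mcode:
  assumes "ortho_list (2 ^ n) us"
  shows "special_proj_code (mcode us (2 ^ n))" (is "special_proj_code ?k")
    "tau_proj (mcode us (2 ^ n)) = real (length us) / 2 ^ n"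
    "state_val \<rho> (mcode us (2 ^ n)) = (\<Sum>k<length us. Re (qform (2 ^ n) (\<rho> n) (evec us k)))"
proof -
  define d where "d = (2::nat) ^ n"
  have o: "orthonormal d (length us) (evec us)" using orthonormal_evec assms by (simp add: d_def)
  have dim: "mat_dim ?k = d" by (simp add: mat_dim_mcode d_def)
  have ent: "mat_decode ?k i j = pmat (length us) (evec us) i j" if "i < d" "j < d" for i j
    using mat_decode_mcode[OF assms] that by (simp add: d_def)
  show "special_proj_code ?k"
    unfolding special_proj_code_def dim
  proof (intro conjI allI impI ballI)
    show "\<exists>n. d = 2 ^ n" by (auto simp: d_def)
    show "length r = d" if "r \<in> set (mat_rows ?k)" for r
      using that by (auto simp: mcode_def mat_rows_enc d_def)
    show "hermitian d (mat_decode ?k)"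
      unfolding hermitian_def
    proof (intro allI impI)
      fix i j assume ij: "i < d" "j < d"
      then have "pmat (length us) (evec us) j i = cnj (pmat (length us) (evec us) i j)"
        using hermitian_pmat unfolding hermitian_def by blast
      then show "mat_decode ?k j i = cnj (mat_decode ?k i j)" by (simp only: ent[OF ij] ent[OF ij(2,1)])
    qed
    show "mmult d (mat_decode ?k) (mat_decode ?k) i j = mat_decode ?k i j" if "i < d" "j < d" for i j
      using pmat_idem[OF o, of i j] that by (simp add: mmult_def ent)
  qed
  have "mtrace d (mat_decode ?k) = of_nat (length us)"
    unfolding mtrace_pmat[OF o, symmetric] by (rule mtrace_cong) (simp add: ent)
  then show "tau_proj ?k = real (length us) / 2 ^ n" by (simp add: tau_proj_def dim) (simp add: d_def)
  have the: "(THE m. d = 2 ^ m) = n" by (rule the_equality) (auto simp: d_def)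
  have "mtrace d (mmult d (\<rho> n) (mat_decode ?k)) = mtrace d (mmult d (\<rho> n) (pmat (length us) (evec us)))"
    by (intro mtrace_cong mmult_cong) (auto simp: ent)
  then show "state_val \<rho> ?k = (\<Sum>k<length us. Re (qform (2 ^ n) (\<rho> n) (evec us k)))"
    unfolding state_val_def dim the mtrace_mmult_pmat by (simp add: d_def)
qed

lemma qform_evec:
  assumes "gnormv (us ! k) > 0"
  shows "qform d A (evec us k) = qform d A (\<lambda>j. gval (us ! k ! j)) / of_int (gnormv (us ! k))"
proof -
  define s where "s = complex_of_real (sqrt (of_int (gnormv (us ! k))))"
  have s: "s * s = of_int (gnormv (us ! k))" "cnj s = s" using assms by (simp_all add: s_def flip: of_real_mult)
  have "qform d A (evec us k) = qform d A (\<lambda>j. gval (us ! k ! j)) / (s * s)"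
    unfolding qform_def evec_def s_def[symmetric] by (simp add: sum_divide_distrib s(2))
  then show ?thesis by (simp add: s)
qed

section \<open>Kraft's inequality\<close>

text \<open>A string of length \<open>l\<close> has \<open>2 ^ (N - l)\<close> extensions of the
  maximal length \<open>N\<close>, and prefix-freeness makes these sets of extensions
  disjoint.\<close>

lemma kraft_inequality:
  assumes "prefix_free_machine U" "finite A" "\<And>\<sigma>. \<sigma> \<in> A \<Longrightarrow> U \<sigma> \<noteq> None"
  shows "(\<Sum>\<sigma>\<in>A. 1 / 2 ^ length \<sigma>) \<le> (1 :: real)"
proof -
  define N where "N = Max (insert 0 (length ` A))"
  have N: "length \<sigma> \<le> N" if "\<sigma> \<in> A" for \<sigma> using assms(2) that by (auto simp: N_def)
  define ext where "ext \<sigma> = (\<lambda>\<tau>. \<sigma> @ \<tau>) ` {\<tau> :: bool list. length \<tau> = N - length \<sigma>}" for \<sigma> :: "bool list"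
  have fin: "finite {\<tau> :: bool list. length \<tau> = m}" and card: "card {\<tau> :: bool list. length \<tau> = m} = 2 ^ m" for m
    using finite_lists_length_eq[of "UNIV :: bool set" m] card_lists_length_eq[of "UNIV :: bool set" m] by simp_all
  have card_ext: "card (ext \<sigma>) = 2 ^ (N - length \<sigma>)" for \<sigma>
    unfolding ext_def by (subst card_image) (auto simp: card inj_on_def)
  have disj: "ext \<sigma> \<inter> ext \<sigma>' = {}" if "\<sigma> \<in> A" "\<sigma>' \<in> A" "\<sigma> \<noteq> \<sigma>'" for \<sigma> \<sigma>'
  proof (rule ccontr)
    assume "ext \<sigma> \<inter> ext \<sigma>' \<noteq> {}"
    then obtain \<tau> \<tau>' where "\<sigma> @ \<tau> = \<sigma>' @ \<tau>'" by (auto simp: ext_def)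
    then obtain \<upsilon> where "\<sigma> = \<sigma>' @ \<upsilon> \<or> \<sigma>' = \<sigma> @ \<upsilon>" by (auto simp: append_eq_append_conv2)
    moreover have "\<upsilon> = []" using calculation assms(1) assms(3)[OF that(1)] assms(3)[OF that(2)]
      unfolding prefix_free_machine_def by metis
    ultimately show False using that(3) by auto
  qed
  have "(\<Sum>\<sigma>\<in>A. 2 ^ (N - length \<sigma>)) = card (\<Union>\<sigma>\<in>A. ext \<sigma>)"
    unfolding card_ext[symmetric]
    by (rule card_UN_disjoint[symmetric]) (use assms(2) disj fin in \<open>auto simp: ext_def\<close>)
  also have "\<dots> \<le> card {\<tau> :: bool list. length \<tau> = N}"
    using N by (intro card_mono fin) (auto simp: ext_def)
  finally have "(\<Sum>\<sigma>\<in>A. 2 ^ (N - length \<sigma>)) \<le> (2::nat) ^ N" by (simp add: card)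
  then have "real (\<Sum>\<sigma>\<in>A. 2 ^ (N - length \<sigma>)) \<le> 2 ^ N" by (metis of_nat_le_iff of_nat_numeral of_nat_power)
  moreover have "real (\<Sum>\<sigma>\<in>A. 2 ^ (N - length \<sigma>)) = 2 ^ N * (\<Sum>\<sigma>\<in>A. 1 / 2 ^ length \<sigma>)"
    unfolding of_nat_sum sum_distrib_left
  proof (intro sum.cong refl)
    fix \<sigma> assume "\<sigma> \<in> A"
    then show "real (2 ^ (N - length \<sigma>)) = 2 ^ N * (1 / 2 ^ length \<sigma>)"
      using power_diff[of "2::real" "length \<sigma>" N] N by simp
  qed
  ultimately show ?thesis by (simp add: mult_le_cancel_left1)
qed

lemma bs_code_inj: "bs_code \<sigma> = bs_code \<tau> \<Longrightarrow> \<sigma> = \<tau>"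
proof (induction \<sigma> arbitrary: \<tau>)
  case Nil
  then show ?case by (cases \<tau>) (auto split: if_splits)
next
  case (Cons b \<sigma>)
  then obtain b' \<tau>' where "\<tau> = b' # \<tau>'" by (cases \<tau>) (auto split: if_splits)
  then have "(if b then 2 else 1) + 2 * bs_code \<sigma> = (if b' then 2 else 1) + 2 * bs_code \<tau>'" using Cons.prems by simp
  then have "b = b' \<and> bs_code \<sigma> = bs_code \<tau>'" by (auto split: if_splits; presburger)
  then show ?case using Cons.IH \<open>\<tau> = b' # \<tau>'\<close> by simp
qed

lemma bs_code_surj: "\<exists>\<sigma>. bs_code \<sigma> = n"
proof (induction n rule: less_induct)
  case (less n)
  show ?case
  proof (cases "n = 0")
    case True
    then show ?thesis by (intro exI[of _ "[]"]) simp
  next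
    case False
    define b where "b \<longleftrightarrow> even n"
    have "(n - 1) div 2 < n" using False by simp
    then obtain \<sigma> where "bs_code \<sigma> = (n - 1) div 2" using less by blast
    then have "bs_code (b # \<sigma>) = n" using False by (auto simp: b_def elim!: evenE oddE)
    then show ?thesis ..
  qed
qed

text \<open>Makes \<open>1 / Suc s\<close> a substitute for \<open>2 ^ (- length)\<close> up to a
  factor 2, so that acceptance can be phrased with the code \<open>s\<close> of a program
  alone.\<close>

lemma bs_code_bounds: "2 ^ length \<sigma> \<le> Suc (bs_code \<sigma>)" "Suc (bs_code \<sigma>) < 2 ^ Suc (length \<sigma>)"
  by (induction \<sigma>) auto

section \<open>From short descriptions to a strong Solovay test\<close>

text \<open>With \<open>T\<close> this number, \<open>near\<close> guarantees an error below
  \<open>\<eta> = 2 / Suc T\<close>. The total loss \<open>L * 6 * d ^ 3 * \<eta>\<close> should be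
  at most \<open>1 / (2 * E)\<close>, whence the constant 24; \<open>Suc L\<close> instead of
  \<open>L\<close> also secures \<open>\<eta> \<le> 1 / (12 * d)\<close>.\<close>

definition precision :: "nat \<Rightarrow> nat \<Rightarrow> nat \<Rightarrow> nat" where
  "precision E L d = 24 * E * Suc L * d * d * d"

text \<open>Only nearness to an orthogonal list is tested, which is decidable; exact orthonormality
  of the vectors \<open>vs\<close> is not part of the test.\<close>

definition close_list :: "nat \<Rightarrow> nat list list \<Rightarrow> nat \<Rightarrow> int \<Rightarrow> gvec list \<Rightarrow> bool" where
  "close_list E vs n D us \<longleftrightarrow> (\<forall>v\<in>set vs. length v = 2 ^ n \<and>
     (\<exists>u\<in>set us. \<forall>j<2 ^ n. near (get v j) (get u j) D (precision E (length vs) (2 ^ n))))"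

lemma computable_close_list [comp_intros]:
  assumes "computable f" "computable g" "computable h" "computable k"
  shows "computable (\<lambda>x. close_list E (f x) (g x) (h x) (k x))"
  unfolding close_list_def precision_def by (intro comp_intros assms assms[THEN computable_comp])

lemma cinner_ip: "length v = d \<Longrightarrow> cinner v w = ip d (\<lambda>i. v ! i) (\<lambda>i. w ! i)"
  by (simp add: cinner_def ip_def)

lemma ip_diff_self:
  "ip d (\<lambda>j. v j - w j) (\<lambda>j. v j - w j) = ip d v v - ip d v w - ip d w v + ip d w w"
  by (simp add: ip_def sum_subtractf[symmetric] sum.distrib[symmetric] algebra_simps)

text \<open>The map \<open>\<kappa>\<close> sends each vector of \<open>F\<close> to a nearby vector
  of the list. It is injective, because distinct orthonormal vectors have squared distance 2 while
  two vectors near the same one are closer; positivity of \<open>A\<close> then allows dropping the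
  remaining vectors of the list. Per vector the loss is \<open>3 * d ^ 2 * \<eta>\<close> for the
  form and at most \<open>3 * d ^ 3 * \<eta>\<close> for the normalisation.\<close>

lemma close_list_projection:
  assumes A: "density_matrix n A" and us: "ortho_list (2 ^ n) us" and D: "D > 0" and E: "E > 0"
    and F: "F = map alg_decode ` set vs" "orthonormal_alg (2 ^ n) F"
    and close: "close_list E vs n D us"
  shows "(\<Sum>v\<in>F. Re (qform (2 ^ n) A (\<lambda>i. v ! i))) - 1 / (2 * real E)
    \<le> (\<Sum>k<length us. Re (qform (2 ^ n) A (evec us k)))"
proof -
  define d where "d = (2::nat) ^ n"
  have d1: "real d \<ge> 1" by (simp add: d_def)
  define L where "L = length vs"
  define T where "T = precision E L d"
  define \<eta> where "\<eta> = 2 / real (Suc T)"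
  have T: "24 * real E * real (Suc L) * real d ^ 3 \<le> real (Suc T)"
    by (simp add: T_def precision_def power3_eq_cube algebra_simps)
  have small: "real L * (6 * real d ^ 3 * \<eta>) \<le> 1 / (2 * real E)"
  proof -
    have "24 * real E * real L * real d ^ 3 \<le> 24 * real E * real (Suc L) * real d ^ 3"
      by (intro mult_mono) auto
    then have "24 * real E * real L * real d ^ 3 \<le> real (Suc T)" using T by linarith
    then show ?thesis using E by (simp add: \<eta>_def field_simps)
  qed
  have \<eta>12: "\<eta> \<le> 1 / (12 * real d)"
  proof -
    have "24 * 1 * 1 * real d \<le> 24 * real E * real (Suc L) * real d ^ 3"
      using E d1 by (intro mult_mono) (auto simp: self_le_power)
    then have "24 * real d \<le> real (Suc T)" using T by linarith
    then show ?thesis using d1 by (simp add: \<eta>_def field_simps)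
  qed
  have "1 / (12 * real d) \<le> 1" using d1 by (simp add: field_simps)
  then have \<eta>1: "\<eta> \<le> 1" using \<eta>12 by linarith
  have \<eta>0: "\<eta> > 0" by (simp add: \<eta>_def)
  have ent: "cmod (A i j) \<le> 1" if "i < d" "j < d" for i j
    using density_matrix_entries[OF A] that by (simp add: d_def)
  have psd: "Re (qform d A v) \<ge> 0" for v using A by (simp add: density_matrix_def d_def)
  have usd: "\<And>u. u \<in> set us \<Longrightarrow> length u = d \<and> gnormv u > 0" using us by (simp add: ortho_list_def d_def)
  have flen: "length f = d" if "f \<in> F" for f using F(2) that by (simp add: orthonormal_alg_def d_def)
  have fip: "ip d (\<lambda>i. f ! i) (\<lambda>i. f' ! i) = (if f = f' then 1 else 0)" if "f \<in> F" "f' \<in> F" for f f'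
    using F(2) that cinner_ip[OF flen[OF that(1)], of f'] by (auto simp: orthonormal_alg_def)
  have fsum: "(\<Sum>j<d. (cmod (f ! j))\<^sup>2) = 1" if "f \<in> F" for f
    using fip[OF that that] unfolding ip_self by (metis of_real_eq_1_iff)
  have f1: "cmod (f ! j) \<le> 1" if "f \<in> F" "j < d" for f j
  proof -
    have "(cmod (f ! j))\<^sup>2 \<le> (\<Sum>j<d. (cmod (f ! j))\<^sup>2)" using that(2) by (intro member_le_sum) auto
    then show ?thesis using fsum[OF that(1)] by (simp add: abs_square_le_1)
  qed
  have "\<exists>k<length us. \<forall>j<d. cmod (gval (us ! k ! j) / of_int D - f ! j) \<le> \<eta>" if f: "f \<in> F" for f
  proof -
    obtain v where v: "v \<in> set vs" "f = map alg_decode v" using f F(1) by auto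
    obtain u where u: "length v = d" "u \<in> set us" "\<And>j. j < d \<Longrightarrow> near (get v j) (get u j) D T"
      using close v(1) unfolding close_list_def T_def L_def d_def by blast
    obtain k where k: "k < length us" "u = us ! k" using u(2) by (metis in_set_conv_nth)
    have "cmod (gval (us ! k ! j) / of_int D - f ! j) \<le> \<eta>" if "j < d" for j
      using near_imp[OF D u(3)[OF that]] usd[OF u(2)] that u(1) k(2)
      by (simp add: get_nth v(2) \<eta>_def norm_minus_commute)
    then show ?thesis using k(1) by blast
  qed
  then obtain \<kappa> where \<kappa>: "\<And>f. f \<in> F \<Longrightarrow> \<kappa> f < length us"
     "\<And>f j. f \<in> F \<Longrightarrow> j < d \<Longrightarrow> cmod (gval (us ! \<kappa> f ! j) / of_int D - f ! j) \<le> \<eta>" by metis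
  have inj: "inj_on \<kappa> F"
  proof (rule inj_onI, rule ccontr)
    fix f f' assume ff: "f \<in> F" "f' \<in> F" "\<kappa> f = \<kappa> f'" "f \<noteq> f'"
    have "cmod (f ! j - f' ! j) \<le> 2 * \<eta>" if "j < d" for j
      using \<kappa>(2)[OF ff(1) that] \<kappa>(2)[OF ff(2) that] ff(3)
        norm_triangle_ineq4[of "gval (us ! \<kappa> f ! j) / of_int D - f' ! j" "gval (us ! \<kappa> f ! j) / of_int D - f ! j"]
      by simp
    then have "(\<Sum>j<d. (cmod (f ! j - f' ! j))\<^sup>2) \<le> (\<Sum>j<d. (2 * \<eta>)\<^sup>2)"
      by (intro sum_mono power_mono) auto
    also have "\<dots> = 4 * real d * \<eta> * \<eta>" by (simp add: power2_eq_square)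
    also have "\<dots> \<le> 4 * real d * (1 / (12 * real d)) * 1"
      using \<eta>12 \<eta>1 \<eta>0 d1 by (intro mult_mono) auto
    also have "\<dots> < 2" using d1 by simp
    finally have "(\<Sum>j<d. (cmod (f ! j - f' ! j))\<^sup>2) < 2" .
    moreover have "complex_of_real (\<Sum>j<d. (cmod (f ! j - f' ! j))\<^sup>2) = 2"
      unfolding ip_self[symmetric] ip_diff_self using fip ff by simp
    ultimately show False by (metis of_real_eq_iff of_real_numeral less_irrefl)
  qed
  have main: "Re (qform d A (\<lambda>i. f ! i)) \<le> Re (qform d A (evec us (\<kappa> f))) + 6 * real d ^ 3 * \<eta>" if f: "f \<in> F" for f
  proof -
    define u where "u = us ! \<kappa> f"
    have u: "length u = d" "gnormv u > 0" using usd[of u] \<kappa>(1)[OF f] by (auto simp: u_def)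
    define w where "w j = gval (u ! j) / of_int D" for j
    define N where "N = (\<Sum>j<d. (cmod (w j))\<^sup>2)"
    define q where "q = Re (qform d A (\<lambda>i. f ! i))"
    define x where "x = Re (qform d A w)"
    define a where "a = real d * real d * (3 * \<eta>)"
    define b where "b = real d * (3 * \<eta>)"
    have wf: "cmod (w j - f ! j) \<le> \<eta>" if "j < d" for j using \<kappa>(2)[OF f that] by (simp add: w_def u_def)
    have "cmod (qform d A w - qform d A (\<lambda>i. f ! i)) \<le> a"
      unfolding a_def using ent f1[OF f] wf \<eta>1 by (intro qform_close) auto
    then have xq: "q - a \<le> x"
      using abs_Re_le_cmod[of "qform d A w - qform d A (\<lambda>i. f ! i)"] by (simp add: x_def q_def)
    have "\<bar>N - 1\<bar> \<le> b"
      unfolding N_def b_def fsum[OF f, symmetric] using f1[OF f] wf \<eta>1 by (intro norm_close) auto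
    then have Nb: "N \<le> 1 + b" by simp
    have b0: "b \<ge> 0" using \<eta>0 by (simp add: b_def)
    have a0: "a \<ge> 0" using \<eta>0 by (simp add: a_def)
    have Nu: "real_of_int (gnormv u) = (of_int D)\<^sup>2 * N"
      unfolding of_int_gnormv[OF u(1)] N_def w_def sum_distrib_left
      using D by (intro sum.cong) (auto simp: norm_divide power_divide)
    then have N0: "N > 0" using u(2) D by (metis of_int_0_less_iff zero_less_mult_pos zero_less_power)
    have "qform d A (\<lambda>j. gval (u ! j)) = (of_int D)\<^sup>2 * qform d A w"
      unfolding qform_def w_def sum_distrib_left using D by (intro sum.cong refl) (simp add: power2_eq_square)
    then have "qform d A (evec us (\<kappa> f)) = qform d A w / of_real N"
      using qform_evec[of us "\<kappa> f" d A] u(2) D arg_cong[OF Nu, of complex_of_real] by (simp add: u_def)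
    then have val: "Re (qform d A (evec us (\<kappa> f))) = x / N" by (simp add: x_def)
    have q2: "q \<le> real d * real d"
    proof -
      have "q \<le> cmod (qform d A (\<lambda>i. f ! i))" unfolding q_def by (rule complex_Re_le_cmod)
      also have "\<dots> \<le> (\<Sum>i<d. \<Sum>j<d. 1)"
        unfolding qform_def
      proof (intro sum_norm_le)
        fix i j assume ij: "i \<in> {..<d}" "j \<in> {..<d}"
        then have "cmod (f ! i) * cmod (A i j) * cmod (f ! j) \<le> 1 * 1 * 1"
          using f1[OF f] ent by (intro mult_mono) auto
        then show "cmod (cnj (f ! i) * A i j * f ! j) \<le> 1" by (simp add: norm_mult)
      qed
      finally show ?thesis by simp
    qed
    \<comment> \<open>Dividing by \<open>N \<le> 1 + b\<close> costs at most
      \<open>d * d * b\<close>: a positive left-hand side \<open>y\<close> satisfies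
      \<open>y * N \<le> y + y * b\<close> and \<open>y \<le> d * d\<close>. In the other case
      positivity of the form suffices.\<close>
    have "q - a - real d * real d * b \<le> x / N"
    proof (cases "q - a - real d * real d * b \<le> 0")
      case True
      have "0 \<le> x / N" using psd[of w] N0 by (simp add: x_def)
      then show ?thesis using True by linarith
    next
      case False
      define y where "y = q - a - real d * real d * b"
      have "0 \<le> real d * real d * b" using b0 by simp
      then have "y \<le> real d * real d" using q2 a0 by (simp add: y_def)
      then have "y * b \<le> real d * real d * b" using b0 by (intro mult_right_mono) auto
      have "y * N \<le> y * (1 + b)" using Nb False by (intro mult_left_mono) (auto simp: y_def)
      also have "\<dots> = y + y * b" by (simp add: algebra_simps)
      also have "\<dots> \<le> y + real d * real d * b" using \<open>y * b \<le> real d * real d * b\<close> by simp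
      also have "\<dots> = q - a" by (simp add: y_def)
      also have "\<dots> \<le> x" by (rule xq)
      finally have "y \<le> x / N" using N0 by (simp add: pos_le_divide_eq)
      then show ?thesis by (simp add: y_def)
    qed
    moreover have "a + real d * real d * b \<le> 6 * real d ^ 3 * \<eta>"
    proof -
      define e2 e3 where "e2 = real d * real d * \<eta>" and "e3 = real d * real d * \<eta> * real d"
      have "e2 * 1 \<le> e2 * real d" unfolding e2_def using d1 \<eta>0 by (intro mult_left_mono) auto
      then have "e2 \<le> e3" by (simp add: e2_def e3_def)
      moreover have "a = 3 * e2" "real d * real d * b = 3 * e3" "6 * real d ^ 3 * \<eta> = 6 * e3"
        by (simp_all add: a_def b_def e2_def e3_def power3_eq_cube)
      ultimately show ?thesis by linarith
    qed
    ultimately show ?thesis by (simp add: val q_def)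
  qed
  have finF: "finite F" using F(1) by simp
  have cardF: "card F \<le> L" unfolding F(1) L_def by (metis card_image_le card_length finite_set le_trans)
  have "(\<Sum>f\<in>F. Re (qform d A (\<lambda>i. f ! i))) \<le> (\<Sum>f\<in>F. Re (qform d A (evec us (\<kappa> f))) + 6 * real d ^ 3 * \<eta>)"
    using main by (rule sum_mono)
  also have "\<dots> = (\<Sum>k\<in>\<kappa> ` F. Re (qform d A (evec us k))) + real (card F) * (6 * real d ^ 3 * \<eta>)"
    by (simp add: sum.distrib sum.reindex[OF inj])
  also have "\<dots> \<le> (\<Sum>k<length us. Re (qform d A (evec us k))) + real L * (6 * real d ^ 3 * \<eta>)"
    using cardF \<eta>0 \<kappa>(1) psd by (intro add_mono sum_mono2 mult_right_mono) auto
  finally show ?thesis using small by (simp add: d_def)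
qed

text \<open>Running time, number of qubits, common denominator and orthogonal list.\<close>

type_synonym witness = "nat \<times> nat \<times> int \<times> gvec list"

text \<open>The bound on the length of the list is the integer form of
  \<open>length \<sigma> + log |F| < n + c\<close>; the additional factor 2 pays for using the code
  \<open>s\<close> in place of the length of the program.\<close>

definition accepts :: "recf \<Rightarrow> nat \<Rightarrow> nat \<Rightarrow> nat \<Rightarrow> witness \<Rightarrow> bool" where
  "accepts r E c s w \<longleftrightarrow> steps r [s] (fst w) \<noteq> 0 \<and> 0 < fst (snd (snd w)) \<and>
     ortho_list (2 ^ fst (snd w)) (snd (snd (snd w))) \<and>
     length (snd (snd (snd w))) * Suc s \<le> 2 ^ (fst (snd w) + c + 1) \<and>
     close_list E (dec (steps r [s] (fst w) - 1)) (fst (snd w)) (fst (snd (snd w))) (snd (snd (snd w)))"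

text \<open>Choosing the least witness gives each program at most one projection, as the comparison
  with Kraft's sum requires.\<close>

definition first_accepts :: "recf \<Rightarrow> nat \<Rightarrow> nat \<Rightarrow> nat \<Rightarrow> nat \<Rightarrow> bool" where
  "first_accepts r E c s w \<longleftrightarrow> accepts r E c s (dec w) \<and> (\<forall>w'<w. \<not> accepts r E c s (dec w'))"

text \<open>Indices that are not first witnesses contribute the zero projection on zero qubits,
  whose trace is 0.\<close>

definition witness_test :: "recf \<Rightarrow> nat \<Rightarrow> nat \<Rightarrow> nat \<Rightarrow> nat" where
  "witness_test r E c m = (if first_accepts r E c (fst (dec m :: nat \<times> nat)) (snd (dec m :: nat \<times> nat))
     then mcode (snd (snd (snd (dec (snd (dec m :: nat \<times> nat)) :: witness))))
            (2 ^ fst (snd (dec (snd (dec m :: nat \<times> nat)) :: witness)))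
     else mcode [] 1)"

lemma computable_accepts [comp_intros]:
  assumes "computable f" "computable g"
  shows "computable (\<lambda>x. accepts r E c (f x) (g x))"
  unfolding accepts_def by (intro comp_intros assms computable_comp2[OF computable_steps])

lemma computable_witness_test: "computable (witness_test r E c)"
  unfolding witness_test_def[abs_def] first_accepts_def by (intro comp_intros)

lemma witness_test_value:
  assumes "first_accepts r E c s w" "(dec w :: witness) = (t, n, D, us)"
  shows "witness_test r E c (prod_encode (s, w)) = mcode us (2 ^ n)"
proof -
  have "dec (prod_encode (s, w)) = (s, w)" by (simp add: dec_prod_def dec_nat_def)
  then show ?thesis using assms by (simp add: witness_test_def)
qed

lemma witness_test_cases:
  obtains (accepted) s w t n D us where "m = prod_encode (s, w)" "first_accepts r E c s w" "(dec w :: witness) = (t, n, D, us)"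
      "witness_test r E c m = mcode us (2 ^ n)"
    | (rejected) "\<not> first_accepts r E c (fst (prod_decode m)) (snd (prod_decode m))" "witness_test r E c m = mcode [] (2 ^ 0)"
proof (cases "first_accepts r E c (fst (prod_decode m)) (snd (prod_decode m))")
  case True
  obtain t n D us where "(dec (snd (prod_decode m)) :: witness) = (t, n, D, us)" by (metis prod.exhaust)
  then show ?thesis
    using accepted[of "fst (prod_decode m)" "snd (prod_decode m)" t n D us] True
      witness_test_value[OF True, of t n D us] by simp
next
  case False
  then have "witness_test r E c m = mcode [] (2 ^ 0)"
    by (simp add: witness_test_def dec_prod_def dec_nat_def)
  then show ?thesis using False rejected by blast
qed

lemma ortho_list_Nil: "ortho_list d []"
  by (simp add: ortho_list_def)

lemma accepts_ortho_list:
  assumes "first_accepts r E c s w" "(dec w :: witness) = (t, n, D, us)"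
  shows "ortho_list (2 ^ n) us" "real (length us) / 2 ^ n \<le> 2 ^ (c + 1) / real (Suc s)" "steps r [s] t \<noteq> 0"
    "D > 0" "close_list E (dec (steps r [s] t - 1)) n D us"
proof -
  have a: "accepts r E c s (t, n, D, us)" using assms by (simp add: first_accepts_def)
  then show "ortho_list (2 ^ n) us" "steps r [s] t \<noteq> 0" "D > 0" "close_list E (dec (steps r [s] t - 1)) n D us"
    by (simp_all add: accepts_def)
  have "length us * Suc s \<le> 2 ^ (n + c + 1)" using a by (simp add: accepts_def)
  then have "real (length us) * real (Suc s) \<le> 2 ^ n * 2 ^ (c + 1)"
    by (metis (mono_tags, lifting) add.assoc of_nat_le_iff of_nat_mult of_nat_numeral of_nat_power power_add)
  then show "real (length us) / 2 ^ n \<le> 2 ^ (c + 1) / real (Suc s)"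
    by (simp add: field_simps)
qed

text \<open>An accepted projection has trace at most \<open>2 ^ (c + 1) / Suc s\<close>, hence at
  most \<open>2 ^ (c + 1)\<close> times the Kraft weight of the program coded by \<open>s\<close>.
  Distinct accepted indices belong to distinct halting programs, so the traces sum to at most
  \<open>2 ^ (c + 1)\<close>.\<close>

lemma strong_solovay_witness_test:
  assumes U: "prefix_free_machine U" and r: "\<And>\<sigma> y. eval_rf r [bs_code \<sigma>] y \<longleftrightarrow> U \<sigma> = Some y"
  shows "strong_solovay_test (witness_test r E c)"
proof -
  let ?g = "witness_test r E c"
  have special: "special_proj_code (?g m) \<and> tau_proj (?g m) \<ge> 0" for m
  proof (cases rule: witness_test_cases[where r = r and E = E and c = c and m = m])
    case (accepted s w t n D us)
    then show ?thesis using special_proj_mcode(1,2)[OF accepts_ortho_list(1)[OF accepted(2,3)]] by simp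
  next
    case rejected
    then show ?thesis using special_proj_mcode(1,2)[OF ortho_list_Nil, of 0] by simp
  qed
  define G where "G = {m. first_accepts r E c (fst (prod_decode m)) (snd (prod_decode m))}"
  define \<sigma> where "\<sigma> m = (SOME \<sigma>. bs_code \<sigma> = fst (prod_decode m))" for m
  have \<sigma>: "bs_code (\<sigma> m) = fst (prod_decode m)" for m
    unfolding \<sigma>_def using bs_code_surj by (rule someI_ex)
  have dom: "U (\<sigma> m) \<noteq> None" if "m \<in> G" for m
  proof -
    obtain t n D us where w: "(dec (snd (prod_decode m)) :: witness) = (t, n, D, us)" by (metis prod.exhaust)
    have "steps r [fst (prod_decode m)] t \<noteq> 0"
      using accepts_ortho_list(3)[OF _ w, of r E c "fst (prod_decode m)"] that by (simp add: G_def)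
    then obtain y where "steps r [bs_code (\<sigma> m)] t = Suc y" unfolding \<sigma> by (metis not0_implies_Suc)
    then have "eval_rf r [bs_code (\<sigma> m)] y" using eval_rf_iff_steps by blast
    then show ?thesis using r by simp
  qed
  have inj: "inj_on \<sigma> G"
  proof (rule inj_onI)
    fix m m' assume m: "m \<in> G" "m' \<in> G" "\<sigma> m = \<sigma> m'"
    then have s: "fst (prod_decode m) = fst (prod_decode m')" using \<sigma> by metis
    have "snd (prod_decode m) = snd (prod_decode m')"
      using m(1,2) s unfolding G_def first_accepts_def mem_Collect_eq by (metis linorder_neqE_nat)
    then show "m = m'" using s by (metis prod.expand prod_decode_inverse)
  qed
  have tau0: "tau_proj (?g m) = 0" if "m \<notin> G" for m
  proof (cases rule: witness_test_cases[where r = r and E = E and c = c and m = m])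
    case rejected
    then show ?thesis using special_proj_mcode(2)[OF ortho_list_Nil, of 0] by simp
  qed (use that in \<open>auto simp: G_def\<close>)
  have tau: "tau_proj (?g m) \<le> 2 ^ (c + 1) * (1 / 2 ^ length (\<sigma> m))" if "m \<in> G" for m
  proof -
    define s where "s = fst (prod_decode m)"
    obtain t n D us where w: "(dec (snd (prod_decode m)) :: witness) = (t, n, D, us)" by (metis prod.exhaust)
    have fa: "first_accepts r E c s (snd (prod_decode m))" using that by (simp add: G_def s_def)
    have "tau_proj (?g m) = real (length us) / 2 ^ n"
      using witness_test_value[OF fa w] special_proj_mcode(2)[OF accepts_ortho_list(1)[OF fa w]] by (simp add: s_def)
    also have "\<dots> \<le> 2 ^ (c + 1) / real (Suc s)" using accepts_ortho_list(2)[OF fa w] .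
    also have "\<dots> \<le> 2 ^ (c + 1) / 2 ^ length (\<sigma> m)"
    proof -
      have "real (2 ^ length (\<sigma> m)) \<le> real (Suc s)"
        using bs_code_bounds(1)[of "\<sigma> m"] unfolding \<sigma> s_def by (simp only: of_nat_le_iff)
      then show ?thesis by (intro divide_left_mono) auto
    qed
    finally show ?thesis by simp
  qed
  have "(\<Sum>m<M. tau_proj (?g m)) \<le> 2 ^ (c + 1)" for M
  proof -
    define B where "B = {..<M} \<inter> G"
    have "(\<Sum>m<M. tau_proj (?g m)) = (\<Sum>m\<in>B. tau_proj (?g m))"
      by (rule sum.mono_neutral_right) (auto simp: B_def tau0)
    also have "\<dots> \<le> (\<Sum>m\<in>B. 2 ^ (c + 1) * (1 / 2 ^ length (\<sigma> m)))"
      using tau by (intro sum_mono) (auto simp: B_def)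
    also have "\<dots> = 2 ^ (c + 1) * (\<Sum>s\<in>\<sigma> ` B. 1 / 2 ^ length s)"
      using inj_on_subset[OF inj, of B] by (subst sum.reindex) (auto simp: B_def sum_distrib_left)
    also have "(\<Sum>s\<in>\<sigma> ` B. 1 / 2 ^ length s) \<le> (1::real)"
      using dom by (intro kraft_inequality[OF U]) (auto simp: B_def)
    finally show ?thesis by simp
  qed
  then have "summable (\<lambda>m. tau_proj (?g m))"
    using special by (intro summableI_nonneg_bounded[where x = "2 ^ (c + 1)"]) auto
  then show ?thesis
    using special computable_witness_test[of r E c] by (simp add: strong_solovay_test_def computable_nat_iff)
qed

text \<open>The witness is an approximation of \<open>F\<close> by as many orthogonal integer
  vectors, taken to the precision that \<open>close_list\<close> demands; the rank bound comes from
  \<open>R < 2 ^ (n + c - l)\<close> and \<open>Suc s \<le> 2 ^ (l + 1)\<close>.\<close>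

lemma short_description_accepted:
  assumes k: "eval_rf r [s] k" and s: "Suc s < 2 ^ Suc l" and F: "orthonormal_alg (2 ^ n) (fset_decode k)"
    and short: "real l + log 2 (real (card (fset_decode k))) < real n + real c"
    and ne: "fset_decode k \<noteq> {}"
  shows "\<exists>w. accepts r E c s w"
proof -
  define d where "d = (2::nat) ^ n"
  define vs where "vs = (dec k :: nat list list)"
  have Fvs: "fset_decode k = map alg_decode ` set vs"
    using fset_decode_enc[of vs] by (simp add: vs_def)
  define F where "F = fset_decode k"
  have fin: "finite F" by (simp add: F_def Fvs)
  \<comment> \<open>The coded list may contain repetitions, whereas the description length involves
    the cardinality of \<open>F\<close>; hence a fresh enumeration without repetitions.\<close>
  obtain fs where fs: "set fs = F" "distinct fs" using finite_distinct_list[OF fin] by blast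
  define R where "R = length fs"
  have card: "card F = R" using fs distinct_card by (auto simp: R_def)
  have flen: "length f = d" if "f \<in> F" for f using assms(3) that by (simp add: orthonormal_alg_def d_def F_def)
  define v where "v = (\<lambda>i j. fs ! i ! j)"
  have on: "orthonormal d R v"
    unfolding orthonormal_def
  proof (intro allI impI)
    fix i k assume ik: "i < R" "k < R"
    then have "fs ! i \<in> F" "fs ! k \<in> F" "fs ! i = fs ! k \<longleftrightarrow> i = k"
      using fs by (auto simp: R_def nth_eq_iff_index_eq)
    then show "ip d (v i) (v k) = (if i = k then 1 else 0)"
      using assms(3) cinner_ip[OF flen, of "fs ! i" "fs ! k"] by (simp add: orthonormal_alg_def F_def v_def)
  qed
  define T where "T = precision E (length vs) d"
  obtain D us where D: "D > 0" "length us = R" "ortho_list d us"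
    and ap: "\<forall>i<R. \<forall>j<d. cmod (gval (us ! i ! j) / of_int D - v i j) < 1 / real (Suc T)"
    using ortho_list_approx[OF on, of "1 / real (Suc T)"] by auto
  obtain t where t: "steps r [s] t = Suc k" using k eval_rf_iff_steps by blast
  have usd: "length u = d" if "u \<in> set us" for u using D(3) that by (simp add: ortho_list_def)
  have "close_list E vs n D us"
    unfolding close_list_def
  proof (intro ballI conjI)
    fix x assume x: "x \<in> set vs"
    then have xF: "map alg_decode x \<in> F" by (simp add: F_def Fvs)
    show lx: "length x = 2 ^ n" using flen[OF xF] by (simp add: d_def)
    obtain i where i: "i < R" "fs ! i = map alg_decode x" using xF fs by (metis R_def in_set_conv_nth)
    have "near (get x j) (get (us ! i) j) D T" if j: "j < d" for j
    proof (rule imp_near[OF D(1)])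
      have "us ! i \<in> set us" using i D(2) by simp
      then have "get (us ! i) j = us ! i ! j" using usd j by (simp add: get_nth)
      moreover have "alg_decode (get x j) = v i j" using i(2) lx j by (simp add: v_def get_nth d_def)
      ultimately show "cmod (alg_decode (get x j) - gval (get (us ! i) j) / of_int D) < 1 / of_nat (Suc T)"
        using ap i(1) j by (simp add: norm_minus_commute)
    qed
    moreover have "us ! i \<in> set us" using i D(2) by simp
    ultimately show "\<exists>u\<in>set us. \<forall>j<2 ^ n. near (get x j) (get u j) D (precision E (length vs) (2 ^ n))"
      by (auto simp: T_def d_def)
  qed
  moreover have "length us * Suc s \<le> 2 ^ (n + c + 1)"
  proof -
    have R0: "R > 0" using ne card fin by (metis F_def card_gt_0_iff)
    have "log 2 (real R) < real n + real c - real l" using short card by (simp add: F_def)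
    then have "real R < 2 powr (real n + real c - real l)" using R0 by (simp add: log_less_iff)
    also have "\<dots> = 2 ^ (n + c) / 2 ^ l" by (simp add: powr_diff powr_add powr_realpow power_add)
    finally have "real R * 2 ^ l < 2 ^ (n + c)" by (simp add: field_simps)
    moreover have "real (Suc s) \<le> 2 * 2 ^ l"
      using s by (metis less_imp_le of_nat_le_iff of_nat_numeral of_nat_power power_Suc)
    then have "real R * real (Suc s) \<le> real R * (2 * 2 ^ l)" by (intro mult_left_mono) auto
    ultimately have "real R * real (Suc s) \<le> 2 ^ (n + c + 1)" by simp
    then show ?thesis unfolding D(2) by (metis of_nat_le_iff of_nat_mult of_nat_numeral of_nat_power)
  qed
  ultimately have "accepts r E c s (t, n, D, us)"
    using t D by (simp add: accepts_def vs_def d_def)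
  then show ?thesis ..
qed

theorem weak_solovay_random_imp_QK:
  assumes U: "prefix_free_machine U" and \<rho>: "is_state \<rho>" and wsr: "weak_solovay_random \<rho>"
    and eps: "eps > 0"
  shows "\<exists>n0. \<forall>n\<ge>n0. QK U eps n (\<rho> n) \<ge> ereal (real n + c)"
proof (rule ccontr)
  assume neg: "\<not> ?thesis"
  obtain r where r: "\<And>\<sigma> y. eval_rf r [bs_code \<sigma>] y \<longleftrightarrow> U \<sigma> = Some y"
    using U by (auto simp: prefix_free_machine_def machine_computable_def)
  \<comment> \<open>The approximation loses at most \<open>1 / (2 * E)\<close>, which is then below
    \<open>eps / 2\<close>.\<close>
  obtain E :: nat where E: "E > 0" "1 / real E < eps"
    using eps by (metis divide_inverse mult_1 reals_Archimedean zero_less_Suc)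
  obtain c' :: nat where c': "c \<le> real c'" using real_arch_simple by blast
  let ?g = "witness_test r E c'"
  have key: "\<exists>m. state_val \<rho> (?g m) > eps / 2 \<and> mat_dim (?g m) = 2 ^ n" if n: "QK U eps n (\<rho> n) < ereal (real n + c)" for n
  proof -
    obtain \<sigma> k where k: "U \<sigma> = Some k" "orthonormal_alg (2 ^ n) (fset_decode k)"
      and gt: "(\<Sum>v\<in>fset_decode k. Re (qform (2 ^ n) (\<rho> n) (\<lambda>i. v ! i))) > eps"
      and lt: "ereal (real (length \<sigma>) + log 2 (real (card (fset_decode k)))) < ereal (real n + c)"
      using n unfolding QK_def Inf_less_iff by auto
    have ne: "fset_decode k \<noteq> {}" using gt eps by auto
    define s where "s = bs_code \<sigma>"
    have ek: "eval_rf r [s] k" using r k by (simp add: s_def)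
    have "\<exists>w. accepts r E c' s w"
      using short_description_accepted[OF ek _ k(2) _ ne, of "length \<sigma>" c' E] bs_code_bounds(2)[of \<sigma>] lt c'
      by (simp add: s_def)
    then have "\<exists>w. accepts r E c' s (dec w)" by (metis dec_enc)
    then have fa: "first_accepts r E c' s (LEAST w. accepts r E c' s (dec w))" (is "first_accepts _ _ _ _ ?w")
      unfolding first_accepts_def by (metis (mono_tags, lifting) LeastI_ex not_less_Least)
    obtain t n' D us where w: "(dec ?w :: witness) = (t, n', D, us)" by (metis prod.exhaust)
    note a = accepts_ortho_list[OF fa w]
    obtain y where y: "steps r [s] t = Suc y" using a(3) by (metis not0_implies_Suc)
    then have "eval_rf r [s] y" using eval_rf_iff_steps by blast
    then have "y = k" using ek r by (simp add: s_def)
    define vs where "vs = (dec k :: nat list list)"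
    have Fvs: "fset_decode k = map alg_decode ` set vs"
      using fset_decode_enc[of vs] by (simp add: vs_def)
    have cl: "close_list E vs n' D us" using a(5) y \<open>y = k\<close> by (simp add: vs_def)
    \<comment> \<open>The witness carries its own number of qubits \<open>n'\<close>. A vector of
      the nonempty output, whose length is tied to both numbers, identifies it with
      \<open>n\<close>.\<close>
    obtain v where v: "v \<in> set vs" using ne Fvs by (cases vs) auto
    have "length v = 2 ^ n'" using cl v by (auto simp: close_list_def)
    moreover have "length (map alg_decode v) = 2 ^ n"
      using k(2) v unfolding orthonormal_alg_def Fvs by blast
    ultimately have n': "n' = n" by simp
    have "(\<Sum>v\<in>fset_decode k. Re (qform (2 ^ n) (\<rho> n) (\<lambda>i. v ! i))) - 1 / (2 * real E)
        \<le> (\<Sum>k<length us. Re (qform (2 ^ n) (\<rho> n) (evec us k)))"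
      using close_list_projection[OF _ _ a(4) E(1) Fvs k(2)] \<rho> a(1) cl
      unfolding n' is_state_def by blast
    also have "\<dots> = state_val \<rho> (mcode us (2 ^ n))"
      using special_proj_mcode(3)[of n us \<rho>] a(1) unfolding n' by simp
    also have "\<dots> = state_val \<rho> (?g (prod_encode (s, ?w)))"
      using witness_test_value[OF fa w] by (simp add: n')
    finally have "state_val \<rho> (?g (prod_encode (s, ?w))) > eps - 1 / (2 * real E)" using gt by linarith
    moreover have "1 / (2 * real E) < eps / 2" using E by simp
    ultimately have "state_val \<rho> (?g (prod_encode (s, ?w))) > eps / 2" by linarith
    moreover have "mat_dim (?g (prod_encode (s, ?w))) = 2 ^ n"
      using witness_test_value[OF fa w] by (simp add: n' mat_dim_mcode)
    ultimately show ?thesis by blast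
  qed
  define M where "M = {m. state_val \<rho> (?g m) > eps / 2}"
  have "infinite M"
  proof
    assume "finite M"
    \<comment> \<open>A finite \<open>M\<close> would bound the dimensions, but \<open>neg\<close>
      supplies failures at arbitrarily large \<open>n\<close>, each yielding an index of dimension
      \<open>2 ^ n\<close>.\<close>
    then have "finite ((\<lambda>m. mat_dim (?g m)) ` M)" by simp
    then obtain b where b: "\<And>m. m \<in> M \<Longrightarrow> mat_dim (?g m) \<le> b" by (metis finite_nat_set_iff_bounded_le imageI)
    obtain n where n: "n \<ge> b" "QK U eps n (\<rho> n) < ereal (real n + c)" using neg by (meson not_le)
    obtain m where "m \<in> M" "mat_dim (?g m) = 2 ^ n" using key[OF n(2)] by (auto simp: M_def)
    then have "2 ^ n \<le> b" using b by metis
    then show False using n(1) less_exp[of n] by linarith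
  qed
  then have "fails_test \<rho> ?g (eps / 2)" by (simp add: fails_test_def M_def INFM_iff_infinite)
  moreover have "strong_solovay_test ?g" using strong_solovay_witness_test[OF U r] .
  ultimately show False using wsr eps unfolding weak_solovay_random_def by (metis half_gt_zero)
qed

section \<open>From a strong Solovay test to short descriptions\<close>

text \<open>With \<open>T = 4 * E * d * d\<close> the entries are known up to
  \<open>\<eta> = 2 / Suc T\<close>, and the value of a state changes by at most
  \<open>d * d * \<eta> \<le> 1 / (2 * E)\<close>.\<close>

definition matches :: "nat \<Rightarrow> nat \<Rightarrow> nat \<times> gvec list \<Rightarrow> bool" where
  "matches E k w \<longleftrightarrow> length (dec k :: nat list list) = 2 ^ fst w \<and> ortho_list (2 ^ fst w) (snd w) \<and>
     (\<forall>i<2 ^ fst w. \<forall>j<2 ^ fst w. near (get (get (dec k :: nat list list) i) j)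
        (fst (pentry (snd w) i j)) (snd (pentry (snd w) i j)) (4 * E * 2 ^ fst w * 2 ^ fst w))"

lemma computable_matches [comp_intros]:
  assumes "computable f" "computable g"
  shows "computable (\<lambda>x. matches E (f x) (g x))"
  unfolding matches_def by (intro comp_intros assms assms[THEN computable_comp])

lemma mat_rows_dec: "mat_rows k = map (map alg_decode) (dec k :: nat list list)"
  using mat_rows_enc[of "dec k"] by simp

lemma mat_decode_get:
  assumes "special_proj_code k" "i < mat_dim k" "j < mat_dim k"
  shows "mat_decode k i j = alg_decode (get (get (dec k :: nat list list) i) j)"
proof -
  have i: "i < length (dec k :: nat list list)" using assms(2) by (simp add: mat_dim_def mat_rows_dec)
  then have "map alg_decode (dec k ! i) \<in> set (mat_rows k)" by (simp add: mat_rows_dec)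
  then have "length (map alg_decode (dec k ! i)) = mat_dim k"
    using assms(1) unfolding special_proj_code_def by blast
  then show ?thesis using i assms(3) by (simp add: mat_decode_def mat_rows_dec get_nth)
qed

lemma special_proj_decomposition:
  assumes "special_proj_code k"
  obtains n r e where "mat_dim k = 2 ^ n" "orthonormal (2 ^ n) r e"
    "\<And>i j. i < 2 ^ n \<Longrightarrow> j < 2 ^ n \<Longrightarrow> mat_decode k i j = pmat r e i j"
    "tau_proj k = real r / 2 ^ n"
proof -
  obtain n where n: "mat_dim k = 2 ^ n" using assms by (auto simp: special_proj_code_def)
  have "\<exists>r e. orthonormal (2 ^ n) r e \<and> (\<forall>i<2 ^ n. \<forall>j<2 ^ n. mat_decode k i j = pmat r e i j)"
    using assms by (intro projection_decomposition) (auto simp: special_proj_code_def n)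
  then obtain r e where re: "orthonormal (2 ^ n) r e" "\<forall>i<2 ^ n. \<forall>j<2 ^ n. mat_decode k i j = pmat r e i j"
    by blast
  have "mtrace (2 ^ n) (mat_decode k) = of_nat r"
    unfolding mtrace_pmat[OF re(1), symmetric] using re(2) by (intro mtrace_cong) auto
  then have "tau_proj k = real r / 2 ^ n" by (simp add: tau_proj_def n)
  then show ?thesis using that[OF n re(1)] re(2) by blast
qed

lemma exists_matches:
  assumes "special_proj_code k"
  shows "\<exists>w. matches E k w"
proof -
  obtain n r e where n: "mat_dim k = 2 ^ n" "orthonormal (2 ^ n) r e"
    "\<And>i j. i < 2 ^ n \<Longrightarrow> j < 2 ^ n \<Longrightarrow> mat_decode k i j = pmat r e i j"
    using special_proj_decomposition[OF assms] by metis
  define T where "T = 4 * E * 2 ^ n * 2 ^ n"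
  obtain us where us: "length us = r" "ortho_list (2 ^ n) us"
    "\<forall>i<2 ^ n. \<forall>j<2 ^ n. cmod (pmat r (evec us) i j - pmat r e i j) < 1 / real (Suc T)"
    using ortho_list_approx[OF n(2), of "1 / real (Suc T)"] by auto
  have "near (get (get (dec k :: nat list list) i) j) (fst (pentry us i j)) (snd (pentry us i j)) T"
    if ij: "i < 2 ^ n" "j < 2 ^ n" for i j
  proof (rule imp_near)
    show "snd (pentry us i j) > 0" using pentry_pmat(1)[OF us(2) ij] .
    have "alg_decode (get (get (dec k :: nat list list) i) j) = pmat r e i j"
      using mat_decode_get[OF assms] n ij by simp
    then show "cmod (alg_decode (get (get (dec k :: nat list list) i) j) -
        gval (fst (pentry us i j)) / of_int (snd (pentry us i j))) < 1 / of_nat (Suc T)"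
      using us ij by (simp add: pentry_pmat(2)[OF us(2) ij] norm_minus_commute)
  qed
  moreover have "length (dec k :: nat list list) = 2 ^ n" using n(1) by (simp add: mat_dim_def mat_rows_dec)
  ultimately have "matches E k (n, us)" using us by (simp add: matches_def T_def)
  then show ?thesis ..
qed

text \<open>Traces of projections are integers, so a difference below 1 already forces equal ranks.
  Hence the trace of a test projection is read off exactly from the list although its entries are
  known only approximately.\<close>

lemma matches_projection:
  assumes "special_proj_code k" "matches E k (n, us)" "E > 0" "is_state \<rho>"
  shows "mat_dim k = 2 ^ n" "tau_proj k = real (length us) / 2 ^ n"
    "state_val \<rho> k - 1 / (2 * real E) \<le> (\<Sum>l<length us. Re (qform (2 ^ n) (\<rho> n) (evec us l)))"
proof -
  define d where "d = (2::nat) ^ n"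
  have d1: "real d \<ge> 1" by (simp add: d_def)
  have ol: "ortho_list d us" using assms(2) by (simp add: matches_def d_def)
  have dim: "mat_dim k = d" using assms(2) by (simp add: matches_def mat_dim_def mat_rows_dec d_def)
  then show "mat_dim k = 2 ^ n" by (simp add: d_def)
  define T where "T = 4 * E * d * d"
  define \<eta> where "\<eta> = 2 / real (Suc T)"
  have d0: "real d > 0" using d1 by linarith
  have E1: "real E \<ge> 1" using assms(3) by simp
  have d\<eta>: "real d * real d * \<eta> \<le> 1 / (2 * real E)"
  proof -
    have "real d * real d * (2 * (2 * real E)) \<le> real (Suc T)" by (simp add: T_def)
    then show ?thesis using assms(3) by (simp add: \<eta>_def field_simps)
  qed
  have \<eta>0: "\<eta> > 0" by (simp add: \<eta>_def)
  have close: "cmod (mat_decode k i j - pmat (length us) (evec us) i j) \<le> \<eta>" if ij: "i < d" "j < d" for i j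
  proof -
    have "near (get (get (dec k :: nat list list) i) j) (fst (pentry us i j)) (snd (pentry us i j)) T"
      using assms(2) ij by (simp add: matches_def d_def T_def)
    from near_imp[OF pentry_pmat(1)[OF ol ij] this]
    show ?thesis
      using mat_decode_get[OF assms(1)] ij by (simp add: dim pentry_pmat(2)[OF ol ij] \<eta>_def)
  qed
  obtain n' r e where "mat_dim k = 2 ^ n'" and o: "orthonormal (2 ^ n') r e"
    and ent: "\<And>i j. i < 2 ^ n' \<Longrightarrow> j < 2 ^ n' \<Longrightarrow> mat_decode k i j = pmat r e i j"
    and tau: "tau_proj k = real r / 2 ^ n'"
    using special_proj_decomposition[OF assms(1)] by metis
  then have n': "2 ^ n' = d" "n' = n" using dim by (auto simp: d_def)
  have o': "orthonormal d (length us) (evec us)" by (rule orthonormal_evec[OF ol])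
  have "cmod (complex_of_real (real r - real (length us))) = cmod (mtrace d (pmat r e) - mtrace d (pmat (length us) (evec us)))"
    using mtrace_pmat[OF o'] mtrace_pmat[OF o] by (simp add: n'(1))
  also have "\<dots> = cmod (\<Sum>i<d. pmat r e i i - pmat (length us) (evec us) i i)"
    by (simp add: mtrace_def sum_subtractf)
  also have "\<dots> \<le> (\<Sum>i<d. \<eta>)"
    using close ent by (intro sum_norm_le) (auto simp: n'(1))
  also have "\<dots> = real d * \<eta>" by simp
  also have "\<dots> \<le> real d * real d * \<eta>" using d1 \<eta>0 by (simp add: mult_le_cancel_right1)
  also have "\<dots> < 1"
  proof -
    have "1 / (2 * real E) < 1" using E1 by (simp add: field_simps)
    then show ?thesis using d\<eta> by linarith
  qed
  finally have "\<bar>real r - real (length us)\<bar> < 1" by (simp only: norm_of_real real_norm_def)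
  then have "r = length us" by linarith
  then show "tau_proj k = real (length us) / 2 ^ n" using tau n' by simp
  have the: "(THE m. d = 2 ^ m) = n" by (rule the_equality) (auto simp: d_def)
  have den: "density_matrix n (\<rho> n)" using assms(4) by (simp add: is_state_def)
  define X where "X = mtrace d (mmult d (\<rho> n) (mat_decode k)) - mtrace d (mmult d (\<rho> n) (pmat (length us) (evec us)))"
  have "cmod X \<le> real d * real d * \<eta>"
    unfolding X_def using close density_matrix_entries[OF den] by (intro mtrace_mmult_close) (auto simp: d_def)
  then have "Re X \<le> 1 / (2 * real E)" using complex_Re_le_cmod[of X] d\<eta> by linarith
  then show "state_val \<rho> k - 1 / (2 * real E) \<le> (\<Sum>l<length us. Re (qform (2 ^ n) (\<rho> n) (evec us l)))"
    unfolding state_val_def dim the X_def mtrace_mmult_pmat by (simp add: d_def)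
qed

text \<open>Unlike the entries of a projection, the normalised basis vectors involve square roots of
  integers; this is why \<open>alg_code\<close> allows any positive \<open>N\<close>.\<close>

lemma fcode_properties:
  assumes "ortho_list (2 ^ n) us"
  shows "orthonormal_alg (2 ^ n) (fset_decode (fcode us))" "card (fset_decode (fcode us)) = length us"
    "(\<Sum>v\<in>fset_decode (fcode us). Re (qform (2 ^ n) A (\<lambda>i. v ! i))) = (\<Sum>k<length us. Re (qform (2 ^ n) A (evec us k)))"
proof -
  define d where "d = (2::nat) ^ n"
  have us: "\<And>u. u \<in> set us \<Longrightarrow> length u = d \<and> gnormv u > 0" using assms by (simp add: ortho_list_def d_def)
  define f where "f k = map (evec us k) [0..<d]" for k
  have code: "map alg_decode (map (\<lambda>z. alg_code z (gnormv (us ! k))) (us ! k)) = f k" if "k < length us" for k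
    using us[of "us ! k"] that by (intro nth_equalityI) (auto simp: f_def alg_decode_alg_code evec_def)
  have "fset_decode (fcode us) = map alg_decode ` set (map (\<lambda>u. map (\<lambda>z. alg_code z (gnormv u)) u) us)"
    unfolding fcode_def fset_decode_enc ..
  also have "\<dots> = (\<lambda>u. map alg_decode (map (\<lambda>z. alg_code z (gnormv u)) u)) ` set us"
    unfolding set_map image_image ..
  also have "set us = (\<lambda>k. us ! k) ` {..<length us}" by (auto simp: set_conv_nth)
  also have "(\<lambda>u. map alg_decode (map (\<lambda>z. alg_code z (gnormv u)) u)) ` (\<lambda>k. us ! k) ` {..<length us} = f ` {..<length us}"
    unfolding image_image using code by (intro image_cong) auto
  finally have F: "fset_decode (fcode us) = f ` {..<length us}" .
  have o: "orthonormal d (length us) (evec us)" using orthonormal_evec assms by (simp add: d_def)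
  have ipf: "cinner (f k) (f l) = (if k = l then 1 else 0)" if "k < length us" "l < length us" for k l
  proof -
    have "cinner (f k) (f l) = ip d (evec us k) (evec us l)"
      unfolding cinner_def ip_def by (intro sum.cong) (auto simp: f_def)
    then show ?thesis using o that by (simp add: orthonormal_def)
  qed
  have inj: "inj_on f {..<length us}"
    by (rule inj_onI) (metis ipf lessThan_iff zero_neq_one)
  have alg: "algebraic x" if "v \<in> fset_decode (fcode us)" "x \<in> set v" for v x
    using that unfolding fcode_def fset_decode_enc by (auto simp: algebraic_alg_decode)
  show "orthonormal_alg (2 ^ n) (fset_decode (fcode us))"
    unfolding orthonormal_alg_def
  proof (intro conjI ballI)
    fix v assume v: "v \<in> fset_decode (fcode us)"
    then obtain k where k: "k < length us" "v = f k" by (auto simp: F)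
    then show "length v = 2 ^ n" by (simp add: f_def d_def)
    show "algebraic x" if "x \<in> set v" for x using alg v that .
    fix w assume "w \<in> fset_decode (fcode us)"
    then obtain l where l: "l < length us" "w = f l" by (auto simp: F)
    then show "cinner v w = (if v = w then 1 else 0)"
      using ipf k inj_onD[OF inj, of k l] by auto
  qed
  show "card (fset_decode (fcode us)) = length us" unfolding F by (simp add: card_image inj)
  have "(\<Sum>v\<in>fset_decode (fcode us). Re (qform (2 ^ n) A (\<lambda>i. v ! i))) = (\<Sum>k<length us. Re (qform (2 ^ n) A (\<lambda>i. f k ! i)))"
    unfolding F by (simp add: sum.reindex[OF inj])
  also have "\<dots> = (\<Sum>k<length us. Re (qform (2 ^ n) A (evec us k)))"
    by (intro sum.cong refl arg_cong[of _ _ Re]) (simp add: qform_def f_def d_def)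
  finally show "(\<Sum>v\<in>fset_decode (fcode us). Re (qform (2 ^ n) A (\<lambda>i. v ! i))) = (\<Sum>k<length us. Re (qform (2 ^ n) A (evec us k)))" .
qed

section \<open>Binary words of fixed length and a prefix-free code for weighted requests\<close>

primrec bits :: "nat \<Rightarrow> nat \<Rightarrow> bool list" where
  "bits 0 j = []"
| "bits (Suc L) j = odd (j div 2 ^ L) # bits L j"

fun bval :: "bool list \<Rightarrow> nat" where
  "bval [] = 0"
| "bval (b # s) = (if b then 2 ^ length s else 0) + bval s"

lemma length_bits [simp]: "length (bits L j) = L"
  by (induction L) auto

lemma bval_less: "bval s < 2 ^ length s"
  by (induction s) auto

lemma bval_append: "bval (s @ t) = bval s * 2 ^ length t + bval t"
  by (induction s) (auto simp: power_add algebra_simps)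

lemma bval_bits: "bval (bits L j) = j mod 2 ^ L"
proof (induction L)
  case (Suc L)
  have "j mod 2 ^ Suc L = 2 ^ L * (j div 2 ^ L mod 2) + j mod 2 ^ L"
    using mod_mult2_eq[of j "2 ^ L" 2] by (simp add: mult.commute)
  then show ?case using Suc by (auto simp: odd_iff_mod_2_eq_one even_iff_mod_2_eq_zero)
qed simp

text \<open>\<open>bits\<close> puts the most significant bit in front, and \<open>bs_code\<close>
  doubles the code of the tail. Halving \<open>j\<close> therefore delivers the bits in the order in
  which the word grows at its front, and one primitive recursion suffices.\<close>

lemma bs_code_bits:
  "rec_nat (j, 0) (\<lambda>i st. (fst st div 2, (if 2 * (fst st div 2) = fst st then 1 else 2) + 2 * snd st)) L
    = (j div 2 ^ L, bs_code (bits L j))"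
proof (induction L)
  case (Suc L)
  have "2 * (x div 2) = x \<longleftrightarrow> even x" for x :: nat by presburger
  then show ?case using Suc by (simp add: div_mult2_eq mult.commute[of 2])
qed simp

lemma computable_bs_code_bits [comp_intros]:
  assumes "computable f" "computable g"
  shows "computable (\<lambda>x. bs_code (bits (f x) (g x)))"
proof -
  have "computable (\<lambda>x. snd (rec_nat (g x, 0 :: nat) (\<lambda>i st. (fst st div 2,
      (if 2 * (fst st div 2) = fst st then 1 else 2) + 2 * snd st)) (f x)))"
    by (intro comp_intros assms)
  then show ?thesis by (simp add: bs_code_bits)
qed

text \<open>An online Shannon-Fano-Elias code: the word of the \<open>m\<close>-th request is a dyadic interval of length
  \<open>1 / 2 ^ L\<close> inside the half-open interval of length \<open>weight m\<close> that starts at the sum of the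
  previous weights. Distinct requests get disjoint intervals, so the code is prefix-free.\<close>

locale weighted_requests =
  fixes num ex :: "nat \<Rightarrow> nat"
  assumes num_comp: "computable num" and ex_comp: "computable ex"
    and bounded: "(\<Sum>m<M. real (num m) / 2 ^ ex m) \<le> 1"
begin

definition weight :: "nat \<Rightarrow> real" where "weight m = real (num m) / 2 ^ ex m"

text \<open>Numerator and unreduced positive denominator of the sum of the weights of the earlier
  requests.\<close>

definition partial :: "nat \<Rightarrow> nat \<times> nat" where
  "partial m = rec_nat (0, 1) (\<lambda>i st. (fst st * 2 ^ ex i + num i * snd st, snd st * 2 ^ ex i)) m"

text \<open>Least \<open>L\<close> with \<open>2 / 2 ^ L\<close> at most the weight: an interval of
  twice the grid width contains a full grid cell. The disjunct \<open>num m = 0\<close> keeps the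
  search total for empty requests.\<close>

definition wlen :: "nat \<Rightarrow> nat" where
  "wlen m = (LEAST L. num m = 0 \<or> 2 ^ (ex m + 1) \<le> num m * 2 ^ L)"

text \<open>The first grid point at or after the start of the interval.\<close>

definition windex :: "nat \<Rightarrow> nat" where
  "windex m = (LEAST j. fst (partial m) * 2 ^ wlen m \<le> j * snd (partial m))"

definition word :: "nat \<Rightarrow> bool list" where
  "word m = bits (wlen m) (windex m)"

lemma partial_pos: "snd (partial m) > 0"
  by (induction m) (auto simp: partial_def)

lemma partial_sum: "real (fst (partial m)) / real (snd (partial m)) = (\<Sum>i<m. weight i)"
proof (induction m)
  case 0
  then show ?case by (simp add: partial_def)
next
  case (Suc m)
  define a b where "a = fst (partial m)" and "b = snd (partial m)"
  have b: "real b > 0" using partial_pos[of m] by (simp add: b_def)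
  have "partial (Suc m) = (a * 2 ^ ex m + num m * b, b * 2 ^ ex m)"
    by (simp add: partial_def a_def b_def)
  then have "real (fst (partial (Suc m))) / real (snd (partial (Suc m))) = real a / real b + real (num m) / 2 ^ ex m"
    using b by (simp add: add_divide_distrib)
  then show ?case using Suc by (simp add: a_def b_def weight_def)
qed

lemma wlen_ex: "\<exists>L. num m = 0 \<or> 2 ^ (ex m + 1) \<le> num m * 2 ^ L"
  by (rule exI[of _ "ex m + 1"]) (cases "num m", auto)

lemma windex_ex: "\<exists>j. fst (partial m) * 2 ^ wlen m \<le> j * snd (partial m)"
  using partial_pos[of m]
  by (intro exI[of _ "fst (partial m) * 2 ^ wlen m"]) (cases "snd (partial m)", auto)

lemma computable_partial: "computable partial"
  unfolding partial_def[abs_def]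
  by (intro comp_intros num_comp[THEN computable_comp] ex_comp[THEN computable_comp])

lemma computable_wlen: "computable wlen"
  unfolding wlen_def[abs_def]
  by (intro comp_intros num_comp[THEN computable_comp] ex_comp[THEN computable_comp] wlen_ex)

lemma computable_windex: "computable windex"
  unfolding windex_def[abs_def]
  by (intro comp_intros computable_partial[THEN computable_comp] computable_wlen[THEN computable_comp] windex_ex)

lemma computable_bs_code_word: "computable (\<lambda>m. bs_code (word m))"
  unfolding word_def by (intro comp_intros computable_wlen computable_windex)

lemma wlen_le: "num m > 0 \<Longrightarrow> 2 ^ (ex m + 1) \<le> num m * 2 ^ wlen m"
  using LeastI_ex[OF wlen_ex[of m]] by (simp add: wlen_def)

lemma weight_le_1: "weight m \<le> 1"
proof -
  have "weight m \<le> (\<Sum>i<Suc m. weight i)"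
    by (rule member_le_sum) (auto simp: weight_def)
  also have "\<dots> \<le> 1" unfolding weight_def by (rule bounded)
  finally show ?thesis .
qed

text \<open>Minimality of the word length gives
  \<open>num m * 2 ^ (wlen m - 1) < 2 ^ (ex m + 1)\<close>, so rounding costs less than two bits.
  Word length 0 has no predecessor and is covered by the weight being at most 1.\<close>

lemma length_word_bound:
  assumes "num m > 0"
  shows "real (length (word m)) + log 2 (real (num m)) < real (ex m) + 2"
proof -
  have "num m * 2 ^ wlen m < 2 ^ (ex m + 2)"
  proof (cases "wlen m")
    case 0
    have "real (num m) \<le> 2 ^ ex m" using weight_le_1[of m] by (simp add: weight_def field_simps)
    then have "num m \<le> 2 ^ ex m" by (metis of_nat_le_iff of_nat_numeral of_nat_power)
    moreover have "0 < (2::nat) ^ ex m" "(2::nat) ^ (ex m + 2) = 4 * 2 ^ ex m" by (simp_all add: power_add)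
    ultimately have "num m < 2 ^ (ex m + 2)" by linarith
    then show ?thesis using 0 by simp
  next
    case (Suc L)
    then have "\<not> 2 ^ (ex m + 1) \<le> num m * 2 ^ L"
      using not_less_Least[of L "\<lambda>L. num m = 0 \<or> 2 ^ (ex m + 1) \<le> num m * 2 ^ L"] by (simp add: wlen_def)
    then show ?thesis using Suc by simp
  qed
  then have "real (num m * 2 ^ wlen m) < real (2 ^ (ex m + 2))" by (simp only: of_nat_less_iff)
  then have "log 2 (real (num m) * 2 ^ wlen m) < log 2 (2 ^ (ex m + 2))"
    using assms by simp
  also have "\<dots> = real (ex m + 2)" by (rule log_pow_cancel) auto
  finally show ?thesis using assms by (simp add: word_def log_mult log_nat_power)
qed

text \<open>The chosen grid point exceeds the start by less than one cell; with the cell itself this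
  makes less than \<open>2 / 2 ^ wlen m\<close>, which is at most the weight.\<close>

lemma word_interval:
  assumes "num m > 0"
  shows "(\<Sum>i<m. weight i) \<le> real (windex m) / 2 ^ wlen m"
    "(real (windex m) + 1) / 2 ^ wlen m \<le> (\<Sum>i<Suc m. weight i)"
    "windex m < 2 ^ wlen m"
proof -
  define a b j where "a = fst (partial m)" and "b = snd (partial m)" and "j = windex m"
  define P where "P = (2::real) ^ wlen m"
  have P: "P > 0" by (simp add: P_def)
  have b: "real b > 0" using partial_pos[of m] by (simp add: b_def)
  have s: "(\<Sum>i<m. weight i) = real a / real b" using partial_sum[of m] by (simp add: a_def b_def)
  have "a * 2 ^ wlen m \<le> j * b" using LeastI_ex[OF windex_ex[of m]] by (simp add: a_def b_def j_def windex_def)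
  then have "real (a * 2 ^ wlen m) \<le> real (j * b)" by (simp only: of_nat_le_iff)
  then have lo: "real a * P \<le> real j * real b" by (simp add: P_def)
  then show 1: "(\<Sum>i<m. weight i) \<le> real (windex m) / 2 ^ wlen m"
    using b P by (simp add: s j_def[symmetric] P_def[symmetric] field_simps)
  have "real j * real b < real a * P + real b"
  proof (cases j)
    case 0
    have "0 \<le> real a * P" using P by simp
    then show ?thesis using 0 b by simp
  next
    case (Suc i)
    then have "\<not> a * 2 ^ wlen m \<le> i * b"
      using not_less_Least[of i "\<lambda>j. fst (partial m) * 2 ^ wlen m \<le> j * snd (partial m)"]
      by (simp add: a_def b_def j_def windex_def)
    then have "real (i * b) < real (a * 2 ^ wlen m)" by (simp only: not_le of_nat_less_iff)
    then show ?thesis using Suc by (simp add: P_def algebra_simps)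
  qed
  then have "real j * real b / (P * real b) < (real a * P + real b) / (P * real b)"
    using b P by (intro divide_strict_right_mono) auto
  then have "real j / P < real a / real b + 1 / P" using b P by (simp add: add_divide_distrib)
  then have hi: "(real j + 1) / P < real a / real b + 2 / P" by (simp add: add_divide_distrib)
  have "real (2 ^ (ex m + 1)) \<le> real (num m * 2 ^ wlen m)" using wlen_le[OF assms] by (simp only: of_nat_le_iff)
  then have "2 * 2 ^ ex m \<le> real (num m) * P" by (simp add: P_def)
  then have "2 / P \<le> weight m" using P by (simp add: weight_def field_simps)
  then show 2: "(real (windex m) + 1) / 2 ^ wlen m \<le> (\<Sum>i<Suc m. weight i)"
    using hi by (simp add: s j_def P_def)
  have "(\<Sum>i<Suc m. weight i) \<le> 1" using bounded[of "Suc m"] by (simp add: weight_def)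
  then have "(real j + 1) / P \<le> 1" using 2 unfolding j_def P_def by linarith
  then have "real (j + 1) \<le> real (2 ^ wlen m)" using P by (simp add: P_def divide_le_eq)
  then have "j + 1 \<le> 2 ^ wlen m" by (simp only: of_nat_le_iff)
  then show "windex m < 2 ^ wlen m" by (simp add: j_def)
qed

text \<open>If one word extends the other, the left endpoint \<open>p\<close> of the longer word's
  dyadic interval lies in both dyadic intervals, hence in the weight intervals of both requests.
  These are disjoint for distinct requests.\<close>

lemma word_prefix_free:
  assumes "num m > 0" "num m' > 0" "word m' = word m @ \<tau>"
  shows "m = m' \<and> \<tau> = []"
proof -
  define j j' where "j = windex m" and "j' = windex m'"
  have len: "wlen m' = wlen m + length \<tau>" using arg_cong[OF assms(3), of length] by (simp add: word_def)
  have "bval (word m) = j" "bval (word m') = j'"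
    using word_interval(3)[OF assms(1)] word_interval(3)[OF assms(2)]
    by (simp_all add: word_def bval_bits j_def j'_def)
  then have j': "j' = j * 2 ^ length \<tau> + bval \<tau>" using assms(3) by (simp add: bval_append)
  define p where "p = real j' / 2 ^ wlen m'"
  have p_eq: "p = (real j + real (bval \<tau>) / 2 ^ length \<tau>) / 2 ^ wlen m"
    by (simp add: p_def j' len power_add add_divide_distrib mult.commute)
  have "real (bval \<tau>) / 2 ^ length \<tau> < 1"
  proof -
    have "real (bval \<tau>) < real (2 ^ length \<tau>)" using bval_less[of \<tau>] by (simp only: of_nat_less_iff)
    then show ?thesis by simp
  qed
  then have p1: "real j / 2 ^ wlen m \<le> p" "p < (real j + 1) / 2 ^ wlen m"
    unfolding p_eq by (auto intro!: divide_right_mono divide_strict_right_mono)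
  have p2: "real j' / 2 ^ wlen m' \<le> p" "p < (real j' + 1) / 2 ^ wlen m'"
    unfolding p_def by (auto intro!: divide_strict_right_mono)
  have mono: "(\<Sum>i<x. weight i) \<le> (\<Sum>i<y. weight i)" if "x \<le> y" for x y
    using that by (intro sum_mono2) (auto simp: weight_def)
  have in1: "(\<Sum>i<m. weight i) \<le> p" "p < (\<Sum>i<Suc m. weight i)"
    using word_interval(1,2)[OF assms(1)] p1 unfolding j_def by linarith+
  have in2: "(\<Sum>i<m'. weight i) \<le> p" "p < (\<Sum>i<Suc m'. weight i)"
    using word_interval(1,2)[OF assms(2)] p2 unfolding j'_def by linarith+
  have "m = m'"
  proof (rule ccontr)
    assume "m \<noteq> m'"
    then consider "Suc m \<le> m'" | "Suc m' \<le> m" by linarith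
    then show False
    proof cases
      case 1
      then show False using mono[OF 1] in1 in2 by linarith
    next
      case 2
      then show False using mono[OF 2] in1 in2 by linarith
    qed
  qed
  then show ?thesis using assms(3) by simp
qed

text \<open>The machine searches for a nonempty request whose word is its input. Distinct requests
  have distinct words, so the least index found is the intended one.\<close>

theorem request_machine:
  assumes "computable out"
  obtains M where "prefix_free_machine M" "\<And>m. num m > 0 \<Longrightarrow> M (word m) = Some (out m)"
proof -
  define P where "P x m \<longleftrightarrow> 0 < num m \<and> bs_code (word m) = x" for x m
  have "computable (\<lambda>p. P (fst p) (snd p))"
    unfolding P_def
    by (intro comp_intros num_comp[THEN computable_comp] computable_bs_code_word[THEN computable_comp])
  then obtain r where r: "\<And>x y. eval_rf r [x] y \<longleftrightarrow> (\<exists>m. P x m) \<and> y = out (LEAST m. P x m)"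
    using eval_rf_search[OF _ assms] by blast
  define M where "M \<sigma> = (if \<exists>m. P (bs_code \<sigma>) m then Some (out (LEAST m. P (bs_code \<sigma>) m)) else None)" for \<sigma>
  have P_word: "P (bs_code \<sigma>) m \<longleftrightarrow> 0 < num m \<and> word m = \<sigma>" for \<sigma> m
    using bs_code_inj by (auto simp: P_def)
  have "machine_computable M"
    unfolding machine_computable_def by (intro exI[of _ r]) (auto simp: r M_def)
  moreover have "\<tau> = []" if M: "M \<sigma> \<noteq> None" "M (\<sigma> @ \<tau>) \<noteq> None" for \<sigma> \<tau>
  proof -
    obtain m where "0 < num m" "word m = \<sigma>" using M(1) by (auto simp: M_def P_word split: if_splits)
    moreover obtain m' where "0 < num m'" "word m' = \<sigma> @ \<tau>"
      using M(2) by (auto simp: M_def P_word split: if_splits)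
    ultimately show ?thesis using word_prefix_free[of m m' \<tau>] by simp
  qed
  ultimately have "prefix_free_machine M" by (auto simp: prefix_free_machine_def)
  moreover have "M (word m) = Some (out m)" if m: "num m > 0" for m
  proof -
    have "P (bs_code (word m)) m" using m by (simp add: P_def)
    then have "P (bs_code (word m)) (LEAST m'. P (bs_code (word m)) m')" by (rule LeastI)
    then have "(LEAST m'. P (bs_code (word m)) m') = m"
      using word_prefix_free[of _ m "[]"] m unfolding P_word by simp
    then show ?thesis using \<open>P (bs_code (word m)) m\<close> by (auto simp: M_def)
  qed
  ultimately show ?thesis by (rule that)
qed

end

theorem QK_imp_weak_solovay_random:
  assumes U: "universal_pf_machine U" and \<rho>: "is_state \<rho>"
    and qk: "\<forall>eps>0. \<forall>c>(0::real). \<exists>n0. \<forall>n\<ge>n0. QK U eps n (\<rho> n) \<ge> ereal (real n + c)"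
  shows "weak_solovay_random \<rho>"
proof (rule ccontr)
  assume "\<not> weak_solovay_random \<rho>"
  then obtain g eps where test: "strong_solovay_test g" and eps: "eps > 0" and fails: "fails_test \<rho> g eps"
    by (auto simp: weak_solovay_random_def)
  have g: "computable g" and sp: "\<And>m. special_proj_code (g m)" and summ: "summable (\<lambda>m. tau_proj (g m))"
    using test by (auto simp: strong_solovay_test_def computable_nat_iff)
  obtain E :: nat where E: "E > 0" "1 / real E < eps"
    using eps by (metis divide_inverse mult_1 reals_Archimedean zero_less_Suc)
  define w where "w m = (dec (LEAST w. matches E (g m) (dec w)) :: nat \<times> gvec list)" for m
  have ex: "\<exists>w. matches E (g m) (dec w)" for m using exists_matches[OF sp] by (metis dec_enc)
  have w: "matches E (g m) (w m)" for m unfolding w_def using ex by (rule LeastI_ex)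
  have w_comp: "computable w"
    unfolding w_def[abs_def] by (intro comp_intros g[THEN computable_comp] ex)
  define n where "n m = fst (w m)" for m
  define us where "us m = snd (w m)" for m
  have nus: "matches E (g m) (n m, us m)" for m using w by (simp add: n_def us_def)
  note proj = matches_projection[OF sp nus E(1) \<rho>]
  have tau: "tau_proj (g m) = real (length (us m)) / 2 ^ n m" for m by (rule proj(2))
  \<comment> \<open>Adding \<open>C\<close> to every exponent scales the total weight to at most 1,
    at the price of \<open>C\<close> further bits per word.\<close>
  obtain C :: nat where C: "(\<Sum>m. tau_proj (g m)) \<le> 2 ^ C"
    by (meson less_imp_le one_less_numeral_iff real_arch_pow semiring_norm(76))
  interpret weighted_requests "\<lambda>m. length (us m)" "\<lambda>m. n m + C"
  proof
    show "computable (\<lambda>m. length (us m))" unfolding us_def by (intro comp_intros w_comp)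
    show "computable (\<lambda>m. n m + C)" unfolding n_def by (intro comp_intros w_comp)
    fix M
    have "(\<Sum>m<M. tau_proj (g m)) \<le> (\<Sum>m. tau_proj (g m))"
      using summ by (intro sum_le_suminf) (auto simp: tau)
    then have "(\<Sum>m<M. tau_proj (g m)) / 2 ^ C \<le> 1" using C by simp
    moreover have "(\<Sum>m<M. real (length (us m)) / 2 ^ (n m + C)) = (\<Sum>m<M. tau_proj (g m)) / 2 ^ C"
      by (simp add: tau sum_divide_distrib power_add)
    ultimately show "(\<Sum>m<M. real (length (us m)) / 2 ^ (n m + C)) \<le> 1" by simp
  qed
  have "computable (\<lambda>m. fcode (us m))" unfolding us_def by (intro comp_intros w_comp)
  then obtain M where M: "prefix_free_machine M" "\<And>m. length (us m) > 0 \<Longrightarrow> M (word m) = Some (fcode (us m))"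
    by (rule request_machine) blast
  obtain \<pi> where \<pi>: "\<And>\<sigma>. U (\<pi> @ \<sigma>) = M \<sigma>" using U M(1) unfolding universal_pf_machine_def by blast
  \<comment> \<open>The three summands are the prefix that makes \<open>U\<close> simulate
    \<open>M\<close>, the scaling of the weights, and the rounding in
    \<open>length_word_bound\<close>.\<close>
  define c where "c = real (length \<pi>) + real C + 2"
  have key: "length (us m) > 0 \<and> QK U (eps / 2) (n m) (\<rho> (n m)) < ereal (real (n m) + c)"
    if m: "state_val \<rho> (g m) > eps" for m
  proof -
    have "1 / (2 * real E) < eps / 2" using E by simp
    then have gt: "(\<Sum>l<length (us m). Re (qform (2 ^ n m) (\<rho> (n m)) (evec (us m) l))) > eps / 2"
      using proj(3)[of m] m by linarith
    then have pos: "length (us m) > 0" using eps by (cases "us m") auto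
    have ol: "ortho_list (2 ^ n m) (us m)" using nus[of m] by (simp add: matches_def)
    note fc = fcode_properties[OF ol]
    have "U (\<pi> @ word m) = Some (fcode (us m))" using \<pi> M(2)[OF pos] by simp
    then have "QK U (eps / 2) (n m) (\<rho> (n m)) \<le>
        ereal (real (length (\<pi> @ word m)) + log 2 (real (card (fset_decode (fcode (us m))))))"
      unfolding QK_def using fc gt
      by (intro Inf_lower CollectI exI[of _ "\<pi> @ word m"] exI[of _ "fset_decode (fcode (us m))"] conjI) auto
    also have "\<dots> < ereal (real (n m) + c)"
      using length_word_bound[OF pos] by (simp add: fc(2) c_def)
    finally show ?thesis using pos by blast
  qed
  obtain n0 where n0: "\<And>k. k \<ge> n0 \<Longrightarrow> QK U (eps / 2) k (\<rho> k) \<ge> ereal (real k + c)"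
    using qk[rule_format, of "eps / 2" c] eps by (auto simp: c_def add_pos_nonneg)
  \<comment> \<open>Projections on which \<open>\<rho>\<close> exceeds \<open>eps\<close> are
    nonzero and live on fewer than \<open>n0\<close> qubits, so each has trace at least
    \<open>1 / 2 ^ n0\<close>; summability permits only finitely many of these.\<close>
  have small: "n m < n0 \<and> length (us m) > 0" if "state_val \<rho> (g m) > eps" for m
    using key[OF that] n0[of "n m"] by (metis not_le)
  have "(\<lambda>m. tau_proj (g m)) \<longlonglongrightarrow> 0" using summ by (rule summable_LIMSEQ_zero)
  then have "\<forall>\<^sub>F m in sequentially. tau_proj (g m) < 1 / 2 ^ n0"
    by (rule order_tendstoD) simp
  then obtain N where N: "\<And>m. m \<ge> N \<Longrightarrow> tau_proj (g m) < 1 / 2 ^ n0" by (auto simp: eventually_sequentially)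
  obtain m where m: "m \<ge> N" "state_val \<rho> (g m) > eps"
    using fails unfolding fails_test_def INFM_nat_le by blast
  have "1 / 2 ^ n0 \<le> (1::real) / 2 ^ n m"
    using small[OF m(2)] by (intro divide_left_mono power_increasing) auto
  also have "\<dots> \<le> tau_proj (g m)"
    unfolding tau using small[OF m(2)] by (intro divide_right_mono) (auto simp: Suc_le_eq)
  finally show False using N[OF m(1)] by simp
qed

theorem mainTheorem8:
  fixes U :: "bool list \<Rightarrow> nat option" and \<rho> :: "nat \<Rightarrow> nat \<Rightarrow> nat \<Rightarrow> complex"
  assumes "universal_pf_machine U"
    and "is_state \<rho>"
  shows "weak_solovay_random \<rho> \<longleftrightarrow>
    (\<forall>eps>0. \<forall>c>(0::real). \<exists>n0. \<forall>n\<ge>n0. QK U eps n (\<rho> n) \<ge> ereal (real n + c))"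
  using weak_solovay_random_imp_QK[of U \<rho>] QK_imp_weak_solovay_random[OF assms] assms
  unfolding universal_pf_machine_def by blast

end
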